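(* Consider the Gaussian data-generating process with $K$ crowdworkers described in the context, and let $\hat\nu_t\in\mathbb{R}^K$, $t\ge 1$, be the aggregation weights produced by the predict-each-worker algorithm with hyperparameters $\Lambda,\lambda_\ell,\overline u,\overline\ell,r$ as defined in the context. If $\Lambda\succ 0$, $\overline\ell>0$ and $\lambda_\ell\ge 0$, then $$\lim_{t\to\infty}\left|\hat\nu_t^\top Y_t-\mathbb{E}[Z_t\mid Y_{1:\infty}]\right|=0\quad\text{almost surely.}$$
   Context: Setting. All random variables live on a probability space $(\Omega,\mathbb{F},\mathbb{P})$. $K$ is a positive integer (with $\mathbb{R}^0=\{0\}$ if $K=1$). In each round $t=1,2,\dots$ there is an outcome $Z_t\in\mathbb{R}$ and a vector $Y_t=(Y_{t,1},\dots,Y_{t,K})\in\mathbb{R}^K$ of crowdworker estimates; $Y_{1:\infty}=(Y_1,Y_2,\dots)$. The process $(Y_t)_{t\ge1}$ is exchangeable with $\mathbb{E}[Y_t]=0$. For each $t$, $Y_t$ consists of the first $K$ components of an exchangeable sequence $(\tilde Y_{t,k})_{k\ge1}$, and $Z_t=\lim_{n\to\infty}\frac1n\sum_{k=1}^n\tilde Y_{t,k}$, where the limit is assumed to exist almost surely. $\theta$ is a random variable conditioned on which $(Y_t)_{t\ge1}$ is iid, and it is minimal: $\theta$ determines the distribution $\mathbb{P}(Y_t\in\cdot\mid\theta)$ and vice versa. $\mathbf 1$ is the all-ones vector, and $Y_{t,-k}\in\mathbb{R}^{K-1}$ is $Y_t$ with the $k$th component removed. Gaussian data-generating process. With $\Delta_t=Y_t-Z_t\mathbf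 1$: $(Z_t)_{t\ge1}$ is iid Gaussian, $(\Delta_t)_{t\ge1}$ is independent of $(Z_t)_{t\ge1}$, and conditioned on $\theta$, $(\Delta_t)_{t\ge1}$ is iid zero-mean Gaussian with (almost surely) positive definite covariance matrix. Write $\overline v=\mathbb{V}[Z_t]$ for the variance of $Z_t$. Algorithm. The hyperparameters are a symmetric $(K-1)\times(K-1)$ matrix $\Lambda$, $\lambda_\ell\ge0$, $\overline u\in\mathbb{R}$, $\overline\ell\ge 0$, and $r>0$. For $t\ge1$ and $k\in\{1,\dots,K\}$, let $(\hat u^{(k)}_{t-1},\hat\ell^{(k)}_{t-1})$ be a minimizer over $(u,\ell)\in\mathbb{R}^{K-1}\times(0,\infty)$ of $$f(u,\ell)=\sum_{\tau<t}\left(\frac{(Y_{\tau,k}-u^\top Y_{\tau,-k})^2}{2\ell}+\frac{\log\ell}{2}\right)+\phi(u,\ell)+\varphi(\ell),$$ where $$\phi(u,\ell)=\frac{1}{2\ell}(u-\overline u\mathbf 1)^\top\Lambda(u-\overline u\mathbf 1)+\frac{K-1}{2}\log\ell$$ is, up to an additive constant, the negative log density at $u$ of $\mathcal N(\overline u\mathbf 1,\ell\Lambda^{-1})$, and $$\varphi(\ell)=\left(\frac{\lambda_\ell}{2}+1\right)\log\ell+\frac{(\lambda_\ell+K+1)\overline\ell}{2\ell}$$ is, up to an additive constant, the negative log density of the inverse gamma distribution with shape $\lambda_\ell/2$ and scale $(\lambda_\ell+K+1)\overline\ell/2$ (when $\lambda_\ell=0$ the formula for $\varphi$ is used as the definition).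 For each $k$ set $$\tilde\nu_{t,k}=\overline v\,\frac{1-\mathbf 1^\top\hat u^{(k)}_{t-1}}{\hat\ell^{(k)}_{t-1}},\qquad \tilde\nu_{1,k}=\overline v\,\frac{1-(K-1)\overline u}{\overline\ell},\qquad \gamma_t=\frac{r}{r+t-1},$$ and $\hat\nu_{t,k}=\gamma_t\tilde\nu_{1,k}+(1-\gamma_t)\tilde\nu_{t,k}$. *)

theory Defs
  imports "HOL-Probability.Probability" "HOL-Combinatorics.Permutations"
begin

text \<open>
  A vector of \<open>\<real>\<^sup>n\<close> is a function on \<open>{1..n}\<close>, extended by \<open>undefined\<close> when it is the value of a
  random vector; for \<open>n = 0\<close> there is exactly one. An \<open>n \<times> n\<close> matrix is a function
  \<open>nat \<Rightarrow> nat \<Rightarrow> real\<close> of which only the entries with indices in \<open>{1..n}\<close> are used.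
\<close>

abbreviation rvec :: "nat \<Rightarrow> (nat \<Rightarrow> real) measure" where
  "rvec n \<equiv> Pi\<^sub>M {1..n} (\<lambda>_. borel)"

definition pos_def :: "nat \<Rightarrow> (nat \<Rightarrow> nat \<Rightarrow> real) \<Rightarrow> bool" where
  "pos_def n A \<longleftrightarrow>
     (\<forall>i\<in>{1..n}. \<forall>j\<in>{1..n}. A i j = A j i) \<and>
     (\<forall>v. (\<exists>i\<in>{1..n}. v i \<noteq> 0) \<longrightarrow> 0 < (\<Sum>i=1..n. \<Sum>j=1..n. v i * A i j * v j))"

text \<open>
  Normal distributions are allowed to be degenerate (point masses), as is customary
  for multivariate ones; \<open>s\<close> is the standard deviation.
\<close>

definition normal_law :: "real \<Rightarrow> real \<Rightarrow> real measure" where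
  "normal_law m s =
     (if s = 0 then return borel m else density lborel (\<lambda>x. ennreal (normal_density m s x)))"

definition gaussian_law :: "real measure \<Rightarrow> bool" where
  "gaussian_law Q \<longleftrightarrow> (\<exists>m s. 0 \<le> s \<and> Q = normal_law m s)"

definition gaussian_vector_law :: "nat \<Rightarrow> (nat \<Rightarrow> real) measure \<Rightarrow> bool" where
  "gaussian_vector_law n Q \<longleftrightarrow>
     sets Q = sets (rvec n) \<and>
     (\<forall>a. gaussian_law (distr Q borel (\<lambda>x. \<Sum>i=1..n. a i * x i)))"

definition mean_vector :: "(nat \<Rightarrow> real) measure \<Rightarrow> nat \<Rightarrow> real" where
  "mean_vector Q i = (LINT x|Q. x i)"

definition cov_matrix :: "(nat \<Rightarrow> real) measure \<Rightarrow> nat \<Rightarrow> nat \<Rightarrow> real" where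
  "cov_matrix Q i j = (LINT x|Q. (x i - mean_vector Q i) * (x j - mean_vector Q j))"

definition exchangeable :: "'a measure \<Rightarrow> 'b measure \<Rightarrow> 'i set \<Rightarrow> ('i \<Rightarrow> 'a \<Rightarrow> 'b) \<Rightarrow> bool" where
  "exchangeable M S I X \<longleftrightarrow>
     (\<forall>i\<in>I. X i \<in> M \<rightarrow>\<^sub>M S) \<and>
     (\<forall>\<pi>. \<pi> permutes I \<and> finite {i. \<pi> i \<noteq> i} \<longrightarrow>
        distr M (Pi\<^sub>M I (\<lambda>_. S)) (\<lambda>\<omega>. \<lambda>i\<in>I. X (\<pi> i) \<omega>) =
        distr M (Pi\<^sub>M I (\<lambda>_. S)) (\<lambda>\<omega>. \<lambda>i\<in>I. X i \<omega>))"

text \<open>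
  Conditioned on \<open>\<theta>\<close>, the \<open>X i\<close> are independent with common law \<open>Q (\<theta> \<omega>)\<close>. The kernel
  \<open>Q\<close> is a regular version of the conditional distribution of \<open>X i\<close> given \<open>\<theta>\<close>
  (take \<open>J = {i}\<close>).
\<close>

definition cond_iid ::
  "'a measure \<Rightarrow> 'c measure \<Rightarrow> ('a \<Rightarrow> 'c) \<Rightarrow> 'b measure \<Rightarrow> 'i set \<Rightarrow> ('i \<Rightarrow> 'a \<Rightarrow> 'b) \<Rightarrow>
   ('c \<Rightarrow> 'b measure) \<Rightarrow> bool" where
  "cond_iid M N \<theta> S I X Q \<longleftrightarrow>
     \<theta> \<in> M \<rightarrow>\<^sub>M N \<and> (\<forall>i\<in>I. X i \<in> M \<rightarrow>\<^sub>M S) \<and> Q \<in> N \<rightarrow>\<^sub>M prob_algebra S \<and>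
     (\<forall>J A. finite J \<and> J \<subseteq> I \<and> (\<forall>j\<in>J. A j \<in> sets S) \<longrightarrow>
        (AE \<omega> in M.
           real_cond_exp M (vimage_algebra (space M) \<theta> N)
             (indicator {\<omega> \<in> space M. \<forall>j\<in>J. X j \<omega> \<in> A j}) \<omega>
           = (\<Prod>j\<in>J. measure (Q (\<theta> \<omega>)) (A j))))"

locale crowd = prob_space M
  for M :: "'a measure" +
  fixes K :: nat
    and Y :: "nat \<Rightarrow> 'a \<Rightarrow> nat \<Rightarrow> real"
    and Ytilde :: "nat \<Rightarrow> nat \<Rightarrow> 'a \<Rightarrow> real"
    and Z :: "nat \<Rightarrow> 'a \<Rightarrow> real"
    and N :: "'c measure"
    and \<theta> :: "'a \<Rightarrow> 'c"
    and QY :: "'c \<Rightarrow> (nat \<Rightarrow> real) measure"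
  assumes K_pos: "1 \<le> K"
    and Z_measurable: "\<And>t. 1 \<le> t \<Longrightarrow> Z t \<in> borel_measurable M"
    and Y_exchangeable: "exchangeable M (rvec K) {1..} Y"
    and Y_integrable: "\<And>t k. 1 \<le> t \<Longrightarrow> k \<in> {1..K} \<Longrightarrow> integrable M (\<lambda>\<omega>. Y t \<omega> k)"
    and Y_mean: "\<And>t k. 1 \<le> t \<Longrightarrow> k \<in> {1..K} \<Longrightarrow> expectation (\<lambda>\<omega>. Y t \<omega> k) = 0"
    and Ytilde_exchangeable: "\<And>t. 1 \<le> t \<Longrightarrow> exchangeable M borel {1..} (Ytilde t)"
    and Y_eq: "\<And>t \<omega>. 1 \<le> t \<Longrightarrow> \<omega> \<in> space M \<Longrightarrow> Y t \<omega> = (\<lambda>k\<in>{1..K}. Ytilde t k \<omega>)"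
    and Z_limit: "\<And>t. 1 \<le> t \<Longrightarrow>
      AE \<omega> in M. (\<lambda>n. (1 / real n) * (\<Sum>k=1..n. Ytilde t k \<omega>)) \<longlonglongrightarrow> Z t \<omega>"
    and Y_cond_iid: "cond_iid M N \<theta> (rvec K) {1..} Y QY"
    \<comment> \<open>Minimality: \<open>\<theta>\<close> determines the conditional law \<open>QY (\<theta> \<omega>)\<close> of \<open>Y t\<close>, and conversely
      this law determines \<open>\<theta>\<close>; \<open>h\<close> is not required to be measurable.\<close>
    and theta_minimal: "\<exists>h. AE \<omega> in M. \<theta> \<omega> = h (QY (\<theta> \<omega>))"

definition residual :: "nat \<Rightarrow> (nat \<Rightarrow> 'a \<Rightarrow> nat \<Rightarrow> real) \<Rightarrow> (nat \<Rightarrow> 'a \<Rightarrow> real) \<Rightarrow>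
    nat \<Rightarrow> 'a \<Rightarrow> nat \<Rightarrow> real" where
  "residual K Y Z t \<omega> = (\<lambda>k\<in>{1..K}. Y t \<omega> k - Z t \<omega>)"

locale gaussian_crowd = crowd M K Y Ytilde Z N \<theta> QY
  for M :: "'a measure" and K :: nat and Y Ytilde Z and N :: "'c measure" and \<theta> QY +
  fixes Q\<Delta> :: "'c \<Rightarrow> (nat \<Rightarrow> real) measure"
  assumes Z_indep: "indep_vars (\<lambda>_. borel) Z {1..}"
    and Z_identical: "\<And>s t. 1 \<le> s \<Longrightarrow> 1 \<le> t \<Longrightarrow> distr M borel (Z s) = distr M borel (Z t)"
    and Z_gaussian: "\<And>t. 1 \<le> t \<Longrightarrow> gaussian_law (distr M borel (Z t))"
    and residual_indep_Z:
      "indep_set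
         (sets (vimage_algebra (space M) (\<lambda>\<omega>. \<lambda>t\<in>{1..}. residual K Y Z t \<omega>)
                  (Pi\<^sub>M {1..} (\<lambda>_. rvec K))))
         (sets (vimage_algebra (space M) (\<lambda>\<omega>. \<lambda>t\<in>{1..}. Z t \<omega>) (Pi\<^sub>M {1..} (\<lambda>_. borel))))"
    and residual_cond_iid: "cond_iid M N \<theta> (rvec K) {1..} (residual K Y Z) Q\<Delta>"
    and residual_gaussian:
      "AE \<omega> in M. gaussian_vector_law K (Q\<Delta> (\<theta> \<omega>)) \<and>
         (\<forall>k\<in>{1..K}. mean_vector (Q\<Delta> (\<theta> \<omega>)) k = 0) \<and>
         pos_def K (cov_matrix (Q\<Delta> (\<theta> \<omega>)))"

definition sigma_Y :: "'a measure \<Rightarrow> nat \<Rightarrow> (nat \<Rightarrow> 'a \<Rightarrow> nat \<Rightarrow> real) \<Rightarrow> 'a measure" where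
  "sigma_Y M K Y =
     vimage_algebra (space M) (\<lambda>\<omega>. \<lambda>t\<in>{1..}. Y t \<omega>) (Pi\<^sub>M {1..} (\<lambda>_. rvec K))"

text \<open>\<open>drop_component k y\<close> is \<open>y\<close> with the \<open>k\<close>-th component removed and later ones shifted down.\<close>

definition drop_component :: "nat \<Rightarrow> (nat \<Rightarrow> real) \<Rightarrow> nat \<Rightarrow> real" where
  "drop_component k y j = (if j < k then y j else y (Suc j))"

definition phi_penalty ::
  "nat \<Rightarrow> (nat \<Rightarrow> nat \<Rightarrow> real) \<Rightarrow> real \<Rightarrow> (nat \<Rightarrow> real) \<Rightarrow> real \<Rightarrow> real" where
  "phi_penalty K \<Lambda> ubar u l =
     1 / (2 * l) * (\<Sum>i=1..K-1. \<Sum>j=1..K-1. (u i - ubar) * \<Lambda> i j * (u j - ubar))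
     + (real K - 1) / 2 * ln l"

definition varphi_penalty :: "nat \<Rightarrow> real \<Rightarrow> real \<Rightarrow> real \<Rightarrow> real" where
  "varphi_penalty K lam lbar l =
     (lam / 2 + 1) * ln l + (lam + real K + 1) * lbar / (2 * l)"

text \<open>
  The objective in round \<open>t\<close> for worker \<open>k\<close>, given the realised estimates \<open>y 1, y 2, \<dots>\<close>. It depends
  on \<open>u\<close> only through its components in \<open>{1..K-1}\<close>, so minimising it over all functions \<open>u\<close>
  amounts to minimising it over vectors with \<open>K - 1\<close> components.
\<close>

definition objective ::
  "nat \<Rightarrow> (nat \<Rightarrow> nat \<Rightarrow> real) \<Rightarrow> real \<Rightarrow> real \<Rightarrow> real \<Rightarrow> (nat \<Rightarrow> nat \<Rightarrow> real) \<Rightarrow>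
   nat \<Rightarrow> nat \<Rightarrow> (nat \<Rightarrow> real) \<Rightarrow> real \<Rightarrow> real" where
  "objective K \<Lambda> lam ubar lbar y t k u l =
     (\<Sum>\<tau>\<in>{1..<t}.
        (y \<tau> k - (\<Sum>j=1..K-1. u j * drop_component k (y \<tau>) j))\<^sup>2 / (2 * l) + ln l / 2)
     + phi_penalty K \<Lambda> ubar u l + varphi_penalty K lam lbar l"

text \<open>
  \<open>uhat k (t - 1)\<close> and \<open>lhat k (t - 1)\<close> are the estimates used in round \<open>t\<close>,
  fitted to the rounds before \<open>t\<close>.
\<close>

definition predict_each_worker_fit ::
  "'a set \<Rightarrow> nat \<Rightarrow> (nat \<Rightarrow> nat \<Rightarrow> real) \<Rightarrow> real \<Rightarrow> real \<Rightarrow> real \<Rightarrow>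
   (nat \<Rightarrow> 'a \<Rightarrow> nat \<Rightarrow> real) \<Rightarrow>
   (nat \<Rightarrow> nat \<Rightarrow> 'a \<Rightarrow> nat \<Rightarrow> real) \<Rightarrow> (nat \<Rightarrow> nat \<Rightarrow> 'a \<Rightarrow> real) \<Rightarrow> bool" where
  "predict_each_worker_fit \<Omega> K \<Lambda> lam ubar lbar Y uhat lhat \<longleftrightarrow>
     (\<forall>t\<ge>1. \<forall>k\<in>{1..K}. \<forall>\<omega>\<in>\<Omega>.
        is_arg_min (\<lambda>(u, l). objective K \<Lambda> lam ubar lbar (\<lambda>\<tau>. Y \<tau> \<omega>) t k u l)
          (\<lambda>(u, l). 0 < l) (uhat k (t - 1) \<omega>, lhat k (t - 1) \<omega>))"

definition nu_tilde ::
  "nat \<Rightarrow> real \<Rightarrow> real \<Rightarrow> real \<Rightarrow>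
   (nat \<Rightarrow> nat \<Rightarrow> 'a \<Rightarrow> nat \<Rightarrow> real) \<Rightarrow> (nat \<Rightarrow> nat \<Rightarrow> 'a \<Rightarrow> real) \<Rightarrow>
   nat \<Rightarrow> 'a \<Rightarrow> nat \<Rightarrow> real" where
  "nu_tilde K vbar ubar lbar uhat lhat t \<omega> k =
     (if t = 1 then vbar * ((1 - (real K - 1) * ubar) / lbar)
      else vbar * ((1 - (\<Sum>j=1..K-1. uhat k (t - 1) \<omega> j)) / lhat k (t - 1) \<omega>))"

definition gamma_weight :: "real \<Rightarrow> nat \<Rightarrow> real" where
  "gamma_weight r t = r / (r + real t - 1)"

definition nu_hat ::
  "nat \<Rightarrow> real \<Rightarrow> real \<Rightarrow> real \<Rightarrow> real \<Rightarrow>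
   (nat \<Rightarrow> nat \<Rightarrow> 'a \<Rightarrow> nat \<Rightarrow> real) \<Rightarrow> (nat \<Rightarrow> nat \<Rightarrow> 'a \<Rightarrow> real) \<Rightarrow>
   nat \<Rightarrow> 'a \<Rightarrow> nat \<Rightarrow> real" where
  "nu_hat K vbar ubar lbar r uhat lhat t \<omega> k =
     gamma_weight r t * nu_tilde K vbar ubar lbar uhat lhat 1 \<omega> k
     + (1 - gamma_weight r t) * nu_tilde K vbar ubar lbar uhat lhat t \<omega> k"

end

(*
  Conditionally on theta the residuals are iid N(0, S) and independent of the outcomes, which are
  iid N(0, v); so (residuals, outcomes) is a mixture over S of laws of iid Gaussian rounds, and
  almost sure statements and conditional expectations given Y reduce to a fixed S. There the
  empirical covariance of Y converges to C = S + v 1 1^T. With C w = v 1, the error Z_t - w^T Y_t is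
  Gaussian and uncorrelated with Y_t, hence symmetric given Y, so E[Z_t | Y] = w^T Y_t; w is a
  function of Y because C is a limit of empirical covariances. The fits solve perturbed normal
  equations, so the aggregation weights converge to w. As Y_t is unbounded in t, convergence alone
  does not suffice: the empirical covariances, and hence the weights, converge with rate o(t^(-1/8)),
  while Y_t = o(t^(1/8)).
*)
theory Submission
  imports Defs "HOL-Real_Asymp.Real_Asymp"
begin

section \<open>Positive definite linear systems\<close>

text \<open>Gaussian vectors are given only through the laws of their linear functionals, so the
  joint symmetry of error and estimates has to be recovered from one-dimensional laws; this is the
  purpose of the Cramer-Wold theorem. The symmetry is stated as equality of two nonnegative
  integrals, of the positive and of the negative part of the error over an event of the estimates:
  such an identity for each covariance can be integrated over \<theta> without any integrability
  check. Passing almost sure statements from the components to the mixture requires measurable path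
  properties, among them positive definiteness of the limit covariance and the solution of a linear
  system. Both are reduced to Gaussian elimination, whose finitely many field operations are
  measurable in the entries and compatible with limits. The exponent 1/8 balances two moment bounds:
  second moments along the squares give rates o(n^(-a)) for a < 1/4, and growth o(n^a) follows from
  a moment of order 2/a, here the sixteenth.\<close>

abbreviation qform :: "nat \<Rightarrow> (nat \<Rightarrow> nat \<Rightarrow> real) \<Rightarrow> (nat \<Rightarrow> real) \<Rightarrow> real" where
  "qform n S a \<equiv> (\<Sum>i=1..n. \<Sum>j=1..n. a i * S i j * a j)"

definition schur :: "nat \<Rightarrow> (nat \<Rightarrow> nat \<Rightarrow> real) \<Rightarrow> nat \<Rightarrow> nat \<Rightarrow> real" where
  "schur n A i j = A i j - A i n * A n j / A n n"

text \<open>Elimination of the last unknown, then back substitution. Being a recursion over field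
  operations on the entries, it inherits measurability and limits from arithmetic. For a positive
  definite matrix every pivot is positive.\<close>

primrec solve :: "nat \<Rightarrow> (nat \<Rightarrow> nat \<Rightarrow> real) \<Rightarrow> (nat \<Rightarrow> real) \<Rightarrow> nat \<Rightarrow> real" where
  "solve 0 A b = (\<lambda>_. 0)"
| "solve (Suc n) A b =
     (let w = solve n (schur (Suc n) A) (\<lambda>i. b i - A i (Suc n) * b (Suc n) / A (Suc n) (Suc n))
      in w(Suc n := (b (Suc n) - (\<Sum>j=1..n. A (Suc n) j * w j)) / A (Suc n) (Suc n)))"

text \<open>Completing the square in the last coordinate; the remaining form no longer involves
  \<open>v (Suc n)\<close>.\<close>

lemma quadratic_form_schur:
  fixes A :: "nat \<Rightarrow> nat \<Rightarrow> real"
  assumes sym: "\<And>i. i \<in> {1..n} \<Longrightarrow> A i (Suc n) = A (Suc n) i" and d: "A (Suc n) (Suc n) \<noteq> 0"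
  shows "qform (Suc n) A v =
    qform n (schur (Suc n) A) v
    + A (Suc n) (Suc n) * (v (Suc n) + (\<Sum>j=1..n. A (Suc n) j * v j) / A (Suc n) (Suc n))\<^sup>2"
proof -
  define d L where "d = A (Suc n) (Suc n)" and "L = (\<Sum>j=1..n. A (Suc n) j * v j)"
  have L': "(\<Sum>i=1..n. v i * A i (Suc n)) = L"
    unfolding L_def by (rule sum.cong) (auto simp: sym)
  have s: "qform n (schur (Suc n) A) v =
      qform n A v - L * L / d"
  proof -
    have "qform n (schur (Suc n) A) v =
        (\<Sum>i=1..n. \<Sum>j=1..n. v i * A i j * v j - (v i * A i (Suc n)) * (A (Suc n) j * v j) / d)"
      by (intro sum.cong refl) (simp add: schur_def d_def algebra_simps)
    also have "\<dots> = qform n A v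
        - (\<Sum>i=1..n. v i * A i (Suc n)) * (\<Sum>j=1..n. A (Suc n) j * v j) / d"
      by (simp only: sum_subtractf sum_divide_distrib sum_product)
    finally show ?thesis by (simp only: L' L_def[symmetric])
  qed
  have "qform (Suc n) A v =
      qform n A v + (\<Sum>i=1..n. v i * A i (Suc n)) * v (Suc n)
      + (v (Suc n) * (\<Sum>j=1..n. A (Suc n) j * v j) + v (Suc n) * d * v (Suc n))"
    by (simp add: sum.distrib sum_distrib_left sum_distrib_right d_def mult.assoc)
  also have "\<dots> = qform n A v - L * L / d + d * (v (Suc n) + L / d)\<^sup>2"
    unfolding L' L_def[symmetric] using d unfolding d_def[symmetric]
    by (simp add: field_simps power2_eq_square)
  finally show ?thesis by (simp only: s d_def L_def)
qed

text \<open>Trades the quantifier over all vectors for conditions on finitely many entries, one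
  dimension at a time. Both directions rest on the completed square: it can only add to the smaller
  form, and a suitable last coordinate makes it vanish.\<close>

lemma pos_def_Suc:
  "pos_def (Suc n) A \<longleftrightarrow>
     (\<forall>i\<in>{1..n}. A i (Suc n) = A (Suc n) i) \<and> 0 < A (Suc n) (Suc n) \<and> pos_def n (schur (Suc n) A)"
  (is "?L \<longleftrightarrow> ?R")
proof
  assume pd: ?L
  then have sym: "A i j = A j i" if "i \<in> {1..Suc n}" "j \<in> {1..Suc n}" for i j
    using that unfolding pos_def_def by blast
  have pos: "0 < qform (Suc n) A v" if "\<exists>i\<in>{1..Suc n}. v i \<noteq> 0" for v
    using pd that unfolding pos_def_def by blast
  have d: "0 < A (Suc n) (Suc n)"
  proof -
    have "0 < (\<Sum>i=1..Suc n. \<Sum>j=1..Suc n. (if i = Suc n then 1 else 0) * A i j * (if j = Suc n then 1 else 0))"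
      by (rule pos) auto
    also have "\<dots> = A (Suc n) (Suc n)" by simp
    finally show ?thesis .
  qed
  have "pos_def n (schur (Suc n) A)"
    unfolding pos_def_def
  proof (intro conjI allI impI ballI)
    fix i j assume "i \<in> {1..n}" "j \<in> {1..n}"
    then show "schur (Suc n) A i j = schur (Suc n) A j i"
      using sym[of i j] sym[of i "Suc n"] sym[of j "Suc n"] by (simp add: schur_def)
  next
    fix v :: "nat \<Rightarrow> real" assume v: "\<exists>i\<in>{1..n}. v i \<noteq> 0"
    \<comment> \<open>The last coordinate annihilates the completed square, so that only the form of
      the Schur complement is left.\<close>
    define v' where "v' = v(Suc n := - (\<Sum>j=1..n. A (Suc n) j * v j) / A (Suc n) (Suc n))"
    obtain i where "i \<in> {1..n}" "v i \<noteq> 0" using v by blast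
    then have "\<exists>i\<in>{1..Suc n}. v' i \<noteq> 0" by (intro bexI[of _ i]) (auto simp: v'_def)
    then have "0 < qform (Suc n) A v'" by (rule pos)
    also have "\<dots> = qform n (schur (Suc n) A) v'
      + A (Suc n) (Suc n) * (v' (Suc n) + (\<Sum>j=1..n. A (Suc n) j * v' j) / A (Suc n) (Suc n))\<^sup>2"
      by (rule quadratic_form_schur) (use sym d in auto)
    also have "(\<Sum>j=1..n. A (Suc n) j * v' j) = (\<Sum>j=1..n. A (Suc n) j * v j)"
      by (rule sum.cong) (auto simp: v'_def)
    also have "qform n (schur (Suc n) A) v' =
        qform n (schur (Suc n) A) v"
      by (intro sum.cong refl) (auto simp: v'_def)
    finally show "0 < qform n (schur (Suc n) A) v"
      by (simp add: v'_def)
  qed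
  then show ?R using d sym by auto
next
  assume R: ?R
  then have bsym: "A i (Suc n) = A (Suc n) i" if "i \<in> {1..n}" for i using that by blast
  have d: "0 < A (Suc n) (Suc n)" using R by blast
  have ssym: "schur (Suc n) A i j = schur (Suc n) A j i" if "i \<in> {1..n}" "j \<in> {1..n}" for i j
    using R that unfolding pos_def_def by blast
  have spos: "0 < qform n (schur (Suc n) A) v" if "\<exists>i\<in>{1..n}. v i \<noteq> 0" for v
    using R that unfolding pos_def_def by blast
  show ?L
    unfolding pos_def_def
  proof (intro conjI allI impI ballI)
    fix i j assume ij: "i \<in> {1..Suc n}" "j \<in> {1..Suc n}"
    show "A i j = A j i"
    proof (cases "i = Suc n \<or> j = Suc n")
      case True then show ?thesis using ij bsym
        by (metis atLeastAtMost_iff le_Suc_eq)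
    next
      case False
      then have "i \<in> {1..n}" "j \<in> {1..n}" using ij by auto
      then show ?thesis using ssym[of i j] bsym[of i] bsym[of j] by (simp add: schur_def mult.commute)
    qed
  next
    fix v :: "nat \<Rightarrow> real" assume v: "\<exists>i\<in>{1..Suc n}. v i \<noteq> 0"
    show "0 < qform (Suc n) A v"
    proof (cases "\<exists>i\<in>{1..n}. v i \<noteq> 0")
      case True
      then show ?thesis using spos[OF True] d
        by (subst quadratic_form_schur[where A = A, OF bsym]) (auto intro!: add_pos_nonneg)
    next
      case False
      then have z: "v i = 0" if "i \<in> {1..n}" for i using that by blast
      then have "v (Suc n) \<noteq> 0" using v by (metis atLeastAtMost_iff le_Suc_eq)
      then show ?thesis using d z
        by (subst quadratic_form_schur[where A = A, OF bsym]) auto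
    qed
  qed
qed

lemma solve_correct:
  "pos_def n A \<Longrightarrow> i \<in> {1..n} \<Longrightarrow> (\<Sum>j=1..n. A i j * solve n A b j) = b i"
proof (induction n arbitrary: A b i)
  case 0 then show ?case by simp
next
  case (Suc n)
  define d where "d = A (Suc n) (Suc n)"
  define w where "w = solve n (schur (Suc n) A) (\<lambda>i. b i - A i (Suc n) * b (Suc n) / d)"
  have d: "0 < d" and pd: "pos_def n (schur (Suc n) A)"
    using Suc.prems(1) by (auto simp: pos_def_Suc d_def)
  have IH: "(\<Sum>j=1..n. schur (Suc n) A k j * w j) = b k - A k (Suc n) * b (Suc n) / d" if "k \<in> {1..n}" for k
    unfolding w_def by (rule Suc.IH[OF pd that])
  have sol: "solve (Suc n) A b = w(Suc n := (b (Suc n) - (\<Sum>j=1..n. A (Suc n) j * w j)) / d)"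
    by (simp add: w_def d_def Let_def)
  have sm: "(\<Sum>j=1..Suc n. A i j * solve (Suc n) A b j) =
     (\<Sum>j=1..n. A i j * w j) + A i (Suc n) * ((b (Suc n) - (\<Sum>j=1..n. A (Suc n) j * w j)) / d)"
  proof -
    have "(\<Sum>j=1..n. A i j * solve (Suc n) A b j) = (\<Sum>j=1..n. A i j * w j)"
      by (rule sum.cong) (auto simp: sol simp del: solve.simps)
    then show ?thesis by (simp add: sol del: solve.simps)
  qed
  show ?case
  proof (cases "i = Suc n")
    case True then show ?thesis unfolding sm using d by (simp add: d_def[symmetric])
  next
    case False
    then have i: "i \<in> {1..n}" using Suc.prems(2) by auto
    have "(\<Sum>j=1..n. schur (Suc n) A i j * w j) =
        (\<Sum>j=1..n. A i j * w j - A i (Suc n) / d * (A (Suc n) j * w j))"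
      by (intro sum.cong refl) (simp add: schur_def d_def algebra_simps)
    also have "\<dots> = (\<Sum>j=1..n. A i j * w j) - A i (Suc n) / d * (\<Sum>j=1..n. A (Suc n) j * w j)"
      by (simp add: sum_subtractf sum_distrib_left)
    finally show ?thesis using IH[OF i] unfolding sm by (simp add: diff_divide_distrib algebra_simps)
  qed
qed

lemma pos_def_pos:
  "pos_def n A \<Longrightarrow> i \<in> {1..n} \<Longrightarrow> v i \<noteq> 0 \<Longrightarrow> 0 < qform n A v"
  unfolding pos_def_def by blast

text \<open>The quadratic form vanishes at \<open>v - w\<close>. This identifies an arbitrary
  solution, in particular one supplied by an arbitrary minimizer, with the output of
  \<open>solve\<close>.\<close>

lemma pos_def_unique:
  assumes pd: "pos_def n A" and eq: "\<And>i. i \<in> {1..n} \<Longrightarrow> (\<Sum>j=1..n. A i j * v j) = (\<Sum>j=1..n. A i j * w j)"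
    and i: "i \<in> {1..n}"
  shows "v i = w i"
proof (rule ccontr)
  assume "v i \<noteq> w i"
  then have "0 < (\<Sum>i=1..n. \<Sum>j=1..n. (v i - w i) * A i j * (v j - w j))"
    using pos_def_pos[OF pd i, of "\<lambda>i. v i - w i"] by simp
  also have "\<dots> = (\<Sum>i=1..n. (v i - w i) * ((\<Sum>j=1..n. A i j * v j) - (\<Sum>j=1..n. A i j * w j)))"
    by (intro sum.cong refl) (simp add: sum_distrib_left sum_subtractf[symmetric] algebra_simps)
  also have "\<dots> = 0" by (rule sum.neutral) (auto simp: eq simp del: One_nat_def)
  finally show False by simp
qed

lemma pos_def_cong:
  assumes "\<And>i j. i \<in> {1..n} \<Longrightarrow> j \<in> {1..n} \<Longrightarrow> A i j = B i j"
  shows "pos_def n A \<longleftrightarrow> pos_def n B"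
proof -
  have "qform n A v = qform n B v" for v
    by (intro sum.cong refl) (simp add: assms)
  then show ?thesis using assms unfolding pos_def_def by simp
qed

lemma measurable_schur:
  assumes "\<And>i j. i \<in> {1..Suc n} \<Longrightarrow> j \<in> {1..Suc n} \<Longrightarrow> (\<lambda>x. A x i j) \<in> borel_measurable M"
    and "i \<in> {1..n}" "j \<in> {1..n}"
  shows "(\<lambda>x. schur (Suc n) (A x) i j) \<in> borel_measurable M"
  using assms unfolding schur_def
  by (intro borel_measurable_diff borel_measurable_divide borel_measurable_times) auto

lemma measurable_solve:
  assumes "\<And>i j. i \<in> {1..n} \<Longrightarrow> j \<in> {1..n} \<Longrightarrow> (\<lambda>x. A x i j) \<in> borel_measurable M"
    and "\<And>i. i \<in> {1..n} \<Longrightarrow> (\<lambda>x. b x i) \<in> borel_measurable M"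
    and "i \<in> {1..n}"
  shows "(\<lambda>x. solve n (A x) (b x) i) \<in> borel_measurable M"
  using assms
proof (induction n arbitrary: A b i)
  case 0 then show ?case by simp
next
  case (Suc n)
  define w where "w x = solve n (schur (Suc n) (A x))
    (\<lambda>i. b x i - A x i (Suc n) * b x (Suc n) / A x (Suc n) (Suc n))" for x
  have w: "(\<lambda>x. w x j) \<in> borel_measurable M" if "j \<in> {1..n}" for j
    unfolding w_def
  proof (rule Suc.IH)
    fix i assume "i \<in> {1..n}"
    then show "(\<lambda>x. b x i - A x i (Suc n) * b x (Suc n) / A x (Suc n) (Suc n)) \<in> borel_measurable M"
      by (intro borel_measurable_diff borel_measurable_divide borel_measurable_times Suc.prems) auto
  qed (use that Suc.prems(1) in \<open>auto intro!: measurable_schur\<close>)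
  have "(\<lambda>x. (b x (Suc n) - (\<Sum>j=1..n. A x (Suc n) j * w x j)) / A x (Suc n) (Suc n)) \<in> borel_measurable M"
    by (intro borel_measurable_diff borel_measurable_divide borel_measurable_times borel_measurable_sum
        Suc.prems w) auto
  moreover have "i = Suc n \<or> i \<in> {1..n}" using Suc.prems(3) by auto
  ultimately show ?case using w by (auto simp: Let_def w_def[symmetric])
qed

text \<open>\<open>pos_def\<close> quantifies over uncountably many vectors; unfolding
  \<open>pos_def_Suc\<close> leaves finitely many equations and inequalities between measurable
  functions.\<close>

lemma pred_pos_def:
  assumes "\<And>i j. i \<in> {1..n} \<Longrightarrow> j \<in> {1..n} \<Longrightarrow> (\<lambda>x. A x i j) \<in> borel_measurable M"
  shows "Measurable.pred M (\<lambda>x. pos_def n (A x))"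
  using assms
proof (induction n arbitrary: A)
  case 0 then show ?case by (simp add: pos_def_def)
next
  case (Suc n)
  have [measurable]: "Measurable.pred M (\<lambda>x. pos_def n (schur (Suc n) (A x)))"
    by (rule Suc.IH) (auto intro!: measurable_schur Suc.prems)
  have [measurable]: "(\<lambda>x. A x (Suc n) (Suc n)) \<in> borel_measurable M" by (rule Suc.prems) auto
  have [measurable]: "Measurable.pred M (\<lambda>x. \<forall>i\<in>{1..n}. A x i (Suc n) = A x (Suc n) i)"
  proof (intro pred_intros_finite)
    fix i assume i: "i \<in> {1..n}"
    have [measurable]: "(\<lambda>x. A x i (Suc n)) \<in> borel_measurable M" "(\<lambda>x. A x (Suc n) i) \<in> borel_measurable M"
      using i by (auto intro!: Suc.prems)
    show "Measurable.pred M (\<lambda>x. A x i (Suc n) = A x (Suc n) i)" by measurable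
  qed simp
  show ?case unfolding pos_def_Suc by measurable
qed

section \<open>Limits attained with rate o(n^(-1/8))\<close>

definition rconv :: "(nat \<Rightarrow> real) \<Rightarrow> real \<Rightarrow> bool" where
  "rconv X x \<longleftrightarrow> (\<lambda>n. real n powr (1/8) * (X n - x)) \<longlonglongrightarrow> 0"

lemma rconv_imp_tendsto:
  assumes "rconv X x" shows "X \<longlonglongrightarrow> x"
proof -
  have "(\<lambda>n. real n powr (-1/8)) \<longlonglongrightarrow> 0" by real_asymp
  from tendsto_mult[OF this assms[unfolded rconv_def]]
  have "(\<lambda>n. real n powr (-1/8) * (real n powr (1/8) * (X n - x))) \<longlonglongrightarrow> 0" by simp
  moreover have "eventually (\<lambda>n. real n powr (-1/8) * (real n powr (1/8) * (X n - x)) = X n - x) sequentially"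
    using eventually_gt_at_top[of 0]
    by eventually_elim (simp add: mult.assoc[symmetric] powr_add[symmetric])
  ultimately have "(\<lambda>n. X n - x) \<longlonglongrightarrow> 0"
    by (rule Lim_transform_eventually)
  then show ?thesis by (rule LIM_zero_cancel)
qed

lemma rconv_const: "rconv (\<lambda>_. x) x"
  by (simp add: rconv_def)

lemma rconv_add: "rconv X x \<Longrightarrow> rconv Y y \<Longrightarrow> rconv (\<lambda>n. X n + Y n) (x + y)"
  unfolding rconv_def by (drule (1) tendsto_add) (simp add: algebra_simps)

lemma rconv_uminus: "rconv X x \<Longrightarrow> rconv (\<lambda>n. - X n) (- x)"
  unfolding rconv_def by (drule tendsto_minus) (simp add: algebra_simps)

lemma rconv_diff: "rconv X x \<Longrightarrow> rconv Y y \<Longrightarrow> rconv (\<lambda>n. X n - Y n) (x - y)"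
  using rconv_add[of X x "\<lambda>n. - Y n" "- y"] rconv_uminus[of Y y] by simp

lemma rconv_sum: "(\<And>i. i \<in> I \<Longrightarrow> rconv (X i) (x i)) \<Longrightarrow> rconv (\<lambda>n. \<Sum>i\<in>I. X i n) (\<Sum>i\<in>I. x i)"
  by (induction I rule: infinite_finite_induct) (auto simp: rconv_const rconv_add)

text \<open>XY - xy = (X - x) Y + x (Y - y): one error meets a convergent factor, the other a
  constant.\<close>

lemma rconv_mult: assumes "rconv X x" "rconv Y y" shows "rconv (\<lambda>n. X n * Y n) (x * y)"
proof -
  have "(\<lambda>n. (real n powr (1/8) * (X n - x)) * Y n + x * (real n powr (1/8) * (Y n - y))) \<longlonglongrightarrow> 0 * y + x * 0"
    using assms rconv_imp_tendsto[OF assms(2)] unfolding rconv_def by (intro tendsto_intros)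
  then show ?thesis unfolding rconv_def by (simp add: algebra_simps)
qed

lemma rconv_inverse: assumes "rconv X x" "x \<noteq> 0" shows "rconv (\<lambda>n. 1 / X n) (1 / x)"
proof -
  have t: "X \<longlonglongrightarrow> x" by (rule rconv_imp_tendsto[OF assms(1)])
  have "(\<lambda>n. - (real n powr (1/8) * (X n - x)) / (X n * x)) \<longlonglongrightarrow> - 0 / (x * x)"
    using assms t unfolding rconv_def by (intro tendsto_intros) auto
  moreover have "eventually (\<lambda>n. - (real n powr (1/8) * (X n - x)) / (X n * x) = real n powr (1/8) * (1 / X n - 1 / x)) sequentially"
    using tendsto_imp_eventually_ne[OF t assms(2)]
    by eventually_elim (use assms(2) in \<open>auto simp: field_simps\<close>)
  ultimately show ?thesis unfolding rconv_def by (simp add: Lim_transform_eventually)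
qed

lemma rconv_divide: "rconv X x \<Longrightarrow> rconv Y y \<Longrightarrow> y \<noteq> 0 \<Longrightarrow> rconv (\<lambda>n. X n / Y n) (x / y)"
  using rconv_mult[OF _ rconv_inverse, of X x Y y] by simp

lemma rconv_eventually: "rconv X x \<Longrightarrow> eventually (\<lambda>n. X n = Y n) sequentially \<Longrightarrow> rconv Y x"
  unfolding rconv_def by (erule Lim_transform_eventually) (auto elim: eventually_mono)

text \<open>Positive definiteness is required of the limit matrix only: its pivots are nonzero, and
  this is all that the divisions in the elimination need in order to pass to the limit.\<close>

lemma rconv_solve:
  assumes "pos_def n A"
    and "\<And>i j. i \<in> {1..n} \<Longrightarrow> j \<in> {1..n} \<Longrightarrow> rconv (\<lambda>m. X m i j) (A i j)"
    and "\<And>i. i \<in> {1..n} \<Longrightarrow> rconv (\<lambda>m. B m i) (b i)"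
    and "i \<in> {1..n}"
  shows "rconv (\<lambda>m. solve n (X m) (B m) i) (solve n A b i)"
  using assms
proof (induction n arbitrary: A b i X B)
  case 0 then show ?case by simp
next
  case (Suc n)
  define v where "v m = solve n (schur (Suc n) (X m))
    (\<lambda>i. B m i - X m i (Suc n) * B m (Suc n) / X m (Suc n) (Suc n))" for m
  define w where "w = solve n (schur (Suc n) A)
    (\<lambda>i. b i - A i (Suc n) * b (Suc n) / A (Suc n) (Suc n))"
  have d: "A (Suc n) (Suc n) \<noteq> 0" and pd: "pos_def n (schur (Suc n) A)"
    using Suc.prems(1) by (auto simp: pos_def_Suc)
  have vw: "rconv (\<lambda>m. v m j) (w j)" if "j \<in> {1..n}" for j
    unfolding v_def w_def
  proof (rule Suc.IH[OF pd])
    fix i assume "i \<in> {1..n}"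
    then show "rconv (\<lambda>m. B m i - X m i (Suc n) * B m (Suc n) / X m (Suc n) (Suc n))
      (b i - A i (Suc n) * b (Suc n) / A (Suc n) (Suc n))"
      by (intro rconv_diff rconv_divide rconv_mult Suc.prems d) auto
  next
    fix i j assume "i \<in> {1..n}" "j \<in> {1..n}"
    then show "rconv (\<lambda>m. schur (Suc n) (X m) i j) (schur (Suc n) A i j)"
      unfolding schur_def by (intro rconv_diff rconv_divide rconv_mult Suc.prems d) auto
  qed (use that in auto)
  have "rconv (\<lambda>m. (B m (Suc n) - (\<Sum>j=1..n. X m (Suc n) j * v m j)) / X m (Suc n) (Suc n))
     ((b (Suc n) - (\<Sum>j=1..n. A (Suc n) j * w j)) / A (Suc n) (Suc n))"
    by (intro rconv_diff rconv_divide rconv_mult rconv_sum Suc.prems vw d) auto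
  moreover have "i = Suc n \<or> i \<in> {1..n}" using Suc.prems(4) by auto
  ultimately show ?case using vw by (auto simp: Let_def v_def[symmetric] w_def[symmetric])
qed

section \<open>Fits on a path with converging empirical covariance\<close>

text \<open>Serves for the contributions of the penalties, which do not grow with the number of
  rounds.\<close>

lemma rconv_over_n: "rconv (\<lambda>n. c / real n) 0"
proof -
  have "(\<lambda>n. c * (real n powr (1/8) / real n)) \<longlonglongrightarrow> c * 0"
    by (intro tendsto_mult tendsto_const) real_asymp
  then show ?thesis by (simp add: rconv_def mult.commute)
qed

text \<open>First-order optimality without derivatives. With c = |H| + 1 the step s = -L/c gives
  (L^2/c)(H/c - 2), which is negative unless L = 0, whatever the sign of H.\<close>

lemma linear_term_zero:
  fixes L H :: real
  assumes "\<And>s. 0 \<le> 2 * s * L + s\<^sup>2 * H"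
  shows "L = 0"
proof (rule ccontr)
  assume L: "L \<noteq> 0"
  define c where "c = \<bar>H\<bar> + 1"
  have c: "0 < c" "H \<le> c" by (auto simp: c_def)
  have "2 * (- L / c) * L + (- L / c)\<^sup>2 * H = (L\<^sup>2 / c) * (H / c - 2)"
    using c by (simp add: field_simps power2_eq_square)
  moreover have "H / c - 2 < 0" using c by (simp add: field_simps)
  moreover have "0 < L\<^sup>2 / c" using L c by simp
  ultimately have "2 * (- L / c) * L + (- L / c)\<^sup>2 * H < 0" by (simp only: mult_pos_neg)
  then show False using assms[of "- L / c"] by linarith
qed

text \<open>Comparison with the candidate q/N suffices: for x = q/(N l) minimality becomes x - 1
  \<le> ln x, which forces x = 1.\<close>

lemma log_ratio_minimizer:
  fixes q N l :: real
  assumes "0 < q" "0 < N" "0 < l"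
    and min: "\<And>l'. 0 < l' \<Longrightarrow> q / (2 * l) + N / 2 * ln l \<le> q / (2 * l') + N / 2 * ln l'"
  shows "l = q / N"
proof -
  define x where "x = q / (N * l)"
  have x: "0 < x" using assms by (simp add: x_def)
  have "q / (2 * l) + N / 2 * ln l \<le> q / (2 * (q / N)) + N / 2 * ln (q / N)"
    using assms by (intro min) auto
  also have "q / N = x * l" using assms by (simp add: x_def)
  also have "q / (2 * (x * l)) = N / 2" using assms by (simp add: x_def)
  also have "q / (2 * l) = N / 2 * x" using assms by (simp add: x_def)
  also have "ln (x * l) = ln x + ln l" using x assms by (simp add: ln_mult)
  finally have "N / 2 * (x - 1) \<le> N / 2 * ln x" by (simp add: right_diff_distrib distrib_left)
  then have "x - 1 \<le> ln x" using assms by simp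
  then have "ln x = x - 1" using ln_le_minus_one[OF x] by linarith
  then have "x = 1" using ln_eq_minus_one[OF x] by simp
  then show ?thesis using assms by (simp add: x_def field_simps)
qed

section \<open>Splitting off one component of a vector\<close>

definition skip :: "nat \<Rightarrow> nat \<Rightarrow> nat" where
  "skip k j = (if j < k then j else Suc j)"

lemma drop_component_skip: "drop_component k y j = y (skip k j)"
  by (simp add: drop_component_def skip_def)

lemma skip_in: "k \<in> {1..K} \<Longrightarrow> j \<in> {1..K-1} \<Longrightarrow> skip k j \<in> {1..K} \<and> skip k j \<noteq> k"
  by (auto simp: skip_def)

lemma sum_skip:
  fixes f :: "nat \<Rightarrow> real"
  assumes k: "k \<in> {1..K}"
  shows "(\<Sum>i=1..K. f i) = f k + (\<Sum>j=1..K-1. f (skip k j))"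
proof -
  have "bij_betw (skip k) {1..K-1} ({1..K} - {k})"
    by (rule bij_betw_byWitness[where f' = "\<lambda>i. if i < k then i else i - 1"])
       (use k in \<open>auto simp: skip_def\<close>)
  then have "(\<Sum>j=1..K-1. f (skip k j)) = (\<Sum>i\<in>{1..K} - {k}. f i)"
    by (rule sum.reindex_bij_betw)
  then show ?thesis using k by (simp add: sum.remove)
qed

text \<open>The full-length coefficient vector of the prediction error y_k - u^T y_(-k). In this
  form the error is a linear functional of all K estimates, and its empirical second moment is a
  quadratic form in their empirical covariance.\<close>

definition contrast :: "nat \<Rightarrow> (nat \<Rightarrow> real) \<Rightarrow> nat \<Rightarrow> real" where
  "contrast k u i = (if i = k then 1 else - u (if i < k then i else i - 1))"

lemma contrast_simps: "contrast k u k = 1" "contrast k u (skip k j) = - u j"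
  by (auto simp: contrast_def skip_def)

lemma sum_contrast:
  assumes "k \<in> {1..K}"
  shows "(\<Sum>i=1..K. contrast k u i * f i) = f k - (\<Sum>j=1..K-1. u j * f (skip k j))"
  by (subst sum_skip[OF assms]) (simp add: contrast_simps sum_negf)

section \<open>The fit of one worker along one fixed path\<close>

locale pew_fit =
  fixes K :: nat and \<Lambda> C :: "nat \<Rightarrow> nat \<Rightarrow> real" and lam ubar lbar :: real
    and y :: "nat \<Rightarrow> nat \<Rightarrow> real" and k :: nat
    and uh :: "nat \<Rightarrow> nat \<Rightarrow> real" and lh :: "nat \<Rightarrow> real"
  assumes K: "1 \<le> K" and C: "pos_def K C" and \<Lambda>: "pos_def (K - 1) \<Lambda>"
    and lbar: "0 < lbar" and lam: "0 \<le> lam" and k: "k \<in> {1..K}"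
    and cov: "\<And>i j. i \<in> {1..K} \<Longrightarrow> j \<in> {1..K} \<Longrightarrow>
        rconv (\<lambda>n. (\<Sum>\<tau>=1..n. y \<tau> i * y \<tau> j) / real n) (C i j)"
    and fit: "\<And>n. is_arg_min (\<lambda>(u, l). objective K \<Lambda> lam ubar lbar y (Suc n) k u l)
        (\<lambda>(u, l). 0 < l) (uh n, lh n)"
begin

abbreviation err :: "(nat \<Rightarrow> real) \<Rightarrow> nat \<Rightarrow> real" where
  "err u \<tau> \<equiv> \<Sum>i=1..K. contrast k u i * y \<tau> i"

abbreviation cross :: "nat \<Rightarrow> nat \<Rightarrow> nat \<Rightarrow> real" where
  "cross n i j \<equiv> \<Sum>\<tau>=1..n. y \<tau> i * y \<tau> j"

text \<open>Twice everything that the objective divides by l: squared errors, Gaussian penalty and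
  the scale of the inverse gamma prior. The index \<open>n\<close> counts observed rounds, so the
  objective concerned is that of round \<open>Suc n\<close>.\<close>

definition ridge :: "nat \<Rightarrow> (nat \<Rightarrow> real) \<Rightarrow> real" where
  "ridge n u = (\<Sum>\<tau>=1..n. (err u \<tau>)\<^sup>2)
     + (\<Sum>i=1..K-1. \<Sum>j=1..K-1. (u i - ubar) * \<Lambda> i j * (u j - ubar))
     + (lam + real K + 1) * lbar"

text \<open>The dependence on u sits entirely in the numerator over 2 l, so the joint minimization
  decouples: u minimizes \<open>ridge n\<close> whatever l is, and l minimizes a scalar function.
  The coefficient of the logarithm collects n from the rounds, K - 1 from \<open>phi_penalty\<close>
  and lam + 2 from \<open>varphi_penalty\<close>.\<close>

lemma objective_ridge:
  assumes l: "0 < l"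
  shows "objective K \<Lambda> lam ubar lbar y (Suc n) k u l =
     ridge n u / (2 * l) + (real n + real K + 1 + lam) / 2 * ln l"
proof -
  have *: "(\<Sum>\<tau>\<in>{1..<Suc n}. (y \<tau> k - (\<Sum>j=1..K-1. u j * drop_component k (y \<tau>) j))\<^sup>2 / (2 * l) + ln l / 2)
     = (\<Sum>\<tau>=1..n. (err u \<tau>)\<^sup>2) / (2 * l) + real n * ln l / 2"
    unfolding atLeastLessThanSuc_atLeastAtMost drop_component_skip sum_contrast[OF k]
    by (simp add: sum.distrib sum_divide_distrib)
  then show ?thesis
    unfolding objective_def phi_penalty_def varphi_penalty_def ridge_def *
    using l by (simp add: field_simps)
qed

lemma lh_pos: "0 < lh n"
  using fit[of n] by (simp add: is_arg_min_def)

lemma fit_le: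
  assumes "0 < l"
  shows "ridge n (uh n) / (2 * lh n) + (real n + real K + 1 + lam) / 2 * ln (lh n) \<le>
     ridge n u / (2 * l) + (real n + real K + 1 + lam) / 2 * ln l"
proof -
  have "\<not> objective K \<Lambda> lam ubar lbar y (Suc n) k u l
      < objective K \<Lambda> lam ubar lbar y (Suc n) k (uh n) (lh n)"
    using fit[of n] assms by (auto simp: is_arg_min_def)
  then show ?thesis by (simp add: objective_ridge assms lh_pos not_less)
qed

text \<open>The term with \<open>lbar\<close> keeps the value strictly positive even when all errors
  vanish, as happens at \<open>n = 0\<close> with u at its prior mean; the scalar minimization over
  l depends on this.\<close>

lemma ridge_pos: "0 < ridge n u"
proof -
  have "0 \<le> (\<Sum>i=1..K-1. \<Sum>j=1..K-1. (u i - ubar) * \<Lambda> i j * (u j - ubar))"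
  proof (cases "\<exists>i\<in>{1..K-1}. u i - ubar \<noteq> 0")
    case True
    then obtain i where "i \<in> {1..K-1}" "u i - ubar \<noteq> 0" by blast
    then show ?thesis using pos_def_pos[OF \<Lambda>, of i "\<lambda>i. u i - ubar"] by simp
  next
    case False
    then show ?thesis by (auto intro!: sum_nonneg)
  qed
  moreover have "0 < (lam + real K + 1) * lbar" using lam lbar by simp
  ultimately show ?thesis
    unfolding ridge_def by (smt (verit) sum_nonneg zero_le_power2)
qed

lemma lh_eq: "lh n = ridge n (uh n) / (real n + real K + 1 + lam)"
  using lam by (intro log_ratio_minimizer ridge_pos lh_pos fit_le) auto

lemma ridge_min: "ridge n (uh n) \<le> ridge n u"
  using fit_le[of "lh n" n u] lh_pos[of n] by (simp add: divide_le_cancel)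

text \<open>Exact expansion along a line. The coefficient of 2 s is the left-hand side of the normal
  equations tested against v; the symmetry of \<Lambda> merges its two cross terms.\<close>

lemma ridge_perturb:
  "ridge n (\<lambda>j. u j + s * v j) = ridge n u
     + 2 * s * (\<Sum>i=1..K-1. v i * ((\<Sum>j=1..K-1. \<Lambda> i j * (u j - ubar))
         - (\<Sum>\<tau>=1..n. err u \<tau> * y \<tau> (skip k i))))
     + s\<^sup>2 * ((\<Sum>\<tau>=1..n. (\<Sum>j=1..K-1. v j * y \<tau> (skip k j))\<^sup>2)
         + qform (K-1) \<Lambda> v)"
proof -
  define R where "R \<tau> = err u \<tau>" for \<tau>
  define V where "V \<tau> = (\<Sum>j=1..K-1. v j * y \<tau> (skip k j))" for \<tau>
  define p where "p i = u i - ubar" for i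
  have sym: "\<Lambda> i j = \<Lambda> j i" if "i \<in> {1..K-1}" "j \<in> {1..K-1}" for i j
    using \<Lambda> that unfolding pos_def_def by blast
  have 1: "(\<Sum>i=1..K. contrast k (\<lambda>j. u j + s * v j) i * y \<tau> i) = R \<tau> - s * V \<tau>" for \<tau>
    unfolding R_def V_def sum_contrast[OF k]
    by (simp add: sum.distrib sum_distrib_left algebra_simps)
  have 2: "(\<Sum>\<tau>=1..n. (R \<tau> - s * V \<tau>)\<^sup>2) = (\<Sum>\<tau>=1..n. (R \<tau>)\<^sup>2) - 2 * s * (\<Sum>\<tau>=1..n. R \<tau> * V \<tau>)
      + s\<^sup>2 * (\<Sum>\<tau>=1..n. (V \<tau>)\<^sup>2)"
    by (simp add: power2_diff power_mult_distrib sum.distrib sum_subtractf sum_distrib_left mult.assoc mult.left_commute)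
  have 3: "(\<Sum>\<tau>=1..n. R \<tau> * V \<tau>) = (\<Sum>i=1..K-1. v i * (\<Sum>\<tau>=1..n. R \<tau> * y \<tau> (skip k i)))"
    unfolding V_def sum_distrib_left by (subst sum.swap) (simp add: mult.left_commute)
  have 4: "(\<Sum>i=1..K-1. \<Sum>j=1..K-1. p i * \<Lambda> i j * v j) = (\<Sum>i=1..K-1. v i * (\<Sum>j=1..K-1. \<Lambda> i j * p j))"
    unfolding sum_distrib_left
    by (subst sum.swap, intro sum.cong refl) (simp add: sym)
  have 5: "(\<Sum>i=1..K-1. \<Sum>j=1..K-1. v i * \<Lambda> i j * p j) = (\<Sum>i=1..K-1. v i * (\<Sum>j=1..K-1. \<Lambda> i j * p j))"
    by (simp add: sum_distrib_left mult.assoc)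
  have "(\<Sum>i=1..K-1. \<Sum>j=1..K-1. (p i + s * v i) * \<Lambda> i j * (p j + s * v j)) =
     (\<Sum>i=1..K-1. \<Sum>j=1..K-1. p i * \<Lambda> i j * p j + s * (p i * \<Lambda> i j * v j) + s * (v i * \<Lambda> i j * p j)
        + s\<^sup>2 * (v i * \<Lambda> i j * v j))"
    by (intro sum.cong refl) (simp add: algebra_simps power2_eq_square)
  also have "\<dots> = qform (K-1) \<Lambda> p
      + 2 * s * (\<Sum>i=1..K-1. v i * (\<Sum>j=1..K-1. \<Lambda> i j * p j))
      + s\<^sup>2 * qform (K-1) \<Lambda> v"
    by (simp only: sum.distrib sum_distrib_left[symmetric] 4 5)
  finally have 6: "(\<Sum>i=1..K-1. \<Sum>j=1..K-1. (p i + s * v i) * \<Lambda> i j * (p j + s * v j)) = \<dots>" .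
  have 7: "(u i + s * v i - ubar) = p i + s * v i" for i by (simp add: p_def)
  show ?thesis
    unfolding ridge_def 1 2 3 7 6 R_def[symmetric] V_def[symmetric] p_def[symmetric]
    by (simp add: right_diff_distrib sum_subtractf algebra_simps)
qed

lemma normal_equations:
  assumes i: "i \<in> {1..K-1}"
  shows "(\<Sum>j=1..K-1. (cross n (skip k i) (skip k j) + \<Lambda> i j) * uh n j) =
    cross n (skip k i) k + (\<Sum>j=1..K-1. \<Lambda> i j * ubar)"
proof -
  define g where "g i = (\<Sum>j=1..K-1. \<Lambda> i j * (uh n j - ubar))
         - (\<Sum>\<tau>=1..n. err (uh n) \<tau> * y \<tau> (skip k i))" for i
  \<comment> \<open>Perturbing the coordinate i alone isolates the i-th normal equation.\<close>
  define v where "v j = (if j = i then 1 else 0 :: real)" for j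
  have "0 \<le> 2 * s * (\<Sum>j=1..K-1. v j * g j)
      + s\<^sup>2 * ((\<Sum>\<tau>=1..n. (\<Sum>j=1..K-1. v j * y \<tau> (skip k j))\<^sup>2)
         + qform (K-1) \<Lambda> v)" for s
    using ridge_min[of n "\<lambda>j. uh n j + s * v j"] unfolding ridge_perturb g_def by linarith
  then have "(\<Sum>j=1..K-1. v j * g j) = 0" by (rule linear_term_zero)
  moreover have "(\<Sum>j=1..K-1. v j * g j) = g i"
    using i by (simp add: v_def if_distrib[of "\<lambda>x. x * _"] sum.delta cong: if_cong)
  ultimately have "g i = 0" by simp
  moreover have "(\<Sum>\<tau>=1..n. err (uh n) \<tau> * y \<tau> (skip k i)) =
      cross n (skip k i) k - (\<Sum>j=1..K-1. cross n (skip k i) (skip k j) * uh n j)"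
    unfolding sum_contrast[OF k] left_diff_distrib sum_subtractf sum_distrib_right
    by (subst (2) sum.swap, simp add: mult.commute mult.left_commute)
  ultimately show ?thesis
    unfolding g_def by (simp add: right_diff_distrib distrib_right sum.distrib sum_subtractf)
qed

text \<open>The normal equations divided by n. On this scale the data part converges to covariances
  and the share of \<Lambda> fades like 1/n.\<close>

definition gram :: "nat \<Rightarrow> nat \<Rightarrow> nat \<Rightarrow> real" where
  "gram n i j = cross n (skip k i) (skip k j) / real n + \<Lambda> i j / real n"

definition rhs :: "nat \<Rightarrow> nat \<Rightarrow> real" where
  "rhs n i = cross n (skip k i) k / real n + (\<Sum>j=1..K-1. \<Lambda> i j * ubar) / real n"

text \<open>The empirical part is a sum of squares and \<Lambda> makes the total strict, so the
  system is uniquely solvable from the first observed round on, also with fewer rounds than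
  unknowns.\<close>

lemma gram_pos_def:
  assumes n: "0 < n" shows "pos_def (K - 1) (gram n)"
  unfolding pos_def_def
proof (intro conjI ballI allI impI)
  fix i j assume "i \<in> {1..K-1}" "j \<in> {1..K-1}"
  then have "\<Lambda> i j = \<Lambda> j i" using \<Lambda> unfolding pos_def_def by blast
  then show "gram n i j = gram n j i" by (simp add: gram_def mult.commute)
next
  fix v :: "nat \<Rightarrow> real" assume "\<exists>i\<in>{1..K-1}. v i \<noteq> 0"
  then have p: "0 < qform (K-1) \<Lambda> v"
    using \<Lambda> unfolding pos_def_def by blast
  have "(\<Sum>i=1..K-1. \<Sum>j=1..K-1. v i * cross n (skip k i) (skip k j) * v j)
     = (\<Sum>i=1..K-1. \<Sum>j=1..K-1. \<Sum>\<tau>=1..n. (v i * y \<tau> (skip k i)) * (v j * y \<tau> (skip k j)))"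
    by (intro sum.cong refl) (simp add: sum_distrib_left sum_distrib_right algebra_simps)
  also have "\<dots> = (\<Sum>\<tau>=1..n. \<Sum>i=1..K-1. \<Sum>j=1..K-1. (v i * y \<tau> (skip k i)) * (v j * y \<tau> (skip k j)))"
    by (subst sum.swap, subst (2) sum.swap) (rule refl)
  also have "\<dots> = (\<Sum>\<tau>=1..n. (\<Sum>i=1..K-1. v i * y \<tau> (skip k i))\<^sup>2)"
    by (simp add: power2_eq_square sum_product)
  finally have q: "0 \<le> (\<Sum>i=1..K-1. \<Sum>j=1..K-1. v i * cross n (skip k i) (skip k j) * v j)"
    by (simp add: sum_nonneg)
  have "(\<Sum>i=1..K-1. \<Sum>j=1..K-1. v i * gram n i j * v j) =
     ((\<Sum>i=1..K-1. \<Sum>j=1..K-1. v i * cross n (skip k i) (skip k j) * v j)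
      + qform (K-1) \<Lambda> v) / real n"
    unfolding gram_def sum.distrib[symmetric] sum_divide_distrib[where A = "{1..K-1}"]
    by (intro sum.cong refl) (simp add: add_divide_distrib[symmetric] algebra_simps)
  also have "\<dots> > 0" using p q n by simp
  finally show "0 < (\<Sum>i=1..K-1. \<Sum>j=1..K-1. v i * gram n i j * v j)" .
qed

lemma uh_eq_solve:
  assumes n: "0 < n" and i: "i \<in> {1..K-1}"
  shows "uh n i = solve (K - 1) (gram n) (rhs n) i"
proof (rule pos_def_unique[OF gram_pos_def[OF n] _ i])
  fix i assume i: "i \<in> {1..K-1}"
  have "(\<Sum>j=1..K-1. gram n i j * uh n j) =
    (\<Sum>j=1..K-1. (cross n (skip k i) (skip k j) + \<Lambda> i j) * uh n j) / real n"
    unfolding gram_def sum_divide_distrib[where A = "{1..K-1}"]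
    by (intro sum.cong refl) (simp add: add_divide_distrib[symmetric])
  also have "\<dots> = rhs n i" unfolding normal_equations[OF i] rhs_def by (simp add: add_divide_distrib)
  also have "\<dots> = (\<Sum>j=1..K-1. gram n i j * solve (K - 1) (gram n) (rhs n) j)"
    by (rule solve_correct[OF gram_pos_def[OF n] i, symmetric])
  finally show "(\<Sum>j=1..K-1. gram n i j * uh n j) = (\<Sum>j=1..K-1. gram n i j * solve (K - 1) (gram n) (rhs n) j)" .
qed

text \<open>Population counterpart of the fit: coefficients of the best linear prediction of
  component k from the others under the covariance C.\<close>

definition ustar :: "nat \<Rightarrow> real" where
  "ustar = solve (K - 1) (\<lambda>i j. C (skip k i) (skip k j)) (\<lambda>i. C (skip k i) k)"

lemma C_sym: "i \<in> {1..K} \<Longrightarrow> j \<in> {1..K} \<Longrightarrow> C i j = C j i"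
  using C unfolding pos_def_def by blast

lemma minor_pos_def: "pos_def (K - 1) (\<lambda>i j. C (skip k i) (skip k j))"
  unfolding pos_def_def
proof (intro conjI ballI allI impI)
  fix i j assume "i \<in> {1..K-1}" "j \<in> {1..K-1}"
  then show "C (skip k i) (skip k j) = C (skip k j) (skip k i)"
    using skip_in[OF k] by (intro C_sym) auto
next
  fix v :: "nat \<Rightarrow> real" assume "\<exists>i\<in>{1..K-1}. v i \<noteq> 0"
  then obtain i where i: "i \<in> {1..K-1}" "v i \<noteq> 0" by blast
  \<comment> \<open>Extension of v by zero at position k. \<open>contrast\<close> carries v with a
    minus sign at the skipped positions, hence the negation.\<close>
  define v' where "v' i = (if i = k then 0 else - contrast k v i)" for i
  have v': "v' k = 0" "\<And>j. v' (skip k j) = v j"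
    by (auto simp: v'_def contrast_simps) (auto simp: skip_def split: if_splits)
  have "0 < qform K C v'"
    using i v' skip_in[OF k i(1)] by (intro pos_def_pos[OF C, of "skip k i"]) auto
  also have "\<dots> = (\<Sum>i=1..K-1. \<Sum>j=1..K-1. v i * C (skip k i) (skip k j) * v j)"
    unfolding sum_skip[OF k] by (simp add: v')
  finally show "0 < (\<Sum>i=1..K-1. \<Sum>j=1..K-1. v i * C (skip k i) (skip k j) * v j)" .
qed

lemma rconv_uh:
  assumes i: "i \<in> {1..K-1}" shows "rconv (\<lambda>n. uh n i) (ustar i)"
proof (rule rconv_eventually)
  show "eventually (\<lambda>n. solve (K - 1) (gram n) (rhs n) i = uh n i) sequentially"
    using eventually_gt_at_top[of 0] by eventually_elim (rule uh_eq_solve[symmetric, OF _ i])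
  show "rconv (\<lambda>n. solve (K - 1) (gram n) (rhs n) i) (ustar i)"
    unfolding ustar_def
  proof (rule rconv_solve[OF minor_pos_def _ _ i])
    fix i j assume "i \<in> {1..K-1}" "j \<in> {1..K-1}"
    then show "rconv (\<lambda>n. gram n i j) (C (skip k i) (skip k j))"
      unfolding gram_def using rconv_add[OF cov rconv_over_n] skip_in[OF k] by simp
  next
    fix i assume "i \<in> {1..K-1}"
    then show "rconv (\<lambda>n. rhs n i) (C (skip k i) k)"
      unfolding rhs_def using rconv_add[OF cov rconv_over_n] skip_in[OF k] k by simp
  qed
qed

text \<open>The population variance of the prediction error of component k.\<close>

definition lstar :: real where
  "lstar = (\<Sum>i=1..K. \<Sum>j=1..K. contrast k ustar i * C i j * contrast k ustar j)"

lemma lstar_pos: "0 < lstar"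
  unfolding lstar_def by (rule pos_def_pos[OF C k]) (simp add: contrast_simps)

lemma rconv_contrast:
  assumes i: "i \<in> {1..K}" shows "rconv (\<lambda>n. contrast k (uh n) i) (contrast k ustar i)"
proof (cases "i = k")
  case False
  then have "(if i < k then i else i - 1) \<in> {1..K-1}" using i k by auto
  then show ?thesis using False unfolding contrast_def by (auto intro!: rconv_uminus rconv_uh)
qed (simp add: contrast_simps rconv_const)

lemma rconv_lh: "rconv lh lstar"
proof -
  \<comment> \<open>The mean squared error is the empirical covariance evaluated at the contrast, so
    its limit follows from the limits of both, although the contrast itself moves with n.\<close>
  have *: "(\<Sum>\<tau>=1..n. (err u \<tau>)\<^sup>2) / real n =
    (\<Sum>i=1..K. \<Sum>j=1..K. contrast k u i * (cross n i j / real n) * contrast k u j)" for n u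
  proof -
    have "(\<Sum>\<tau>=1..n. (err u \<tau>)\<^sup>2) =
      (\<Sum>\<tau>=1..n. \<Sum>i=1..K. \<Sum>j=1..K. (contrast k u i * y \<tau> i) * (contrast k u j * y \<tau> j))"
      by (simp add: power2_eq_square sum_product)
    also have "\<dots> = (\<Sum>i=1..K. \<Sum>j=1..K. \<Sum>\<tau>=1..n. (contrast k u i * y \<tau> i) * (contrast k u j * y \<tau> j))"
      by (subst sum.swap, subst (2) sum.swap) simp
    finally show ?thesis
      by (simp add: sum_divide_distrib sum_distrib_left sum_distrib_right algebra_simps)
  qed
  have "rconv (\<lambda>n. (\<Sum>\<tau>=1..n. (err (uh n) \<tau>)\<^sup>2) / real n) lstar"
    unfolding * lstar_def by (intro rconv_sum rconv_mult rconv_contrast cov)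
  moreover have "rconv (\<lambda>n. (\<Sum>i=1..K-1. \<Sum>j=1..K-1. (uh n i - ubar) * \<Lambda> i j * (uh n j - ubar))
        * (1 / real n)) ((\<Sum>i=1..K-1. \<Sum>j=1..K-1. (ustar i - ubar) * \<Lambda> i j * (ustar j - ubar)) * 0)"
    by (intro rconv_sum rconv_mult rconv_diff rconv_const rconv_uh rconv_over_n)
  ultimately have "rconv (\<lambda>n. (\<Sum>\<tau>=1..n. (err (uh n) \<tau>)\<^sup>2) / real n
      + (\<Sum>i=1..K-1. \<Sum>j=1..K-1. (uh n i - ubar) * \<Lambda> i j * (uh n j - ubar)) * (1 / real n)
      + (lam + real K + 1) * lbar / real n)
     (lstar + (\<Sum>i=1..K-1. \<Sum>j=1..K-1. (ustar i - ubar) * \<Lambda> i j * (ustar j - ubar)) * 0 + 0)"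
    by (intro rconv_add rconv_over_n)
  then have 1: "rconv (\<lambda>n. ridge n (uh n) / real n) lstar"
    by (simp add: ridge_def add_divide_distrib)
  \<comment> \<open>The denominator n + K + 1 + lam of \<open>lh_eq\<close> is asymptotically n, up
    to a factor 1 + O(1/n).\<close>
  have 2: "rconv (\<lambda>n. 1 + (real K + 1 + lam) / real n) (1 + 0)"
    by (intro rconv_add rconv_const rconv_over_n)
  have "rconv (\<lambda>n. (ridge n (uh n) / real n) / (1 + (real K + 1 + lam) / real n)) (lstar / 1)"
    using 2 by (intro rconv_divide 1) auto
  then have "rconv (\<lambda>n. (ridge n (uh n) / real n) / (1 + (real K + 1 + lam) / real n)) lstar" by simp
  then show ?thesis
  proof (rule rconv_eventually)
    show "eventually (\<lambda>n. (ridge n (uh n) / real n) / (1 + (real K + 1 + lam) / real n) = lh n) sequentially"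
      using eventually_gt_at_top[of 0]
    proof eventually_elim
      case (elim n)
      then have "1 + (real K + 1 + lam) / real n = (real n + real K + 1 + lam) / real n"
        by (simp add: field_simps)
      then show ?case using elim by (simp add: lh_eq)
    qed
  qed
qed

text \<open>The contrast \<open>e = (1, -u)\<close> satisfies \<open>C e = l \<delta>\<^sub>k\<close>, so pairing it with \<open>C w = v 1\<close> reads off \<open>w\<^sub>k\<close>.\<close>

lemma solve_eq_ratio: "solve K C (\<lambda>_. v) k = v * ((1 - (\<Sum>j=1..K-1. ustar j)) / lstar)"
proof -
  let ?e = "contrast k ustar" and ?w = "solve K C (\<lambda>_. v)"
  \<comment> \<open>The rows other than k are the population normal equations that define
    \<open>ustar\<close>.\<close>
  have Ce0: "(\<Sum>j=1..K. C i j * ?e j) = 0" if i: "i \<in> {1..K}" "i \<noteq> k" for i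
  proof -
    obtain i' where i': "i' \<in> {1..K-1}" "i = skip k i'"
    proof (rule that)
      show "(if i < k then i else i - 1) \<in> {1..K-1}" using i k by auto
      show "i = skip k (if i < k then i else i - 1)" using i k by (auto simp: skip_def)
    qed
    show ?thesis
      using solve_correct[OF minor_pos_def i'(1), of "\<lambda>i. C (skip k i) k"] sum_contrast[OF k, of ustar "\<lambda>j. C i j"]
      unfolding i'(2) ustar_def[symmetric] by (simp add: mult.commute)
  qed
  have pair: "(\<Sum>i=1..K. f i * (\<Sum>j=1..K. C i j * ?e j)) = f k * (\<Sum>j=1..K. C k j * ?e j)" for f
  proof -
    have "(\<Sum>i=1..K. f i * (\<Sum>j=1..K. C i j * ?e j)) =
        (\<Sum>i=1..K. if i = k then f k * (\<Sum>j=1..K. C k j * ?e j) else 0)"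
      by (intro sum.cong refl) (simp add: Ce0 del: One_nat_def)
    then show ?thesis using k by simp
  qed
  have "lstar = (\<Sum>i=1..K. ?e i * (\<Sum>j=1..K. C i j * ?e j))"
    unfolding lstar_def by (simp add: sum_distrib_left mult.assoc)
  also have "\<dots> = (\<Sum>j=1..K. C k j * ?e j)" unfolding pair by (simp add: contrast_simps)
  finally have ls: "lstar = (\<Sum>j=1..K. C k j * ?e j)" .
  \<comment> \<open>Symmetry of C lets w^T C e be read as e^T C w, and C w is the constant vector
    v.\<close>
  have "?w k * lstar = (\<Sum>i=1..K. ?w i * (\<Sum>j=1..K. C i j * ?e j))" unfolding pair ls ..
  also have "\<dots> = (\<Sum>i=1..K. \<Sum>j=1..K. ?e i * (C i j * ?w j))"
    unfolding sum_distrib_left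
    by (subst sum.swap, intro sum.cong refl) (use C_sym in \<open>auto simp: algebra_simps\<close>)
  also have "\<dots> = (\<Sum>i=1..K. ?e i * (\<Sum>j=1..K. C i j * ?w j))"
    unfolding sum_distrib_left ..
  also have "\<dots> = (\<Sum>i=1..K. ?e i * v)"
    by (intro sum.cong refl) (simp only: solve_correct[OF C])
  also have "\<dots> = v * (1 - (\<Sum>j=1..K-1. ustar j))"
    unfolding sum_contrast[OF k] by (simp add: right_diff_distrib sum_distrib_left mult.commute)
  finally show ?thesis using lstar_pos by (simp add: field_simps)
qed

lemma rconv_weight:
  "rconv (\<lambda>n. v * ((1 - (\<Sum>j=1..K-1. uh n j)) / lh n)) (solve K C (\<lambda>_. v) k)"
  unfolding solve_eq_ratio using lstar_pos
  by (intro rconv_mult rconv_divide rconv_diff rconv_sum rconv_const rconv_uh rconv_lh) auto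

end

section \<open>Convergence of the aggregate along a path\<close>

lemma rconv_gamma: "0 < r \<Longrightarrow> rconv (\<lambda>n. gamma_weight r (Suc n)) 0"
proof -
  assume r: "0 < r"
  have "(\<lambda>n. real n powr (1/8) * (r / (r + real n))) \<longlonglongrightarrow> 0" using r by real_asymp
  then show ?thesis by (simp add: rconv_def gamma_weight_def)
qed

text \<open>Rate and growth meet here: the error of each weight times n^(1/8) tends to zero, and so
  does each estimate divided by n^(1/8); the two powers cancel in the product.\<close>

lemma nu_hat_asymptotic:
  fixes y :: "nat \<Rightarrow> nat \<Rightarrow> real" and Y :: "nat \<Rightarrow> 'a \<Rightarrow> nat \<Rightarrow> real"
  assumes K: "1 \<le> K" and C: "pos_def K C" and \<Lambda>: "pos_def (K - 1) \<Lambda>"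
    and lbar: "0 < lbar" and lam: "0 \<le> lam" and r: "0 < r"
    and cov: "\<And>i j. i \<in> {1..K} \<Longrightarrow> j \<in> {1..K} \<Longrightarrow>
        rconv (\<lambda>n. (\<Sum>\<tau>=1..n. Y \<tau> \<omega> i * Y \<tau> \<omega> j) / real n) (C i j)"
    and growth: "\<And>k. k \<in> {1..K} \<Longrightarrow> (\<lambda>n. Y (Suc n) \<omega> k / real n powr (1/8)) \<longlonglongrightarrow> 0"
    and fit: "predict_each_worker_fit \<Omega> K \<Lambda> lam ubar lbar Y uhat lhat" and \<omega>: "\<omega> \<in> \<Omega>"
  shows "(\<lambda>t. (\<Sum>k=1..K. nu_hat K vbar ubar lbar r uhat lhat t \<omega> k * Y t \<omega> k)
      - (\<Sum>k=1..K. solve K C (\<lambda>_. vbar) k * Y t \<omega> k)) \<longlonglongrightarrow> 0"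
proof (rule LIMSEQ_imp_Suc)
  let ?w = "solve K C (\<lambda>_. vbar)" and ?nu = "\<lambda>n k. nu_hat K vbar ubar lbar r uhat lhat (Suc n) \<omega> k"
  have nu: "rconv (\<lambda>n. ?nu n k) (?w k)" if k: "k \<in> {1..K}" for k
  proof -
    interpret pew_fit K \<Lambda> C lam ubar lbar "\<lambda>\<tau>. Y \<tau> \<omega>" k "\<lambda>n. uhat k n \<omega>" "\<lambda>n. lhat k n \<omega>"
    proof
      fix n
      have "1 \<le> Suc n" by simp
      then show "is_arg_min (\<lambda>(u, l). objective K \<Lambda> lam ubar lbar (\<lambda>\<tau>. Y \<tau> \<omega>) (Suc n) k u l)
          (\<lambda>(u, l). 0 < l) (uhat k n \<omega>, lhat k n \<omega>)"
        using fit k \<omega> unfolding predict_each_worker_fit_def by (metis diff_Suc_1)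
    qed (use K C \<Lambda> lbar lam k cov in auto)
    have "rconv (\<lambda>n. gamma_weight r (Suc n) * nu_tilde K vbar ubar lbar uhat lhat 1 \<omega> k
        + (1 - gamma_weight r (Suc n)) * (vbar * ((1 - (\<Sum>j=1..K-1. uhat k n \<omega> j)) / lhat k n \<omega>)))
       (0 * nu_tilde K vbar ubar lbar uhat lhat 1 \<omega> k + (1 - 0) * ?w k)"
      by (intro rconv_add rconv_mult[OF rconv_gamma[OF r] rconv_const]
          rconv_mult[OF rconv_diff[OF rconv_const rconv_gamma[OF r]] rconv_weight])
    then have "rconv (\<lambda>n. gamma_weight r (Suc n) * nu_tilde K vbar ubar lbar uhat lhat 1 \<omega> k
        + (1 - gamma_weight r (Suc n)) * (vbar * ((1 - (\<Sum>j=1..K-1. uhat k n \<omega> j)) / lhat k n \<omega>))) (?w k)"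
      by simp
    \<comment> \<open>For n > 0 the round \<open>Suc n\<close> is not the first one, so
      \<open>nu_tilde\<close> takes its fitted branch.\<close>
    then show ?thesis
      by (rule rconv_eventually, intro eventually_mono[OF eventually_gt_at_top[of 0]])
         (simp add: nu_hat_def nu_tilde_def)
  qed
  have "(\<lambda>n. \<Sum>k=1..K. (real n powr (1/8) * (?nu n k - ?w k)) * (Y (Suc n) \<omega> k / real n powr (1/8))) \<longlonglongrightarrow> (\<Sum>k=1..K. 0 * 0)"
    using nu growth unfolding rconv_def by (intro tendsto_sum tendsto_mult) auto
  moreover have "eventually (\<lambda>n. (\<Sum>k=1..K. (real n powr (1/8) * (?nu n k - ?w k)) * (Y (Suc n) \<omega> k / real n powr (1/8)))
     = (\<Sum>k=1..K. ?nu n k * Y (Suc n) \<omega> k) - (\<Sum>k=1..K. ?w k * Y (Suc n) \<omega> k)) sequentially"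
    using eventually_gt_at_top[of 0]
    by eventually_elim (simp add: sum_subtractf[symmetric] left_diff_distrib)
  ultimately show "(\<lambda>n. (\<Sum>k=1..K. ?nu n k * Y (Suc n) \<omega> k) - (\<Sum>k=1..K. ?w k * Y (Suc n) \<omega> k)) \<longlonglongrightarrow> 0"
    by (simp add: Lim_transform_eventually)
qed

section \<open>The Cramer-Wold theorem\<close>

lemma char_eqI:
  fixes X :: "'a \<Rightarrow> real"
  assumes [measurable]: "X \<in> borel_measurable \<mu>" "h \<in> borel_measurable \<mu>"
    and "finite_measure \<mu>" and h: "\<And>x. 0 \<le> h x" "\<And>x. h x \<le> B"
  shows "char (distr (density \<mu> (\<lambda>x. ennreal (h x))) borel X) s =
    Complex (\<integral>x. h x * cos (s * X x) \<partial>\<mu>) (\<integral>x. h x * sin (s * X x) \<partial>\<mu>)"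
proof -
  interpret finite_measure \<mu> by fact
  have int: "integrable \<mu> (\<lambda>x. h x *\<^sub>R iexp (s * X x))"
    by (rule integrable_const_bound[where B = B]) (use h in auto)
  have "char (distr (density \<mu> (\<lambda>x. ennreal (h x))) borel X) s = (\<integral>x. h x *\<^sub>R iexp (s * X x) \<partial>\<mu>)"
    unfolding char_def using h by (simp add: integral_distr integral_density)
  also have "\<dots> = Complex (\<integral>x. Re (h x *\<^sub>R iexp (s * X x)) \<partial>\<mu>) (\<integral>x. Im (h x *\<^sub>R iexp (s * X x)) \<partial>\<mu>)"
    by (rule complex_eqI) (simp_all only: integral_Re[OF int] integral_Im[OF int] complex.sel)
  also have "\<dots> = Complex (\<integral>x. h x * cos (s * X x) \<partial>\<mu>) (\<integral>x. h x * sin (s * X x) \<partial>\<mu>)"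
    by (simp add: Re_exp Im_exp)
  finally show ?thesis .
qed

text \<open>Levy uniqueness for finite measures with bounded densities, obtained by dividing by the
  total mass. A vanishing mass is treated apart, since there is then nothing to normalize.\<close>

lemma weighted_Levy_uniqueness:
  fixes X :: "'a \<Rightarrow> real" and X' :: "'b \<Rightarrow> real"
  assumes X[measurable]: "X \<in> borel_measurable \<mu>" "X' \<in> borel_measurable \<nu>"
    and [measurable]: "h \<in> borel_measurable \<mu>" "h' \<in> borel_measurable \<nu>"
    and fin: "finite_measure \<mu>" "finite_measure \<nu>"
    and h: "\<And>x. 0 \<le> h x" "\<And>x. h x \<le> B" and h': "\<And>x. 0 \<le> h' x" "\<And>x. h' x \<le> B"
    and c: "\<And>s. (\<integral>x. h x * cos (s * X x) \<partial>\<mu>) = (\<integral>x. h' x * cos (s * X' x) \<partial>\<nu>)"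
    and s: "\<And>s. (\<integral>x. h x * sin (s * X x) \<partial>\<mu>) = (\<integral>x. h' x * sin (s * X' x) \<partial>\<nu>)"
    and A[measurable]: "A \<in> sets borel"
  shows "(\<integral>x. h x * indicator A (X x) \<partial>\<mu>) = (\<integral>x. h' x * indicator A (X' x) \<partial>\<nu>)"
proof -
  interpret m: finite_measure \<mu> by fact
  interpret n: finite_measure \<nu> by fact
  have ih: "integrable \<mu> h" by (rule m.integrable_const_bound[where B = B]) (use h in auto)
  have ih': "integrable \<nu> h'" by (rule n.integrable_const_bound[where B = B]) (use h' in auto)
  have iA: "integrable \<mu> (\<lambda>x. h x * indicator A (X x))"
    by (rule m.integrable_const_bound[where B = B]) (use h order_trans[OF h] in \<open>auto simp: indicator_def\<close>)
  have iA': "integrable \<nu> (\<lambda>x. h' x * indicator A (X' x))"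
    by (rule n.integrable_const_bound[where B = B]) (use h' order_trans[OF h'] in \<open>auto simp: indicator_def\<close>)
  define m where "m = (\<integral>x. h x \<partial>\<mu>)"
  \<comment> \<open>The cosine hypothesis at frequency 0 says that the two total masses
    agree.\<close>
  have m': "m = (\<integral>x. h' x \<partial>\<nu>)" using c[of 0] by (simp add: m_def)
  have m0: "0 \<le> m" unfolding m_def by (rule Bochner_Integration.integral_nonneg) (rule h)
  show ?thesis
  proof (cases "m = 0")
    case True
    have "AE x in \<mu>. h x = 0"
      using True integral_nonneg_eq_0_iff_AE[OF ih] h(1) by (simp add: m_def)
    then have "(\<integral>x. h x * indicator A (X x) \<partial>\<mu>) = 0"
      by (intro integral_eq_zero_AE) auto
    moreover have "AE x in \<nu>. h' x = 0"
      using True integral_nonneg_eq_0_iff_AE[OF ih'] h'(1) by (simp add: m')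
    then have "(\<integral>x. h' x * indicator A (X' x) \<partial>\<nu>) = 0"
      by (intro integral_eq_zero_AE) auto
    ultimately show ?thesis by simp
  next
    case False
    with m0 have m: "0 < m" by simp
    let ?D = "density \<mu> (\<lambda>x. ennreal (h x / m))" and ?E = "density \<nu> (\<lambda>x. ennreal (h' x / m))"
    have "prob_space ?D"
      using m h by (intro prob_spaceI) (simp add: emeasure_density nn_integral_eq_integral ih m_def[symmetric] cong: nn_integral_cong)
    then have D: "real_distribution (distr ?D borel X)"
      by (intro prob_space.real_distribution_distr) auto
    have "prob_space ?E"
      using m h' by (intro prob_spaceI) (simp add: emeasure_density nn_integral_eq_integral ih' m'[symmetric] cong: nn_integral_cong)
    then have E: "real_distribution (distr ?E borel X')"
      by (intro prob_space.real_distribution_distr) auto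
    have "char (distr ?D borel X) = char (distr ?E borel X')"
    proof
      fix t
      have "char (distr ?D borel X) t = Complex (\<integral>x. h x / m * cos (t * X x) \<partial>\<mu>) (\<integral>x. h x / m * sin (t * X x) \<partial>\<mu>)"
        by (rule char_eqI[where B = "B / m"]) (use h m fin in \<open>auto simp: divide_right_mono\<close>)
      also have "\<dots> = Complex (\<integral>x. h' x / m * cos (t * X' x) \<partial>\<nu>) (\<integral>x. h' x / m * sin (t * X' x) \<partial>\<nu>)"
        using c[of t] s[of t] by simp
      also have "\<dots> = char (distr ?E borel X') t"
        by (rule char_eqI[where B = "B / m", symmetric]) (use h' m fin in \<open>auto simp: divide_right_mono\<close>)
      finally show "char (distr ?D borel X) t = char (distr ?E borel X') t" .
    qed
    from Levy_uniqueness[OF D E this]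
    have eq: "integral\<^sup>L (distr ?D borel X) (indicator A :: real \<Rightarrow> real) = integral\<^sup>L (distr ?E borel X') (indicator A)"
      by simp
    have "integral\<^sup>L (distr ?D borel X) (indicator A :: real \<Rightarrow> real) = (\<integral>x. h x / m * indicator A (X x) \<partial>\<mu>)"
      using m h by (subst integral_distr) (auto simp: integral_density)
    moreover have "integral\<^sup>L (distr ?E borel X') (indicator A :: real \<Rightarrow> real) = (\<integral>x. h' x / m * indicator A (X' x) \<partial>\<nu>)"
      using m h' by (subst integral_distr) (auto simp: integral_density)
    ultimately show ?thesis using eq m by simp
  qed
qed

text \<open>Only one-dimensional Levy uniqueness is available, so coordinates are treated one at a
  time: the induction over J turns trigonometric test functions of a linear form into indicators of
  the coordinates in J times trigonometric functions of the rest. At J = I only indicators of boxes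
  remain.\<close>

theorem Cramer_Wold:
  fixes \<mu> \<nu> :: "('i \<Rightarrow> real) measure"
  assumes I: "finite I"
    and sets[measurable_cong]: "sets \<mu> = sets (Pi\<^sub>M I (\<lambda>_. borel))" "sets \<nu> = sets (Pi\<^sub>M I (\<lambda>_. borel))"
    and prob: "prob_space \<mu>" "prob_space \<nu>"
    and proj: "\<And>a. distr \<mu> borel (\<lambda>x. \<Sum>i\<in>I. a i * x i) = distr \<nu> borel (\<lambda>x. \<Sum>i\<in>I. a i * x i)"
  shows "\<mu> = \<nu>"
proof -
  interpret m: prob_space \<mu> by fact
  interpret n: prob_space \<nu> by fact
  let ?eq = "\<lambda>g. (\<integral>x. g x \<partial>\<mu>) = (\<integral>x. g x \<partial>\<nu>)" and ?P = "Pi\<^sub>M I (\<lambda>_. borel)"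
  define T where "T J A x = (\<Prod>j\<in>J. indicator (A j) (x j) :: real)" for J and A :: "'i \<Rightarrow> real set" and x
  have T: "0 \<le> T J A x" "T J A x \<le> 1" for J A x
    unfolding T_def by (auto intro!: prod_nonneg prod_le_1 simp: indicator_def)
  have T_meas[measurable]: "T J A \<in> borel_measurable ?P"
    if "J \<subseteq> I" "\<And>j. j \<in> J \<Longrightarrow> A j \<in> sets borel" for J A
    unfolding T_def
  proof (rule borel_measurable_prod)
    fix j assume "j \<in> J"
    then have [measurable]: "A j \<in> sets borel" "j \<in> I" using that by auto
    show "(\<lambda>x. indicator (A j) (x j) :: real) \<in> borel_measurable ?P" by measurable
  qed
  have main: "?eq (\<lambda>x. T J A x * cos (\<Sum>i\<in>I-J. a i * x i)) \<and>
      ?eq (\<lambda>x. T J A x * sin (\<Sum>i\<in>I-J. a i * x i))"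
    if "finite J" "J \<subseteq> I" "\<And>j. j \<in> J \<Longrightarrow> A j \<in> sets borel" for J A a
    using that
  proof (induction J arbitrary: A a rule: finite_induct)
    case empty
    have "?eq (\<lambda>x. g (\<Sum>i\<in>I. a i * x i))"
      if [measurable]: "g \<in> borel_measurable borel" for g :: "real \<Rightarrow> real"
      using arg_cong[OF proj[of a], of "\<lambda>D. integral\<^sup>L D g"] by (simp add: integral_distr)
    from this[of cos] this[of sin] show ?case by (simp add: T_def)
  next
    case (insert j J)
    have j[measurable]: "j \<in> I" and J: "J \<subseteq> I" using insert.prems by auto
    have AJ: "\<And>i. i \<in> J \<Longrightarrow> A i \<in> sets borel" and Aj[measurable]: "A j \<in> sets borel"
      using insert.prems by auto
    note [measurable] = T_meas[OF J AJ]
    define \<theta> where "\<theta> x = (\<Sum>i\<in>I - insert j J. a i * x i)" for x :: "'i \<Rightarrow> real"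
    have \<theta>[measurable]: "\<theta> \<in> borel_measurable ?P"
      unfolding \<theta>_def by measurable
    have IJ: "I - J = insert j (I - insert j J)" using j insert.hyps by auto
    \<comment> \<open>Coordinate j gets a free frequency s and the others a common factor c. The
      values c = 1 and c = -1 feed the product-to-sum formulas, c = 0 removes the other
      coordinates.\<close>
    have form: "(\<Sum>i\<in>I-J. (\<lambda>i. if i = j then s else c * a i) i * x i) = s * x j + c * \<theta> x" for s c x
      unfolding IJ using I by (subst sum.insert) (auto simp: \<theta>_def sum_distrib_left mult.assoc intro!: sum.cong)
    have IH: "?eq (\<lambda>x. T J A x * cos (\<Sum>i\<in>I-J. b i * x i)) \<and>
      ?eq (\<lambda>x. T J A x * sin (\<Sum>i\<in>I-J. b i * x i))" for b
      by (rule insert.IH[OF J AJ])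
    have IHc: "?eq (\<lambda>x. T J A x * cos (s * x j + c * \<theta> x))"
      and IHs: "?eq (\<lambda>x. T J A x * sin (s * x j + c * \<theta> x))" for s c
      using IH[of "\<lambda>i. if i = j then s else c * a i"] unfolding form by auto
    have int: "integrable \<mu> (\<lambda>x. T J A x * g x)" "integrable \<nu> (\<lambda>x. T J A x * g x)"
      if [measurable]: "g \<in> borel_measurable ?P" and g: "\<And>x. \<bar>g x\<bar> \<le> 2" for g
    proof -
      have "norm (T J A x * g x) \<le> 2" for x
        using mult_mono[OF T(2)[of J A x] g[of x]] T(1)[of J A x] by (simp add: abs_mult)
      then show "integrable \<mu> (\<lambda>x. T J A x * g x)" "integrable \<nu> (\<lambda>x. T J A x * g x)"
        by (auto intro!: m.integrable_const_bound[where B = 2] n.integrable_const_bound[where B = 2])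
    qed
    \<comment> \<open>Product-to-sum formulas separate coordinate j from the remaining linear
      form.\<close>
    have cc: "?eq (\<lambda>x. T J A x * (cos (s * x j) * cos (\<theta> x)))"
      and sc: "?eq (\<lambda>x. T J A x * (sin (s * x j) * cos (\<theta> x)))"
      and cs: "?eq (\<lambda>x. T J A x * (cos (s * x j) * sin (\<theta> x)))"
      and ss: "?eq (\<lambda>x. T J A x * (sin (s * x j) * sin (\<theta> x)))" for s
    proof -
      have comb: "?eq (\<lambda>x. T J A x * g1 x / 2 + c * (T J A x * g2 x / 2))"
        if "g1 \<in> borel_measurable ?P" "g2 \<in> borel_measurable ?P"
          "\<And>x. \<bar>g1 x\<bar> \<le> 2" "\<And>x. \<bar>g2 x\<bar> \<le> 2"
          "?eq (\<lambda>x. T J A x * g1 x)"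
          "?eq (\<lambda>x. T J A x * g2 x)" for g1 g2 :: "('i \<Rightarrow> real) \<Rightarrow> real" and c
        using that int by (subst (1 2) Bochner_Integration.integral_add) auto
      have b: "\<bar>cos x\<bar> \<le> 2" "\<bar>sin x\<bar> \<le> 2" for x :: real
        using abs_cos_le_one[of x] abs_sin_le_one[of x] by linarith+
      have e: "T J A x * (cos (s * x j) * cos (\<theta> x)) = T J A x * cos (s * x j + 1 * \<theta> x) / 2 + 1 * (T J A x * cos (s * x j + (-1) * \<theta> x) / 2)"
        "T J A x * (sin (s * x j) * cos (\<theta> x)) = T J A x * sin (s * x j + 1 * \<theta> x) / 2 + 1 * (T J A x * sin (s * x j + (-1) * \<theta> x) / 2)"
        "T J A x * (cos (s * x j) * sin (\<theta> x)) = T J A x * sin (s * x j + 1 * \<theta> x) / 2 + (-1) * (T J A x * sin (s * x j + (-1) * \<theta> x) / 2)"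
        "T J A x * (sin (s * x j) * sin (\<theta> x)) = T J A x * cos (s * x j + (-1) * \<theta> x) / 2 + (-1) * (T J A x * cos (s * x j + 1 * \<theta> x) / 2)"
        for x by (simp_all add: cos_add sin_add cos_diff sin_diff field_simps)
      show "?eq (\<lambda>x. T J A x * (cos (s * x j) * cos (\<theta> x)))"
        "?eq (\<lambda>x. T J A x * (sin (s * x j) * cos (\<theta> x)))"
        "?eq (\<lambda>x. T J A x * (cos (s * x j) * sin (\<theta> x)))"
        "?eq (\<lambda>x. T J A x * (sin (s * x j) * sin (\<theta> x)))"
        unfolding e by (rule comb; (rule b IHc IHs | measurable))+
    qed
    have c0: "?eq (\<lambda>x. T J A x * cos (s * x j))"
      and s0: "?eq (\<lambda>x. T J A x * sin (s * x j))" for s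
      using IHc[of s 0] IHs[of s 0] by auto
    \<comment> \<open>Levy uniqueness needs a nonnegative weight, while g is a cosine or sine and
      may be negative. Hence the weight 1 + g; the share of the constant 1 is subtracted afterwards,
      using the case g = 0.\<close>
    have Levy: "?eq (\<lambda>x. T J A x * (1 + g x) * indicator (A j) (x j))"
      if [measurable]: "g \<in> borel_measurable ?P" and g: "\<And>x. \<bar>g x\<bar> \<le> 1"
        and c: "\<And>s. ?eq (\<lambda>x. T J A x * (cos (s * x j) * g x))"
        and s: "\<And>s. ?eq (\<lambda>x. T J A x * (sin (s * x j) * g x))" for g
    proof (rule weighted_Levy_uniqueness[where B = "1 * 2"])
      have b: "\<bar>cos x * g y\<bar> \<le> 2" "\<bar>sin x * g y\<bar> \<le> 2" "\<bar>cos x\<bar> \<le> 2" "\<bar>sin x\<bar> \<le> 2" for x y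
        using mult_mono[OF abs_cos_le_one[of x] g[of y]] mult_mono[OF abs_sin_le_one[of x] g[of y]]
          order_trans[OF abs_cos_le_one[of x], of 2] order_trans[OF abs_sin_le_one[of x], of 2] by (auto simp: abs_mult)
      have g': "0 \<le> 1 + g x" "1 + g x \<le> 2" for x using g[of x] by (auto simp: abs_le_iff)
      have hb: "0 \<le> T J A x * (1 + g x)" "T J A x * (1 + g x) \<le> 1 * 2" for x
        using mult_mono[OF T(2)[of J A x] g'(2)[of x]] T(1)[of J A x] g'(1)[of x] by simp_all
      fix s
      have e: "T J A x * (1 + g x) * f (s * x j) = T J A x * f (s * x j) + T J A x * (f (s * x j) * g x)" for f x
        by (simp add: algebra_simps)
      show "?eq (\<lambda>x. T J A x * (1 + g x) * cos (s * x j))"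
        unfolding e by (subst (1 2) Bochner_Integration.integral_add; (intro int b; measurable)?; simp only: c c0)
      show "?eq (\<lambda>x. T J A x * (1 + g x) * sin (s * x j))"
        unfolding e by (subst (1 2) Bochner_Integration.integral_add; (intro int b; measurable)?; simp only: s s0)
      show "0 \<le> T J A x * (1 + g x)" "T J A x * (1 + g x) \<le> 1 * 2" for x by (fact hb)+
      show "0 \<le> T J A x * (1 + g x)" "T J A x * (1 + g x) \<le> 1 * 2" for x by (fact hb)+
    qed (use prob in \<open>auto intro: prob_space.finite_measure\<close>)
    have L0: "?eq (\<lambda>x. T J A x * indicator (A j) (x j))"
      using Levy[of "\<lambda>_. 0"] by simp
    have Tins: "T (insert j J) A x = T J A x * indicator (A j) (x j)" for x
      unfolding T_def using insert.hyps by (simp add: mult.commute)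
    have fin: "?eq (\<lambda>x. T (insert j J) A x * g x)"
      if [measurable]: "g \<in> borel_measurable ?P" and g: "\<And>x. \<bar>g x\<bar> \<le> 1"
        and L: "?eq (\<lambda>x. T J A x * (1 + g x) * indicator (A j) (x j))" for g
    proof -
      have b: "\<bar>indicator (A j) (x j)\<bar> \<le> (2::real)" "\<bar>(1 + g x) * indicator (A j) (x j)\<bar> \<le> 2" for x
        using g[of x] by (auto simp: indicator_def abs_le_iff)
      have e: "T (insert j J) A x * g x = T J A x * ((1 + g x) * indicator (A j) (x j)) - T J A x * indicator (A j) (x j)" for x
        unfolding Tins by (simp add: algebra_simps)
      show ?thesis
        unfolding e using L L0 by (subst (1 2) Bochner_Integration.integral_diff; (intro int b; measurable)?; simp add: mult.assoc)
    qed
    show ?case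
      unfolding \<theta>_def[symmetric]
      by (intro conjI fin Levy cc sc cs ss) (auto intro: abs_cos_le_one abs_sin_le_one)
  qed
  show ?thesis
  proof (rule measure_eqI_PiM_infinite[where I = I and M = "\<lambda>_. borel"])
    fix A :: "'i \<Rightarrow> real set" and J assume J: "finite J" "J \<subseteq> I" and A: "\<And>i. i \<in> J \<Longrightarrow> A i \<in> sets borel"
    let ?E = "prod_emb I (\<lambda>_. borel) J (Pi\<^sub>E J A)"
    have E: "?E \<in> sets ?P" using J A by (intro sets_PiM_I) auto
    have TE: "T J A x = indicator ?E x" if "x \<in> space ?P" for x
    proof (cases "\<forall>j\<in>J. x j \<in> A j")
      case True
      then have "T J A x = 1" by (simp add: T_def)
      then show ?thesis using True that J by (auto simp: prod_emb_def space_PiM indicator_def)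
    next
      case False
      then obtain j where "j \<in> J" "x j \<notin> A j" by blast
      then have "T J A x = 0" using J(1) unfolding T_def by (intro prod_zero bexI[of _ j]) auto
      moreover have "x \<notin> ?E" using \<open>j \<in> J\<close> \<open>x j \<notin> A j\<close> by (auto simp: prod_emb_def PiE_iff)
      ultimately show ?thesis by simp
    qed
    have "measure \<mu> ?E = (\<integral>x. T J A x \<partial>\<mu>)"
      using E sets_eq_imp_space_eq[OF sets(1)] by (subst Bochner_Integration.integral_cong[OF refl TE]) (auto simp: sets)
    also have "\<dots> = (\<integral>x. T J A x \<partial>\<nu>)" using main[OF J, of A "\<lambda>_. 0"] A by simp
    also have "\<dots> = measure \<nu> ?E"
      using E sets_eq_imp_space_eq[OF sets(2)] by (subst Bochner_Integration.integral_cong[OF refl TE]) (auto simp: sets)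
    finally show "emeasure \<mu> ?E = emeasure \<nu> ?E"
      by (simp add: m.emeasure_eq_measure n.emeasure_eq_measure)
  qed (use sets in \<open>auto intro: m.finite_measure_axioms\<close>)
qed

section \<open>Normal laws and laws of large numbers\<close>

text \<open>Point masses and proper normal laws become affine images of the same standard normal
  law, so that moments and characteristic functions need no case distinction on s.\<close>

lemma normal_law_distr:
  assumes s: "0 \<le> s"
  shows "normal_law m s = distr std_normal_distribution borel (\<lambda>x. m + s * x)"
proof (cases "s = 0")
  case True
  interpret prob_space std_normal_distribution by (rule prob_space_normal_density) simp
  show ?thesis using True by (simp add: normal_law_def distr_const)
next
  case False
  interpret prob_space std_normal_distribution by (rule prob_space_normal_density) simp
  have "distributed std_normal_distribution lborel (\<lambda>x. x) (normal_density 0 1)"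
    by (auto simp: distributed_def intro!: measure_eqI simp: emeasure_distr)
  from normal_density_affine[OF this, of s m] False s
  have "distr std_normal_distribution lborel (\<lambda>x. m + s * x) = density lborel (\<lambda>x. ennreal (normal_density m s x))"
    by (simp add: distributed_def)
  moreover have "distr std_normal_distribution lborel (\<lambda>x. m + s * x) = distr std_normal_distribution borel (\<lambda>x. m + s * x)"
    by (rule distr_cong) auto
  ultimately show ?thesis using False by (simp only: normal_law_def if_False)
qed

lemma
  shows prob_space_normal_law: "0 \<le> s \<Longrightarrow> prob_space (normal_law m s)"
    and sets_normal_law[simp, measurable_cong]: "sets (normal_law m s) = sets borel"
proof -
  interpret prob_space std_normal_distribution by (rule prob_space_normal_density) simp
  show "0 \<le> s \<Longrightarrow> prob_space (normal_law m s)"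
    by (simp add: normal_law_distr prob_space_distr)
qed (simp add: normal_law_def)

lemma integrable_normal_law_power:
  assumes "0 \<le> s" shows "integrable (normal_law m s) (\<lambda>x. x ^ k)"
proof -
  have "integrable std_normal_distribution (\<lambda>x. (m + s * x) ^ k)"
  proof -
    have "(\<lambda>x. (m + s * x) ^ k) = (\<lambda>x. \<Sum>i\<le>k. (of_nat (k choose i) * m ^ i * s ^ (k - i)) * x ^ (k - i))"
      unfolding binomial_ring power_mult_distrib by (simp only: mult.assoc)
    then show ?thesis
      by (simp only:) (intro Bochner_Integration.integrable_sum integrable_mult_right
        integrable_std_normal_distribution_moment)
  qed
  then show ?thesis using assms by (simp add: normal_law_distr integrable_distr_eq)
qed

lemma integral_normal_law:
  assumes "0 \<le> s" shows "(\<integral>x. x \<partial>normal_law m s) = m"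
proof -
  interpret prob_space std_normal_distribution by (rule prob_space_normal_density) simp
  have i1: "integrable std_normal_distribution (\<lambda>x. x)" and m1: "(\<integral>x. x \<partial>std_normal_distribution) = 0"
    using integrable_std_normal_distribution_moment[of 1] integral_std_normal_distribution_moment_odd[of 1]
    by (simp_all only: power_one_right odd_one simp_thms)
  have "(\<integral>x. x \<partial>normal_law m s) = (\<integral>x. m + s * x \<partial>std_normal_distribution)"
    unfolding normal_law_distr[OF assms] by (rule integral_distr) auto
  also have "\<dots> = (\<integral>x. m \<partial>std_normal_distribution) + (\<integral>x. s * x \<partial>std_normal_distribution)"
    by (intro Bochner_Integration.integral_add integrable_mult_right i1 integrable_const)
  also have "\<dots> = m" by (simp only: integral_mult_right_zero m1 lebesgue_integral_const prob_space) simp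
  finally show ?thesis .
qed

lemma integral_normal_law_square:
  assumes "0 \<le> s" shows "(\<integral>x. x\<^sup>2 \<partial>normal_law 0 s) = s\<^sup>2"
proof -
  have f: "fact 2 / (2 ^ 1 * fact 1) = (1::real)" by (simp add: fact_numeral)
  have 1: "(\<integral>x. x\<^sup>2 \<partial>std_normal_distribution) = 1"
    by (rule std_normal_distribution_even_moments(1)[of 1, unfolded mult_1_right f])
  have "(\<integral>x. x\<^sup>2 \<partial>normal_law 0 s) = (\<integral>x. (0 + s * x)\<^sup>2 \<partial>std_normal_distribution)"
    unfolding normal_law_distr[OF assms] by (rule integral_distr) auto
  also have "\<dots> = s\<^sup>2 * (\<integral>x. x\<^sup>2 \<partial>std_normal_distribution)"
    by (simp only: add_0 power_mult_distrib integral_mult_right_zero)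
  finally show ?thesis by (simp only: 1 mult_1_right)
qed

lemma char_normal_law:
  assumes "0 \<le> s" shows "char (normal_law 0 s) t = complex_of_real (exp (- (s\<^sup>2 * t\<^sup>2) / 2))"
proof -
  have "char (normal_law 0 s) t = (\<integral>x. iexp (t * (0 + s * x)) \<partial>std_normal_distribution)"
    unfolding char_def normal_law_distr[OF assms] by (rule integral_distr) auto
  also have "\<dots> = char std_normal_distribution (s * t)"
    unfolding char_def by (simp only: add_0 mult_ac)
  also have "\<dots> = complex_of_real (exp (- (s\<^sup>2 * t\<^sup>2) / 2))"
    unfolding char_std_normal_distribution by (simp only: power_mult_distrib)
  finally show ?thesis .
qed

text \<open>By monotone convergence the series of the \<open>f n\<close> has finite expectation,
  hence it converges almost everywhere and its terms tend to zero.\<close>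

lemma AE_tendsto_0_of_summable:
  fixes f :: "nat \<Rightarrow> 'a \<Rightarrow> real"
  assumes [measurable]: "\<And>n. integrable M (f n)" and nn: "\<And>n x. 0 \<le> f n x"
    and le: "\<And>n. (\<integral>x. f n x \<partial>M) \<le> g n" and g: "summable g"
  shows "AE x in M. (\<lambda>n. f n x) \<longlonglongrightarrow> 0"
proof -
  have g0: "0 \<le> g n" for n
    by (rule order_trans[OF Bochner_Integration.integral_nonneg le]) (rule nn)
  have "(\<integral>\<^sup>+x. (\<Sum>n. ennreal (f n x)) \<partial>M) = (\<Sum>n. \<integral>\<^sup>+x. ennreal (f n x) \<partial>M)"
    by (rule nn_integral_suminf) measurable
  also have "\<dots> \<le> (\<Sum>n. ennreal (g n))"
    using assms by (intro suminf_le) (auto simp: nn_integral_eq_integral intro!: ennreal_leI)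
  also have "\<dots> < \<infinity>"
    using g g0 by (simp add: suminf_ennreal_eq[OF _ summable_sums] less_top)
  finally have "AE x in M. (\<Sum>n. ennreal (f n x)) \<noteq> \<infinity>"
    by (intro nn_integral_PInf_AE) auto
  then show ?thesis
  proof eventually_elim
    case (elim x)
    then have "summable (\<lambda>n. f n x)"
      using nn by (intro summable_suminf_not_top) auto
    then show ?case by (rule summable_LIMSEQ_zero)
  qed
qed

text \<open>
  Along the squares \<open>m\<^sup>2\<close>, Chebyshev's bound is summable even after multiplication with the
  convergence rate; between two squares the partial sums move by at most the sum of \<open>2 m + 1\<close> terms.
\<close>

lemma orthogonal_SLLN:
  fixes X :: "nat \<Rightarrow> 'a \<Rightarrow> real"
  assumes X[measurable]: "\<And>n. X n \<in> borel_measurable M"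
    and int: "\<And>m n. 1 \<le> m \<Longrightarrow> 1 \<le> n \<Longrightarrow> integrable M (\<lambda>x. X m x * X n x)"
    and orth: "\<And>m n. 1 \<le> m \<Longrightarrow> 1 \<le> n \<Longrightarrow> m \<noteq> n \<Longrightarrow> (\<integral>x. X m x * X n x \<partial>M) = 0"
    and bound: "\<And>n. 1 \<le> n \<Longrightarrow> (\<integral>x. (X n x)\<^sup>2 \<partial>M) \<le> c"
  shows "AE x in M. (\<lambda>n. real n powr (1/8) * ((\<Sum>\<tau>=1..n. X \<tau> x) / real n)) \<longlonglongrightarrow> 0"
proof -
  define S where "S n x = (\<Sum>\<tau>=1..n. X \<tau> x)" for n x
  define B where "B m = {m\<^sup>2+1..(m+1)\<^sup>2}" for m :: nat
  let ?T = "\<lambda>m x. \<Sum>\<tau>\<in>B m. (X \<tau> x)\<^sup>2"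
  define G where "G m x = (\<Sum>\<tau>\<in>B m. \<bar>X \<tau> x\<bar>)" for m x
  define H where "H m x = \<bar>S (m\<^sup>2) x\<bar> + G m x" for m x
  have [measurable]: "S n \<in> borel_measurable M" "G n \<in> borel_measurable M" "H n \<in> borel_measurable M" for n
    unfolding S_def G_def H_def by measurable
  have isq: "integrable M (\<lambda>x. (X n x)\<^sup>2)" if "1 \<le> n" for n
    using int[of n n] that by (simp add: power2_eq_square)
  have S_sq: "(S n x)\<^sup>2 = (\<Sum>i=1..n. \<Sum>j=1..n. X i x * X j x)" for n x
    by (simp add: S_def power2_eq_square sum_product)
  have iS: "integrable M (\<lambda>x. (S n x)\<^sup>2)" for n
    unfolding S_sq by (intro Bochner_Integration.integrable_sum int) auto
  have c0: "0 \<le> c" by (rule order_trans[OF Bochner_Integration.integral_nonneg bound[of 1]]) auto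
  have S_le: "(\<integral>x. (S n x)\<^sup>2 \<partial>M) \<le> c * real n" for n
  proof -
    have "(\<integral>x. (S n x)\<^sup>2 \<partial>M) = (\<Sum>i=1..n. \<Sum>j=1..n. \<integral>x. X i x * X j x \<partial>M)"
      unfolding S_sq
      by (subst Bochner_Integration.integral_sum, fastforce intro!: Bochner_Integration.integrable_sum int,
          intro sum.cong refl Bochner_Integration.integral_sum int) auto
    also have "\<dots> = (\<Sum>i=1..n. \<integral>x. X i x * X i x \<partial>M)"
    proof (intro sum.cong refl)
      fix i assume i: "i \<in> {1..n}"
      have "(\<Sum>j=1..n. \<integral>x. X i x * X j x \<partial>M) = (\<Sum>j=1..n. if j = i then \<integral>x. X i x * X i x \<partial>M else 0)"
        using i by (intro sum.cong refl) (auto intro: orth)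
      then show "(\<Sum>j=1..n. \<integral>x. X i x * X j x \<partial>M) = (\<integral>x. X i x * X i x \<partial>M)" using i by simp
    qed
    also have "\<dots> \<le> (\<Sum>i=1..n. c)"
      using bound by (intro sum_mono) (auto simp: power2_eq_square)
    finally show ?thesis by (simp add: mult.commute)
  qed
  \<comment> \<open>Cauchy-Schwarz over the block. With \<open>B_le\<close> the block contributes
    order m^2 to the second moment, the same order as the partial sum at m^2.\<close>
  have G_sq: "(G m x)\<^sup>2 \<le> real (2*m+1) * ?T m x" for m x
  proof -
    have "card (B m) = 2 * m + 1" by (simp add: B_def power2_eq_square)
    then show ?thesis
      using sum_squared_le_sum_of_squares[of "\<lambda>\<tau>. \<bar>X \<tau> x\<bar>" "B m"] by (simp add: G_def mult.commute)
  qed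
  have iB: "integrable M (\<lambda>x. \<Sum>\<tau>\<in>B m. (X \<tau> x)\<^sup>2)" for m
    by (intro Bochner_Integration.integrable_sum isq) (auto simp: B_def)
  have B_le: "(\<integral>x. ?T m x \<partial>M) \<le> real (2*m+1) * c" for m
  proof -
    have "(\<integral>x. ?T m x \<partial>M) = (\<Sum>\<tau>\<in>B m. \<integral>x. (X \<tau> x)\<^sup>2 \<partial>M)"
      by (rule Bochner_Integration.integral_sum) (auto intro!: isq simp: B_def)
    also have "\<dots> \<le> (\<Sum>\<tau>\<in>B m. c)" by (intro sum_mono bound) (auto simp: B_def)
    finally show ?thesis by (simp add: B_def power2_eq_square)
  qed
  \<comment> \<open>A majorant of the square of \<open>H\<close>, by (a + b)^2 \<le> 2 a^2 + 2
    b^2.\<close>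
  define F where "F m x = 2 * (S (m\<^sup>2) x)\<^sup>2 + 2 * (real (2*m+1) * ?T m x)" for m x
  have HF: "(H m x)\<^sup>2 \<le> F m x" for m x
  proof -
    have "(H m x)\<^sup>2 \<le> 2 * (S (m\<^sup>2) x)\<^sup>2 + 2 * (G m x)\<^sup>2"
      unfolding H_def using sum_squares_bound[of "\<bar>S (m\<^sup>2) x\<bar>" "G m x"] by (simp add: power2_sum)
    then show ?thesis unfolding F_def using G_sq[of m x] by linarith
  qed
  have iF: "integrable M (F m)" for m
    unfolding F_def by (intro Bochner_Integration.integrable_add integrable_mult_right iS iB)
  have F_le: "(\<integral>x. F m x \<partial>M) \<le> 2 * (c * (real m)\<^sup>2) + 2 * (real (2*m+1) * (real (2*m+1) * c))" for m
  proof -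
    have "(\<integral>x. F m x \<partial>M) = 2 * (\<integral>x. (S (m\<^sup>2) x)\<^sup>2 \<partial>M) + 2 * (real (2*m+1) * (\<integral>x. ?T m x \<partial>M))"
      unfolding F_def by (subst Bochner_Integration.integral_add) (auto intro!: integrable_mult_right iS iB)
    also have "\<dots> \<le> 2 * (c * real (m\<^sup>2)) + 2 * (real (2*m+1) * (real (2*m+1) * c))"
      by (intro add_mono mult_left_mono S_le B_le) auto
    finally show ?thesis by simp
  qed
  \<comment> \<open>For m^2 \<le> n the scale n^(1/8)/n is at most m^(-7/4), whose square is
    m^(-7/2). Since F has mean of order m^2, the quotients have means of order m^(-3/2), which is
    summable.\<close>
  have "AE x in M. (\<lambda>m. F m x / real m powr (7/2)) \<longlonglongrightarrow> 0"
  proof (rule AE_tendsto_0_of_summable)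
    show "integrable M (\<lambda>x. F m x / real m powr (7/2))" for m
      by (intro integrable_divide iF)
    show "0 \<le> F m x / real m powr (7/2)" for m x
      using order_trans[OF zero_le_power2 HF] by simp
    show "(\<integral>x. F m x / real m powr (7/2) \<partial>M) \<le> 20 * c * real m powr (-3/2)" for m
    proof (cases "m = 0")
      case False
      \<comment> \<open>The bound 2 m + 1 \<le> 3 m yields the constant 20 = 2 + 2 * 9. At m = 0
        division by zero makes both sides vanish.\<close>
      have "2 * (c * (real m)\<^sup>2) + 2 * (real (2*m+1) * (real (2*m+1) * c)) \<le> 2 * (c * (real m)\<^sup>2) + 2 * ((3 * real m) * ((3 * real m) * c))"
        using False c0 by (intro add_mono mult_mono order_refl) auto
      also have "\<dots> = 20 * c * (real m)\<^sup>2" by (simp add: power2_eq_square)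
      finally have "(\<integral>x. F m x \<partial>M) \<le> 20 * c * (real m)\<^sup>2" using F_le[of m] by linarith
      then have "(\<integral>x. F m x / real m powr (7/2) \<partial>M) \<le> 20 * c * (real m)\<^sup>2 / real m powr (7/2)"
        by (simp add: divide_right_mono)
      also have "\<dots> = 20 * c * (real m powr 2 / real m powr (7/2))" using False by simp
      also have "real m powr 2 / real m powr (7/2) = real m powr (-3/2)"
        by (simp only: powr_diff[symmetric]) simp
      finally show ?thesis .
    qed simp
    show "summable (\<lambda>m. 20 * c * real m powr (-3/2))"
      by (intro summable_mult) (simp add: summable_real_powr_iff)
  qed
  then show ?thesis
  proof eventually_elim
    case (elim x)
    have "(\<lambda>m. (H m x / real m powr (7/4))\<^sup>2) \<longlonglongrightarrow> 0"
    proof (rule tendsto_sandwich[OF _ _ tendsto_const elim])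
      show "eventually (\<lambda>m. (H m x / real m powr (7/4))\<^sup>2 \<le> F m x / real m powr (7/2)) sequentially"
      proof (intro always_eventually allI)
        fix k
        have "(real k powr (7/4))\<^sup>2 = real k powr (7/2)"
          by (simp only: power2_eq_square powr_add[symmetric]) simp
        then show "(H k x / real k powr (7/4))\<^sup>2 \<le> F k x / real k powr (7/2)"
          unfolding power_divide using HF[of k x] by (simp add: divide_right_mono)
      qed
    qed simp
    from tendsto_real_sqrt[OF this]
    have Hlim: "(\<lambda>m. \<bar>H m x / real m powr (7/4)\<bar>) \<longlonglongrightarrow> 0"
      by (simp only: real_sqrt_abs real_sqrt_zero)
    \<comment> \<open>The largest m with m^2 \<le> n.\<close>
    define q where "q n = nat \<lfloor>sqrt (real n)\<rfloor>" for n
    have q_top: "filterlim q at_top at_top"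
      unfolding q_def
      by (intro filterlim_compose[OF filterlim_nat_sequentially] filterlim_compose[OF filterlim_floor_sequentially]
          filterlim_compose[OF sqrt_at_top] filterlim_real_sequentially)
    have lim: "(\<lambda>n. \<bar>H (q n) x / real (q n) powr (7/4)\<bar>) \<longlonglongrightarrow> 0"
      by (rule filterlim_compose[OF Hlim q_top])
    show ?case
    proof (rule tendsto_rabs_zero_cancel, rule tendsto_sandwich[OF _ _ tendsto_const lim])
      show "eventually (\<lambda>n. \<bar>real n powr (1/8) * ((\<Sum>\<tau>=1..n. X \<tau> x) / real n)\<bar>
          \<le> \<bar>H (q n) x / real (q n) powr (7/4)\<bar>) sequentially"
        using eventually_ge_at_top[of 1]
      proof eventually_elim
        case (elim n)
        define m where "m = q n"
        have m1: "real m \<le> sqrt (real n)" "sqrt (real n) < real m + 1"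
        proof -
          have "real m = of_int \<lfloor>sqrt (real n)\<rfloor>" by (simp add: m_def q_def)
          then show "real m \<le> sqrt (real n)" "sqrt (real n) < real m + 1" by linarith+
        qed
        have "1 \<le> m" using elim unfolding m_def q_def by (simp add: le_nat_iff le_floor_iff)
        have "(real m)\<^sup>2 \<le> (sqrt (real n))\<^sup>2" using m1(1) by (intro power_mono) auto
        then have mn': "(real m)\<^sup>2 \<le> real n" by simp
        then have "real (m\<^sup>2) \<le> real n" by simp
        then have mn: "m\<^sup>2 \<le> n" by (simp only: of_nat_le_iff)
        have "(sqrt (real n))\<^sup>2 < (real m + 1)\<^sup>2" using m1(2) by (intro power_strict_mono) auto
        then have "real n < real ((m + 1)\<^sup>2)" by (simp add: add.commute)
        then have nm: "n < (m + 1)\<^sup>2" by (simp only: of_nat_less_iff)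
        have "S n x = S (m\<^sup>2) x + (\<Sum>\<tau>\<in>{m\<^sup>2+1..n}. X \<tau> x)"
          unfolding S_def using sum.ub_add_nat[of 1 "m\<^sup>2" "\<lambda>\<tau>. X \<tau> x" "n - m\<^sup>2"] mn by simp
        moreover have "\<bar>\<Sum>\<tau>\<in>{m\<^sup>2+1..n}. X \<tau> x\<bar> \<le> (\<Sum>\<tau>\<in>{m\<^sup>2+1..n}. \<bar>X \<tau> x\<bar>)" by (rule sum_abs)
        moreover have "(\<Sum>\<tau>\<in>{m\<^sup>2+1..n}. \<bar>X \<tau> x\<bar>) \<le> G m x"
          unfolding G_def B_def using nm by (intro sum_mono2) auto
        ultimately have SH: "\<bar>S n x\<bar> \<le> H m x" unfolding H_def by linarith
        have "real n powr (1/8) / real n = real n powr (-7/8)"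
          using powr_diff[of "real n" "1/8" 1] elim by simp
        also have "\<dots> \<le> ((real m)\<^sup>2) powr (-7/8)"
          using mn' \<open>1 \<le> m\<close> by (intro powr_mono2') auto
        also have "\<dots> = 1 / real m powr (7/4)"
          using \<open>1 \<le> m\<close> by (simp add: powr_minus_divide powr_power[symmetric] powr_powr flip: powr_numeral)
        finally have "real n powr (1/8) / real n \<le> 1 / real m powr (7/4)" .
        then have "real n powr (1/8) / real n * \<bar>S n x\<bar> \<le> 1 / real m powr (7/4) * H m x"
          using SH by (intro mult_mono) auto
        moreover have "0 \<le> H m x" using SH by linarith
        ultimately show ?case
          unfolding m_def[symmetric] S_def by (simp add: abs_mult mult.commute)
      qed
    qed simp
  qed
qed

text \<open>The centred squares are orthogonal with bounded second moments, which gives the rate.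
  The growth bound needs no independence, only a high moment common to all rounds.\<close>

lemma (in prob_space) iid_normal_squares:
  fixes V :: "nat \<Rightarrow> 'a \<Rightarrow> real"
  assumes s: "0 \<le> s" and V[measurable]: "\<And>n. V n \<in> borel_measurable M" and ind: "indep_vars (\<lambda>_. borel) V {1..}"
    and law: "\<And>n. 1 \<le> n \<Longrightarrow> distr M borel (V n) = normal_law 0 s"
  shows "AE x in M. rconv (\<lambda>n. (\<Sum>\<tau>=1..n. (V \<tau> x)\<^sup>2) / real n) (s\<^sup>2)"
    and "AE x in M. (\<lambda>n. V (Suc n) x / real n powr (1/8)) \<longlonglongrightarrow> 0"
proof -
  have int: "integrable M (\<lambda>x. (V n x) ^ k)" if "1 \<le> n" for n k
    using integrable_normal_law_power[OF s, of 0 k] unfolding law[OF that, symmetric]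
    by (simp add: integrable_distr_eq)
  have EV: "(\<integral>x. g (V n x) \<partial>M) = (\<integral>x. g x \<partial>normal_law 0 s)"
    if "1 \<le> n" and [measurable]: "g \<in> borel_measurable borel" for n and g :: "real \<Rightarrow> real"
    unfolding law[OF that(1), symmetric] by (simp add: integral_distr)
  define X where "X n x = (V n x)\<^sup>2 - s\<^sup>2" for n x
  have [measurable]: "X n \<in> borel_measurable M" for n unfolding X_def by measurable
  have X1: "integrable M (X n)" "(\<integral>x. X n x \<partial>M) = 0" if "1 \<le> n" for n
    using int[OF that, of 2] EV[OF that, of "\<lambda>x. x\<^sup>2"] integral_normal_law_square[OF s]
    unfolding X_def by (auto simp: prob_space)
  have X2: "(X n x)\<^sup>2 = (V n x)^4 - 2 * s\<^sup>2 * (V n x)^2 + s^4" for n x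
    unfolding X_def by (simp add: power2_eq_square power4_eq_xxxx algebra_simps)
  have iX2: "integrable M (\<lambda>x. (X n x)\<^sup>2)" if "1 \<le> n" for n
    unfolding X2 using int[OF that] by auto
  have prod: "integrable M (\<lambda>x. X m x * X n x)" "(\<integral>x. X m x * X n x \<partial>M) = 0"
    if "1 \<le> m" "1 \<le> n" "m \<noteq> n" for m n
  proof -
    have "indep_vars (\<lambda>_. borel) (\<lambda>n x. (V n x)\<^sup>2 - s\<^sup>2) {1..}"
      by (rule indep_vars_compose2[OF ind]) measurable
    then have iX: "indep_vars (\<lambda>_. borel) X {m, n}"
      unfolding X_def using that by (elim indep_vars_subset) auto
    show "integrable M (\<lambda>x. X m x * X n x)"
      using indep_vars_integrable[OF _ iX] X1 that by auto
    show "(\<integral>x. X m x * X n x \<partial>M) = 0"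
      using indep_vars_lebesgue_integral[OF _ iX] X1 that by auto
  qed
  have "AE x in M. (\<lambda>n. real n powr (1/8) * ((\<Sum>\<tau>=1..n. X \<tau> x) / real n)) \<longlonglongrightarrow> 0"
  proof (rule orthogonal_SLLN)
    show "integrable M (\<lambda>x. X m x * X n x)" if "1 \<le> m" "1 \<le> n" for m n
      using prod(1)[of m n] iX2[of n] that by (cases "m = n") (auto simp: power2_eq_square)
    show "(\<integral>x. (X n x)\<^sup>2 \<partial>M) \<le> (\<integral>x. (x\<^sup>2 - s\<^sup>2)\<^sup>2 \<partial>normal_law 0 s)" if "1 \<le> n" for n
      unfolding X_def using EV[OF that, of "\<lambda>x. (x\<^sup>2 - s\<^sup>2)\<^sup>2"] by simp
  qed (use prod in auto)
  then show "AE x in M. rconv (\<lambda>n. (\<Sum>\<tau>=1..n. (V \<tau> x)\<^sup>2) / real n) (s\<^sup>2)"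
  proof eventually_elim
    case (elim x)
    have "eventually (\<lambda>n. real n powr (1/8) * ((\<Sum>\<tau>=1..n. X \<tau> x) / real n) =
        real n powr (1/8) * ((\<Sum>\<tau>=1..n. (V \<tau> x)\<^sup>2) / real n - s\<^sup>2)) sequentially"
      using eventually_gt_at_top[of 0]
      by eventually_elim (simp add: X_def sum_subtractf diff_divide_distrib)
    then show ?case unfolding rconv_def using elim by (simp add: Lim_transform_eventually)
  qed
  \<comment> \<open>The sixteenth power turns n^(1/8) into n^2, and 1/n^2 is summable.\<close>
  have "AE x in M. (\<lambda>n. (V (Suc n) x)^16 / (real n)\<^sup>2) \<longlonglongrightarrow> 0"
  proof (rule AE_tendsto_0_of_summable)
    show "integrable M (\<lambda>x. (V (Suc n) x)^16 / (real n)\<^sup>2)" for n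
      by (intro integrable_divide int) auto
    show "(\<integral>x. (V (Suc n) x)^16 / (real n)\<^sup>2 \<partial>M) \<le> (\<integral>x. x^16 \<partial>normal_law 0 s) * (1 / (real n)\<^sup>2)" for n
      using EV[of "Suc n" "\<lambda>x. x^16"] by simp
    show "summable (\<lambda>n. (\<integral>x. x^16 \<partial>normal_law 0 s) * (1 / (real n)\<^sup>2))"
      using inverse_power_summable[of 2, where 'a = real] by (intro summable_mult) (simp add: inverse_eq_divide)
  qed simp
  then show "AE x in M. (\<lambda>n. V (Suc n) x / real n powr (1/8)) \<longlonglongrightarrow> 0"
  proof eventually_elim
    case (elim x)
    have "(\<lambda>n. root 16 ((V (Suc n) x)^16 / (real n)\<^sup>2)) \<longlonglongrightarrow> root 16 0"
      by (rule tendsto_real_root[OF elim])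
    moreover have "eventually (\<lambda>n. root 16 ((V (Suc n) x)^16 / (real n)\<^sup>2) = \<bar>V (Suc n) x / real n powr (1/8)\<bar>) sequentially"
      using eventually_gt_at_top[of 0]
    proof eventually_elim
      case (elim n)
      have "(V (Suc n) x)^16 / (real n)\<^sup>2 = \<bar>V (Suc n) x / real n powr (1/8)\<bar> ^ 16"
        using elim by (simp add: power_divide power_even_abs powr_power)
      then show ?case by (simp only: real_root_power_cancel abs_ge_zero zero_less_numeral)
    qed
    ultimately have "(\<lambda>n. \<bar>V (Suc n) x / real n powr (1/8)\<bar>) \<longlonglongrightarrow> 0"
      by (simp add: Lim_transform_eventually)
    then show ?case by (rule tendsto_rabs_zero_cancel)
  qed
qed

section \<open>Gaussian rounds\<close>

text \<open>Each linear functional is normal with unspecified parameters. Unit vectors as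
  coefficients make the coordinates square integrable; then the first two moments of a general
  functional identify its mean as 0 and its variance as the quadratic form of the
  covariance.\<close>

lemma
  assumes Q: "prob_space Q" and g: "gaussian_vector_law n Q"
    and mean: "\<And>k. k \<in> {1..n} \<Longrightarrow> mean_vector Q k = 0"
  shows gaussian_vector_integrable: "i \<in> {1..n} \<Longrightarrow> integrable Q (\<lambda>x. x i)"
    and gaussian_vector_qform_nonneg: "0 \<le> qform n (cov_matrix Q) a"
    and gaussian_vector_distr: "distr Q borel (\<lambda>x. \<Sum>i=1..n. a i * x i) = normal_law 0 (sqrt (qform n (cov_matrix Q) a))"
proof -
  interpret prob_space Q by fact
  have sets[measurable_cong]: "sets Q = sets (rvec n)"
    using g unfolding gaussian_vector_law_def by blast
  have law: "\<exists>m s. 0 \<le> s \<and> distr Q borel (\<lambda>x. \<Sum>i=1..n. a i * x i) = normal_law m s" for a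
    using g unfolding gaussian_vector_law_def gaussian_law_def by blast
  have pow: "integrable Q (\<lambda>x. x i ^ k)" if i: "i \<in> {1..n}" for i k
  proof -
    obtain m s where ms: "0 \<le> s" "distr Q borel (\<lambda>x. \<Sum>j=1..n. (if j = i then 1 else 0) * x j) = normal_law m s"
      using law[of "\<lambda>j. if j = i then 1 else 0"] by (elim exE conjE)
    have "(\<lambda>x. \<Sum>j=1..n. (if j = i then 1 else 0) * x j) = (\<lambda>x::nat \<Rightarrow> real. x i)"
    proof
      fix x :: "nat \<Rightarrow> real"
      have "(\<Sum>j=1..n. (if j = i then 1 else 0) * x j) = (\<Sum>j=1..n. if j = i then x j else 0)"
        by (intro sum.cong refl) simp
      then show "(\<Sum>j=1..n. (if j = i then 1 else 0) * x j) = x i" using i by simp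
    qed
    with ms(2) have d: "distr Q borel (\<lambda>x. x i) = normal_law m s" by (simp only:)
    have [measurable]: "(\<lambda>x. x i) \<in> borel_measurable Q" using i by measurable
    show ?thesis
      using integrable_normal_law_power[OF ms(1), of m k] unfolding d[symmetric] by (simp add: integrable_distr_eq)
  qed
  show int: "integrable Q (\<lambda>x. x i)" if "i \<in> {1..n}" for i using pow[OF that, of 1] by simp
  have prod: "integrable Q (\<lambda>x. x i * x j)" if ij: "i \<in> {1..n}" "j \<in> {1..n}" for i j
  proof (rule Bochner_Integration.integrable_bound)
    show "integrable Q (\<lambda>x. (x i)\<^sup>2 + (x j)\<^sup>2)" using pow ij by simp
    show "(\<lambda>x. x i * x j) \<in> borel_measurable Q" using ij by measurable
    show "AE x in Q. norm (x i * x j) \<le> norm ((x i)\<^sup>2 + (x j)\<^sup>2)"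
    proof (rule AE_I2)
      fix x :: "nat \<Rightarrow> real"
      have "2 * \<bar>x i\<bar> * \<bar>x j\<bar> \<le> (x i)\<^sup>2 + (x j)\<^sup>2"
        using sum_squares_bound[of "\<bar>x i\<bar>" "\<bar>x j\<bar>"] by simp
      moreover have "0 \<le> \<bar>x i\<bar> * \<bar>x j\<bar>" by simp
      ultimately have "\<bar>x i * x j\<bar> \<le> (x i)\<^sup>2 + (x j)\<^sup>2" unfolding abs_mult by linarith
      then show "norm (x i * x j) \<le> norm ((x i)\<^sup>2 + (x j)\<^sup>2)" by simp
    qed
  qed
  have cov: "cov_matrix Q i j = (\<integral>x. x i * x j \<partial>Q)" if "i \<in> {1..n}" "j \<in> {1..n}" for i j
    using that mean by (simp add: cov_matrix_def)
  obtain m s where ms: "0 \<le> s" "distr Q borel (\<lambda>x. \<Sum>i=1..n. a i * x i) = normal_law m s"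
    using law by blast
  have [measurable]: "(\<lambda>x. \<Sum>i=1..n. a i * x i) \<in> borel_measurable Q" by measurable
  have "m = (\<integral>x. x \<partial>distr Q borel (\<lambda>x. \<Sum>i=1..n. a i * x i))"
    unfolding ms(2) by (rule integral_normal_law[OF ms(1), symmetric])
  also have "\<dots> = (\<integral>x. (\<Sum>i=1..n. a i * x i) \<partial>Q)" by (rule integral_distr) auto
  also have "\<dots> = (\<Sum>i=1..n. \<integral>x. a i * x i \<partial>Q)"
    by (intro Bochner_Integration.integral_sum integrable_mult_right int)
  also have "\<dots> = 0"
    using mean by (intro sum.neutral ballI) (simp add: mean_vector_def)
  finally have m: "m = 0" .
  have "s\<^sup>2 = (\<integral>x. x\<^sup>2 \<partial>distr Q borel (\<lambda>x. \<Sum>i=1..n. a i * x i))"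
    unfolding ms(2) m by (rule integral_normal_law_square[OF ms(1), symmetric])
  also have "\<dots> = (\<integral>x. (\<Sum>i=1..n. a i * x i)\<^sup>2 \<partial>Q)" by (rule integral_distr) auto
  also have "\<dots> = (\<integral>x. (\<Sum>i=1..n. \<Sum>j=1..n. a i * a j * (x i * x j)) \<partial>Q)"
    unfolding power2_eq_square sum_product
    by (intro arg_cong[where f = "integral\<^sup>L Q"] ext sum.cong refl) (simp add: algebra_simps)
  also have "\<dots> = (\<Sum>i=1..n. \<integral>x. (\<Sum>j=1..n. a i * a j * (x i * x j)) \<partial>Q)"
    by (intro Bochner_Integration.integral_sum Bochner_Integration.integrable_sum integrable_mult_right prod)
  also have "\<dots> = (\<Sum>i=1..n. \<Sum>j=1..n. \<integral>x. a i * a j * (x i * x j) \<partial>Q)"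
    by (intro sum.cong refl Bochner_Integration.integral_sum integrable_mult_right prod)
  also have "\<dots> = qform n (cov_matrix Q) a"
    by (intro sum.cong refl) (simp only: cov integral_mult_right_zero, simp only: mult_ac)
  finally have s: "s\<^sup>2 = qform n (cov_matrix Q) a" .
  then show "0 \<le> qform n (cov_matrix Q) a" by (metis zero_le_power2)
  show "distr Q borel (\<lambda>x. \<Sum>i=1..n. a i * x i) = normal_law 0 (sqrt (qform n (cov_matrix Q) a))"
    using ms s[symmetric] by (simp add: m)
qed

section \<open>One round for a fixed residual law\<close>

definition estimates :: "nat \<Rightarrow> (nat \<Rightarrow> real) \<times> real \<Rightarrow> nat \<Rightarrow> real" where
  "estimates K p = (\<lambda>k\<in>{1..K}. fst p k + snd p)"

definition estimate_path :: "nat \<Rightarrow> (nat \<Rightarrow> (nat \<Rightarrow> real) \<times> real) \<Rightarrow> nat \<Rightarrow> nat \<Rightarrow> real" where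
  "estimate_path K p = (\<lambda>\<tau>\<in>{1..}. estimates K (p \<tau>))"

abbreviation est_space :: "nat \<Rightarrow> (nat \<Rightarrow> nat \<Rightarrow> real) measure" where
  "est_space K \<equiv> Pi\<^sub>M {1..} (\<lambda>_. rvec K)"

text \<open>The situation for a fixed value of \<theta>: residual law Q with covariance S, and
  outcome variance v. S is positive semidefinite here; strict positivity enters only when the linear
  system for w has to be solved.\<close>

locale gaussian_round =
  fixes K :: nat and Q :: "(nat \<Rightarrow> real) measure" and S :: "nat \<Rightarrow> nat \<Rightarrow> real" and v :: real
  assumes Q: "prob_space Q" and sets_Q[measurable_cong]: "sets Q = sets (rvec K)"
    and S_nonneg: "\<And>a. 0 \<le> qform K S a"
    and S_sym: "\<And>i j. i \<in> {1..K} \<Longrightarrow> j \<in> {1..K} \<Longrightarrow> S i j = S j i"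
    and Q_linear: "\<And>a. distr Q borel (\<lambda>x. \<Sum>i=1..K. a i * x i) = normal_law 0 (sqrt (qform K S a))"
    and v: "0 \<le> v"
begin

definition R :: "((nat \<Rightarrow> real) \<times> real) measure" where
  "R = Q \<Otimes>\<^sub>M normal_law 0 (sqrt v)"

abbreviation est :: "(nat \<Rightarrow> real) \<times> real \<Rightarrow> nat \<Rightarrow> real" where
  "est \<equiv> estimates K"

lemma sets_R[measurable_cong]: "sets R = sets (rvec K \<Otimes>\<^sub>M borel)"
  unfolding R_def by (intro sets_pair_measure_cong sets_Q sets_normal_law)

lemma prob_space_R: "prob_space R"
  unfolding R_def using v by (intro prob_space_pair Q prob_space_normal_law) simp

lemma measurable_est[measurable]: "est \<in> R \<rightarrow>\<^sub>M rvec K"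
  unfolding estimates_def by measurable

text \<open>The residual functional and the scaled outcome are independent under the product
  measure, so their characteristic functions multiply and the variances add. The computation
  includes degenerate laws.\<close>

lemma R_linear:
  "distr R borel (\<lambda>p. (\<Sum>i=1..K. a i * fst p i) + b * snd p) = normal_law 0 (sqrt (qform K S a + b\<^sup>2 * v))"
proof -
  let ?Z = "normal_law 0 (sqrt v)"
  let ?L = "\<lambda>x. \<Sum>i=1..K. a i * x i" and ?LZ = "\<lambda>p. (\<Sum>i=1..K. a i * fst p i) + b * snd p"
  interpret Q: prob_space Q by (rule Q)
  interpret Z: prob_space ?Z by (rule prob_space_normal_law) (simp add: v)
  interpret P: pair_prob_space Q ?Z ..
  interpret R: prob_space R by (rule prob_space_R)
  have fst: "distr R Q fst = Q" unfolding R_def by (rule Z.distr_pair_fst)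
  have snd: "distr R ?Z snd = ?Z"
  proof (rule measure_eqI)
    fix A assume "A \<in> sets (distr R ?Z snd)"
    then have A: "A \<in> sets ?Z" by simp
    then have "snd -` A \<inter> space R = space Q \<times> A"
      using sets.sets_into_space[OF A] by (auto simp: R_def space_pair_measure)
    then show "emeasure (distr R ?Z snd) A = emeasure ?Z A"
      using A Z.emeasure_pair_measure_Times[of "space Q" Q A]
      by (simp add: emeasure_distr R_def Q.emeasure_space_1)
  qed simp
  have d1: "distr R borel (?L \<circ> fst) = normal_law 0 (sqrt (qform K S a))"
  proof -
    have "distr R borel (?L \<circ> fst) = distr (distr R Q fst) borel ?L"
      by (rule distr_distr[symmetric]) measurable
    then show ?thesis unfolding fst Q_linear .
  qed
  have d2: "distr R borel ((\<lambda>z. b * z) \<circ> snd) = distr ?Z borel (\<lambda>z. b * z)"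
  proof -
    have "distr R borel ((\<lambda>z. b * z) \<circ> snd) = distr (distr R ?Z snd) borel (\<lambda>z. b * z)"
      by (rule distr_distr[symmetric]) measurable
    then show ?thesis unfolding snd .
  qed
  have "R.indep_var borel (?L \<circ> fst) borel ((\<lambda>z. b * z) \<circ> snd)"
  proof -
    have "distr Q borel ?L \<Otimes>\<^sub>M distr ?Z borel (\<lambda>z. b * z) =
       distr (Q \<Otimes>\<^sub>M ?Z) (borel \<Otimes>\<^sub>M borel) (\<lambda>(x, z). (\<Sum>i=1..K. a i * x i, b * z))"
      by (intro pair_measure_distr prob_space_imp_sigma_finite Z.prob_space_distr) measurable
    then show ?thesis
      unfolding R.indep_var_distribution_eq d1 d2 Q_linear
      by (auto simp: R_def[symmetric] comp_def case_prod_beta')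
  qed
  note ind = this
  have c2: "char (distr ?Z borel (\<lambda>z. b * z)) t = complex_of_real (exp (- (b\<^sup>2 * v * t\<^sup>2) / 2))" for t
  proof -
    have "char (distr ?Z borel (\<lambda>z. b * z)) t = char ?Z (b * t)"
      unfolding char_def by (subst integral_distr) (auto simp: mult_ac)
    also have "\<dots> = complex_of_real (exp (- (b\<^sup>2 * v * t\<^sup>2) / 2))"
      using v by (simp add: char_normal_law power_mult_distrib mult_ac)
    finally show ?thesis .
  qed
  have nn: "0 \<le> qform K S a + b\<^sup>2 * v" using S_nonneg v by (intro add_nonneg_nonneg) auto
  have rd: "real_distribution (normal_law 0 s)" if "0 \<le> s" for s
    unfolding normal_law_distr[OF that]
    by (intro prob_space.real_distribution_distr prob_space_normal_density) auto
  show ?thesis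
  proof (rule Levy_uniqueness)
    show "real_distribution (distr R borel ?LZ)"
      by (intro R.real_distribution_distr) measurable
    show "real_distribution (normal_law 0 (sqrt (qform K S a + b\<^sup>2 * v)))"
      by (intro rd real_sqrt_ge_zero nn)
    show "char (distr R borel ?LZ) = char (normal_law 0 (sqrt (qform K S a + b\<^sup>2 * v)))"
    proof
      fix t
      have "char (distr R borel ?LZ) t =
          char (normal_law 0 (sqrt (qform K S a))) t * char (distr ?Z borel (\<lambda>z. b * z)) t"
        using R.char_distr_add[OF ind, of t, unfolded d1 d2] unfolding comp_def .
      also have "\<dots> = complex_of_real (exp (- (qform K S a * t\<^sup>2) / 2) * exp (- (b\<^sup>2 * v * t\<^sup>2) / 2))"
        unfolding c2 using S_nonneg[of a] by (simp only: char_normal_law real_sqrt_ge_zero real_sqrt_pow2 of_real_mult)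
      also have "\<dots> = complex_of_real (exp (- ((qform K S a + b\<^sup>2 * v) * t\<^sup>2) / 2))"
        unfolding exp_add[symmetric] by (simp only: distrib_right minus_add_distrib add_divide_distrib)
      also have "\<dots> = char (normal_law 0 (sqrt (qform K S a + b\<^sup>2 * v))) t"
        using nn by (simp only: char_normal_law real_sqrt_ge_zero real_sqrt_pow2)
      finally show "char (distr R borel ?LZ) t = \<dots>" .
    qed
  qed
qed

definition innov :: "(nat \<Rightarrow> real) \<Rightarrow> (nat \<Rightarrow> real) \<times> real \<Rightarrow> real" where
  "innov w p = snd p - (\<Sum>k=1..K. w k * est p k)"

lemma measurable_innov[measurable]: "innov w \<in> borel_measurable R"
  unfolding innov_def by measurable

lemma innov_linear:
  "b * innov w p + (\<Sum>i=1..K. a i * est p i) =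
     (\<Sum>i=1..K. (a i - b * w i) * fst p i) + (b * (1 - (\<Sum>k=1..K. w k)) + (\<Sum>k=1..K. a k)) * snd p"
proof -
  have e: "(\<Sum>i=1..K. c i * est p i) = (\<Sum>i=1..K. c i * fst p i) + (\<Sum>i=1..K. c i) * snd p" for c
    by (simp add: estimates_def sum.distrib distrib_left sum_distrib_right)
  show ?thesis unfolding innov_def e
    by (simp add: left_diff_distrib sum_subtractf sum_distrib_left mult.assoc algebra_simps)
qed

text \<open>The system for w has the covariance matrix S + v 1 1^T of the estimates on the left and
  their covariances v with the outcome on the right: these are the normal equations of the best
  linear predictor.\<close>

context
  fixes w :: "nat \<Rightarrow> real"
  assumes w: "\<And>i. i \<in> {1..K} \<Longrightarrow> (\<Sum>j=1..K. (S i j + v) * w j) = v"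
begin

lemma S_w: "i \<in> {1..K} \<Longrightarrow> (\<Sum>j=1..K. S i j * w j) = v * (1 - (\<Sum>k=1..K. w k))"
  using w[of i] by (simp add: distrib_right sum.distrib sum_distrib_left[symmetric] algebra_simps)

lemma qform_diff:
  "qform K S (\<lambda>i. a i - b * w i) = qform K S a - 2 * b * (v * (1 - (\<Sum>k=1..K. w k))) * (\<Sum>i=1..K. a i)
     + b\<^sup>2 * (v * (1 - (\<Sum>k=1..K. w k)) * (\<Sum>k=1..K. w k))"
proof -
  have 1: "(\<Sum>i=1..K. \<Sum>j=1..K. c i * S i j * w j) = v * (1 - (\<Sum>k=1..K. w k)) * (\<Sum>i=1..K. c i)" for c
  proof -
    have "(\<Sum>i=1..K. \<Sum>j=1..K. c i * S i j * w j) = (\<Sum>i=1..K. c i * (v * (1 - (\<Sum>k=1..K. w k))))"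
      by (intro sum.cong refl) (simp only: S_w[symmetric] sum_distrib_left mult.assoc)
    then show ?thesis by (simp only: sum_distrib_right[symmetric] mult.commute)
  qed
  have 2: "(\<Sum>i=1..K. \<Sum>j=1..K. w i * S i j * a j) = v * (1 - (\<Sum>k=1..K. w k)) * (\<Sum>i=1..K. a i)"
    unfolding 1[symmetric] by (subst sum.swap, intro sum.cong refl) (simp add: S_sym mult_ac)
  have "qform K S (\<lambda>i. a i - b * w i) = (\<Sum>i=1..K. \<Sum>j=1..K. a i * S i j * a j - b * (a i * S i j * w j)
      - b * (w i * S i j * a j) + b\<^sup>2 * (w i * S i j * w j))"
    by (intro sum.cong refl) (simp add: algebra_simps power2_eq_square)
  also have "\<dots> = qform K S a - b * (\<Sum>i=1..K. \<Sum>j=1..K. a i * S i j * w j)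
      - b * (\<Sum>i=1..K. \<Sum>j=1..K. w i * S i j * a j) + b\<^sup>2 * qform K S w"
    by (simp only: sum.distrib sum_subtractf sum_distrib_left)
  finally show ?thesis unfolding 1 2 by (simp add: algebra_simps)
qed

text \<open>The choice of \<open>w\<close> cancels the cross term, so that the variance is even in \<open>b\<close>.\<close>

lemma innov_law:
  "distr R borel (\<lambda>p. b * innov w p + (\<Sum>i=1..K. a i * est p i)) =
     normal_law 0 (sqrt (qform K S a + v * (\<Sum>i=1..K. a i)\<^sup>2 + b\<^sup>2 * (v * (1 - (\<Sum>k=1..K. w k)))))"
proof -
  have "qform K S (\<lambda>i. a i - b * w i) + (b * (1 - (\<Sum>k=1..K. w k)) + (\<Sum>k=1..K. a k))\<^sup>2 * v
    = qform K S a + v * (\<Sum>i=1..K. a i)\<^sup>2 + b\<^sup>2 * (v * (1 - (\<Sum>k=1..K. w k)))"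
    unfolding qform_diff by (simp add: algebra_simps power2_eq_square)
  then show ?thesis unfolding innov_linear R_linear by simp
qed

text \<open>The quantity v (1 - s), with s the sum of the weights, is the variance of the error.
  Nonnegativity of w^T S w = v (1 - s) s puts s between 0 and 1 unless v = 0. The upper bound v does
  not depend on S and therefore survives mixing over \<theta>.\<close>

lemma innov_variance: "0 \<le> v * (1 - (\<Sum>k=1..K. w k))" "v * (1 - (\<Sum>k=1..K. w k)) \<le> v"
proof -
  define s where "s = (\<Sum>k=1..K. w k)"
  have q: "0 \<le> v * (1 - s) * s"
    using S_nonneg[of "\<lambda>i. 0 - 1 * w i"] unfolding qform_diff s_def[symmetric] by simp
  have "0 \<le> v * (1 - s) \<and> v * (1 - s) \<le> v"
  proof (cases "v = 0")
    case False
    then have "0 < v" using v by simp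
    then have "0 \<le> (1 - s) * s" using q by (simp add: mult.assoc zero_le_mult_iff)
    then have "0 \<le> s \<and> s \<le> 1" by (auto simp: zero_le_mult_iff)
    then show ?thesis using \<open>0 < v\<close> by (simp add: mult_left_le)
  qed simp
  then show "0 \<le> v * (1 - (\<Sum>k=1..K. w k))" "v * (1 - (\<Sum>k=1..K. w k)) \<le> v" by (auto simp: s_def)
qed

lemma
  shows integrable_innov: "integrable R (innov w)"
    and integrable_innov_square: "integrable R (\<lambda>p. (innov w p)\<^sup>2)"
    and innov_square_le: "(\<integral>p. (innov w p)\<^sup>2 \<partial>R) \<le> v"
proof -
  let ?s = "sqrt (v * (1 - (\<Sum>k=1..K. w k)))"
  have s: "0 \<le> ?s" using innov_variance by simp
  have d: "distr R borel (innov w) = normal_law 0 ?s"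
    using innov_law[of 1 "\<lambda>_. 0"] by simp
  have "integrable (normal_law 0 ?s) (\<lambda>x. x ^ k)" for k by (rule integrable_normal_law_power[OF s])
  then have int: "integrable R (\<lambda>p. innov w p ^ k)" for k
    unfolding d[symmetric] by (simp add: integrable_distr_eq)
  show "integrable R (innov w)" using int[of 1] by simp
  show "integrable R (\<lambda>p. (innov w p)\<^sup>2)" by (rule int)
  have "(\<integral>p. (innov w p)\<^sup>2 \<partial>R) = (\<integral>x. x\<^sup>2 \<partial>normal_law 0 ?s)"
    unfolding d[symmetric] by (simp add: integral_distr)
  also have "\<dots> = ?s\<^sup>2" by (rule integral_normal_law_square[OF s])
  also have "\<dots> \<le> v" using innov_variance by simp
  finally show "(\<integral>p. (innov w p)\<^sup>2 \<partial>R) \<le> v" .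
qed

text \<open>By \<open>innov_law\<close> changing the sign of the error leaves every linear
  functional of error and estimates unchanged in law, so Cramer-Wold gives the same joint law for
  both signs. Since \<open>ennreal\<close> truncates at zero, the two integrals are those of the
  positive and the negative part.\<close>

lemma innov_symmetric:
  assumes G[measurable]: "G \<in> sets (rvec K)"
  shows "(\<integral>\<^sup>+p. ennreal (innov w p) * indicator G (est p) \<partial>R) = (\<integral>\<^sup>+p. ennreal (- innov w p) * indicator G (est p) \<partial>R)"
proof -
  interpret R: prob_space R by (rule prob_space_R)
  let ?P = "Pi\<^sub>M {0..K} (\<lambda>_. borel :: real measure)"
  \<comment> \<open>Error and estimates are packed into one vector; the estimates occupy the indices
    1 to K, which leaves index 0 for the error.\<close>
  define J where "J c p = (\<lambda>i\<in>{0..K}. if i = 0 then c * innov w p else est p i)" for c :: real and p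
  have J[measurable]: "J c \<in> R \<rightarrow>\<^sub>M ?P" for c
    unfolding J_def
  proof (rule measurable_restrict)
    fix i assume "i \<in> {0..K}"
    then show "(\<lambda>p. if i = 0 then c * innov w p else est p i) \<in> borel_measurable R"
      by (cases "i = 0") (auto simp: estimates_def)
  qed
  have sm: "(\<Sum>i\<in>{0..K}. a i * J c p i) = (a 0 * c) * innov w p + (\<Sum>i=1..K. a i * est p i)" for a c p
    unfolding atLeast0_atMost_Suc_eq_insert_0[symmetric]
    by (simp add: sum.atLeast_Suc_atMost[of 0 K] J_def)
  have "distr R ?P (J 1) = distr R ?P (J (-1))"
  proof (rule Cramer_Wold[of "{0..K}"])
    fix a :: "nat \<Rightarrow> real"
    have "distr (distr R ?P (J c)) borel (\<lambda>x. \<Sum>i\<in>{0..K}. a i * x i)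
       = distr R borel (\<lambda>p. (a 0 * c) * innov w p + (\<Sum>i=1..K. a i * est p i))" for c
      by (subst distr_distr) (auto simp: comp_def sm)
    then show "distr (distr R ?P (J 1)) borel (\<lambda>x. \<Sum>i\<in>{0..K}. a i * x i) =
      distr (distr R ?P (J (-1))) borel (\<lambda>x. \<Sum>i\<in>{0..K}. a i * x i)"
      by (simp only: innov_law power_mult_distrib power2_minus power_one)
  qed (auto intro: R.prob_space_distr)
  moreover have "(\<integral>\<^sup>+p. ennreal (c * innov w p) * indicator G (est p) \<partial>R) =
    (\<integral>\<^sup>+x. ennreal (x 0) * indicator G (restrict x {1..K}) \<partial>distr R ?P (J c))" for c
  proof -
    have r: "restrict (J c p) {1..K} = est p" for p
      by (auto simp: J_def estimates_def restrict_def)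
    have [measurable]: "(\<lambda>x. restrict x {1..K}) \<in> ?P \<rightarrow>\<^sub>M rvec K"
      by (rule measurable_restrict_subset) auto
    have [measurable]: "(\<lambda>x. x 0) \<in> ?P \<rightarrow>\<^sub>M (borel :: real measure)"
      by (rule measurable_component_singleton) simp
    have "(\<integral>\<^sup>+x. ennreal (x 0) * indicator G (restrict x {1..K}) \<partial>distr R ?P (J c))
      = (\<integral>\<^sup>+p. ennreal (J c p 0) * indicator G (restrict (J c p) {1..K}) \<partial>R)"
      by (rule nn_integral_distr) measurable
    then show ?thesis unfolding r by (simp add: J_def)
  qed
  from this[of 1] this[of "-1"] calculation show ?thesis by simp
qed

end

section \<open>Sequences of independent rounds with a fixed law\<close>

definition path :: "(nat \<Rightarrow> (nat \<Rightarrow> real) \<times> real) measure" where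
  "path = Pi\<^sub>M {1..} (\<lambda>_. R)"

lemma prob_space_path: "prob_space path"
  unfolding path_def by (intro prob_space_PiM prob_space_R)

lemma distr_path_coord: "1 \<le> t \<Longrightarrow> distr path R (\<lambda>p. p t) = R"
  unfolding path_def by (rule distr_PiM_component) (auto intro: prob_space_R)

lemma measurable_path_coord[measurable]: "1 \<le> t \<Longrightarrow> (\<lambda>p. p t) \<in> path \<rightarrow>\<^sub>M R"
  unfolding path_def by (rule measurable_component_singleton) simp

lemma nn_integral_path_coord:
  assumes t: "1 \<le> t" and f: "f \<in> borel_measurable R"
  shows "(\<integral>\<^sup>+p. f (p t) \<partial>path) = (\<integral>\<^sup>+q. f q \<partial>R)"
proof -
  have "(\<integral>\<^sup>+q. f q \<partial>distr path R (\<lambda>p. p t)) = (\<integral>\<^sup>+p. f (p t) \<partial>path)"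
    by (rule nn_integral_distr) (use measurable_path_coord[OF t] f in auto)
  then show ?thesis by (simp only: distr_path_coord[OF t])
qed

lemma nn_integral_path_prod:
  assumes J: "finite J" "J \<subseteq> {1..}" and f: "\<And>j. j \<in> J \<Longrightarrow> f j \<in> borel_measurable R"
  shows "(\<integral>\<^sup>+p. (\<Prod>j\<in>J. f j (p j)) \<partial>path) = (\<Prod>j\<in>J. \<integral>\<^sup>+q. f j q \<partial>R)"
proof -
  interpret R: prob_space R by (rule prob_space_R)
  interpret product_prob_space "\<lambda>_. R" "{1..} :: nat set" ..
  interpret F: finite_product_sigma_finite "\<lambda>_. R" J by standard (rule J)
  have m: "(\<lambda>x. \<Prod>j\<in>J. f j (x j)) \<in> borel_measurable (Pi\<^sub>M J (\<lambda>_. R))"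
  proof (rule borel_measurable_prod_ennreal)
    fix j assume j: "j \<in> J"
    show "(\<lambda>x. f j (x j)) \<in> borel_measurable (Pi\<^sub>M J (\<lambda>_. R))"
      by (rule measurable_compose[where N = R]) (use j f in \<open>auto intro: measurable_component_singleton\<close>)
  qed
  have "(\<Prod>j\<in>J. \<integral>\<^sup>+q. f j q \<partial>R) = (\<integral>\<^sup>+x. (\<Prod>j\<in>J. f j (x j)) \<partial>Pi\<^sub>M J (\<lambda>_. R))"
    by (rule product_nn_integral_prod[symmetric]) (use J f in auto)
  also have "\<dots> = (\<integral>\<^sup>+x. (\<Prod>j\<in>J. f j (x j)) \<partial>distr (Pi\<^sub>M {1..} (\<lambda>_. R)) (Pi\<^sub>M J (\<lambda>_. R)) (\<lambda>p. restrict p J))"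
    by (simp only: distr_PiM_restrict_finite[OF J])
  also have "\<dots> = (\<integral>\<^sup>+p. (\<Prod>j\<in>J. f j (restrict p J j)) \<partial>path)"
    unfolding path_def
    by (rule nn_integral_distr) (use m J in \<open>auto intro: measurable_restrict_subset\<close>)
  finally show ?thesis by (simp cong: prod.cong)
qed

abbreviation ests :: "(nat \<Rightarrow> (nat \<Rightarrow> real) \<times> real) \<Rightarrow> nat \<Rightarrow> nat \<Rightarrow> real" where
  "ests \<equiv> estimate_path K"

lemma measurable_ests[measurable]: "ests \<in> path \<rightarrow>\<^sub>M est_space K"
  unfolding estimate_path_def
  by (rule measurable_restrict) (rule measurable_compose[OF measurable_path_coord measurable_est], simp only: atLeast_iff)

text \<open>Extends the symmetry from the estimates of round t to those of all rounds. The positive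
  and the negative part of the error define two finite measures on sequences of estimates. On
  cylinders they factor over the rounds: round t contributes equal factors by
  \<open>innov_symmetric\<close>, the other rounds contribute identical ones.\<close>

lemma innov_path_symmetric:
  assumes w: "\<And>i. i \<in> {1..K} \<Longrightarrow> (\<Sum>j=1..K. (S i j + v) * w j) = v"
    and t: "1 \<le> t" and G: "G \<in> sets (est_space K)"
  shows "(\<integral>\<^sup>+p. ennreal (innov w (p t)) * indicator G (ests p) \<partial>path) =
    (\<integral>\<^sup>+p. ennreal (- innov w (p t)) * indicator G (ests p) \<partial>path)"
proof -
  interpret R: prob_space R by (rule prob_space_R)
  have [measurable]: "(\<lambda>p. innov w (p t)) \<in> borel_measurable path"
    by (rule measurable_compose[OF measurable_path_coord[OF t]]) measurable
  define m where "m c = distr (density path (\<lambda>p. ennreal (c * innov w (p t)))) (est_space K) ests" for c :: real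
  have em: "emeasure (m c) A = (\<integral>\<^sup>+p. ennreal (c * innov w (p t)) * indicator A (ests p) \<partial>path)"
    if A[measurable]: "A \<in> sets (est_space K)" for A c
  proof -
    have [measurable]: "ests -` A \<inter> space path \<in> sets path" by measurable
    have "emeasure (m c) A = emeasure (density path (\<lambda>p. ennreal (c * innov w (p t)))) (ests -` A \<inter> space path)"
      unfolding m_def using emeasure_distr[OF _ A, of ests "density path (\<lambda>p. ennreal (c * innov w (p t)))"] measurable_ests
      by (simp only: space_density measurable_density_eq1)
    also have "\<dots> = (\<integral>\<^sup>+p. ennreal (c * innov w (p t)) * indicator (ests -` A \<inter> space path) p \<partial>path)"
      by (rule emeasure_density) measurable
    also have "\<dots> = (\<integral>\<^sup>+p. ennreal (c * innov w (p t)) * indicator A (ests p) \<partial>path)"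
      by (intro nn_integral_cong) (auto simp: indicator_def)
    finally show ?thesis .
  qed
  have "m 1 = m (-1)"
  proof (rule measure_eqI_PiM_infinite)
    show "sets (m 1) = sets (est_space K)" "sets (m (-1)) = sets (est_space K)"
      by (simp_all add: m_def)
    show "finite_measure (m 1)"
    proof
      have "emeasure (m 1) (space (m 1)) = (\<integral>\<^sup>+p. ennreal (1 * innov w (p t)) * indicator (space (est_space K)) (ests p) \<partial>path)"
        by (subst em[symmetric]) (auto simp: m_def)
      also have "\<dots> \<le> (\<integral>\<^sup>+p. ennreal (innov w (p t)) \<partial>path)"
        by (intro nn_integral_mono) (auto simp: indicator_def)
      also have "\<dots> = (\<integral>\<^sup>+q. ennreal (innov w q) \<partial>R)"
        by (rule nn_integral_path_coord[OF t]) measurable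
      also have "\<dots> \<le> (\<integral>\<^sup>+q. ennreal (norm (innov w q)) \<partial>R)"
        by (intro nn_integral_mono ennreal_leI) auto
      also have "\<dots> < \<infinity>" using integrable_innov[OF w] by (simp add: integrable_iff_bounded)
      finally show "emeasure (m 1) (space (m 1)) \<noteq> \<infinity>" by simp
    qed
    fix A :: "nat \<Rightarrow> (nat \<Rightarrow> real) set" and J
    assume J: "finite J" "J \<subseteq> {1..}" and A: "\<And>i. i \<in> J \<Longrightarrow> A i \<in> sets (rvec K)"
    let ?E = "prod_emb {1..} (\<lambda>_. rvec K) J (Pi\<^sub>E J A)"
    have E: "?E \<in> sets (est_space K)" using J A by (intro sets_PiM_I) auto
    \<comment> \<open>Padding with the whole space lets round t take part in the product even if the
      cylinder does not constrain it.\<close>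
    define g where "g j = (if j \<in> J then A j else space (rvec K))" for j
    have g[measurable]: "g j \<in> sets (rvec K)" for j using A by (auto simp: g_def)
    have ind: "indicator ?E (ests p) = (\<Prod>j\<in>insert t J. indicator (g j) (est (p j)) :: ennreal)"
      if p: "p \<in> space path" for p
    proof -
      have e: "est (p j) \<in> space (rvec K)" if "1 \<le> j" for j
        using measurable_space[OF measurable_est measurable_space[OF measurable_path_coord[OF that] p]] .
      have "ests p \<in> ?E \<longleftrightarrow> (\<forall>j\<in>J. est (p j) \<in> A j)"
        using J e by (auto simp: prod_emb_def estimate_path_def space_PiM[of "{1..}"] PiE_iff subset_eq)
      also have "\<dots> \<longleftrightarrow> (\<forall>j\<in>insert t J. est (p j) \<in> g j)" using e[OF t] by (auto simp: g_def)
      finally have iff: "ests p \<in> ?E \<longleftrightarrow> (\<forall>j\<in>insert t J. est (p j) \<in> g j)" .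
      show ?thesis
      proof (cases "\<forall>j\<in>insert t J. est (p j) \<in> g j")
        case True
        then have "(\<Prod>j\<in>insert t J. indicator (g j) (est (p j)) :: ennreal) = 1"
          by (intro prod.neutral) auto
        then show ?thesis using True iff by (simp only: indicator_simps)
      next
        case False
        then obtain j where "j \<in> insert t J" "est (p j) \<notin> g j" by blast
        then have "(\<Prod>j\<in>insert t J. indicator (g j) (est (p j)) :: ennreal) = 0"
          using J(1) by (intro prod_zero bexI[of _ j]) auto
        then show ?thesis using False iff by (simp only: indicator_simps not_False_eq_True)
      qed
    qed
    have val: "emeasure (m c) ?E = (\<integral>\<^sup>+q. ennreal (c * innov w q) * indicator (g t) (est q) \<partial>R)
        * (\<Prod>j\<in>J - {t}. \<integral>\<^sup>+q. indicator (g j) (est q) \<partial>R)" for c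
    proof -
      have J': "insert t J = insert t (J - {t})" by auto
      have "emeasure (m c) ?E = (\<integral>\<^sup>+p. (\<Prod>j\<in>insert t J. (if j = t then ennreal (c * innov w (p j)) else 1) * indicator (g j) (est (p j))) \<partial>path)"
        unfolding em[OF E]
      proof (rule nn_integral_cong)
        fix p assume p: "p \<in> space path"
        have "(\<Prod>j\<in>insert t J. if j = t then ennreal (c * innov w (p j)) else 1) = ennreal (c * innov w (p t))"
          using J(1) by (subst prod.delta) auto
        then show "ennreal (c * innov w (p t)) * indicator ?E (ests p) =
          (\<Prod>j\<in>insert t J. (if j = t then ennreal (c * innov w (p j)) else 1) * indicator (g j) (est (p j)))"
          by (simp only: prod.distrib ind[OF p])
      qed
      also have "\<dots> = (\<Prod>j\<in>insert t J. \<integral>\<^sup>+q. (if j = t then ennreal (c * innov w q) else 1) * indicator (g j) (est q) \<partial>R)"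
        using J t by (intro nn_integral_path_prod) auto
      also have "\<dots> = (\<integral>\<^sup>+q. ennreal (c * innov w q) * indicator (g t) (est q) \<partial>R)
        * (\<Prod>j\<in>J - {t}. \<integral>\<^sup>+q. indicator (g j) (est q) \<partial>R)"
        unfolding J' using J(1) by (subst prod.insert) (auto intro!: arg_cong2[where f = "(*)"] prod.cong)
      finally show ?thesis .
    qed
    show "emeasure (m 1) ?E = emeasure (m (-1)) ?E"
      unfolding val using innov_symmetric[OF w g] by simp
  qed
  then show ?thesis using em[OF G, of 1] em[OF G, of "-1"] by simp
qed

lemma innov_path_square_le:
  assumes w: "\<And>i. i \<in> {1..K} \<Longrightarrow> (\<Sum>j=1..K. (S i j + v) * w j) = v" and t: "1 \<le> t"
  shows "(\<integral>\<^sup>+p. ennreal ((innov w (p t))\<^sup>2) \<partial>path) \<le> ennreal v"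
proof -
  have "(\<integral>\<^sup>+p. ennreal ((innov w (p t))\<^sup>2) \<partial>path) = (\<integral>\<^sup>+q. ennreal ((innov w q)\<^sup>2) \<partial>R)"
    by (rule nn_integral_path_coord[OF t]) measurable
  also have "\<dots> = ennreal (\<integral>q. (innov w q)\<^sup>2 \<partial>R)"
    by (rule nn_integral_eq_integral) (auto intro: integrable_innov_square[OF w])
  also have "\<dots> \<le> ennreal v" by (intro ennreal_leI innov_square_le[OF w])
  finally show ?thesis .
qed

lemma indep_path: "prob_space.indep_vars path (\<lambda>_. R) (\<lambda>\<tau> p. p \<tau>) {1..}"
proof -
  interpret prob_space path by (rule prob_space_path)
  have "distr path (Pi\<^sub>M {1..} (\<lambda>_. R)) (\<lambda>p. \<lambda>\<tau>\<in>{1..}. p \<tau>) = path"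
  proof -
    have "distr path (Pi\<^sub>M {1..} (\<lambda>_. R)) (\<lambda>p. \<lambda>\<tau>\<in>{1..}. p \<tau>) = distr path path (\<lambda>p. p)"
      by (rule distr_cong) (auto simp: path_def space_PiM PiE_def extensional_restrict)
    then show ?thesis by (simp add: distr_id)
  qed
  also have "\<dots> = (\<Pi>\<^sub>M \<tau>\<in>{1..}. distr path R (\<lambda>p. p \<tau>))"
    by (subst path_def) (rule PiM_cong, auto simp: distr_path_coord)
  finally show ?thesis
    by (subst indep_vars_iff_distr_eq_PiM') (auto intro: measurable_path_coord)
qed

lemma path_linear:
  shows "AE p in path. rconv (\<lambda>n. (\<Sum>\<tau>=1..n. (\<Sum>i=1..K. a i * est (p \<tau>) i)\<^sup>2) / real n) (qform K S a + v * (\<Sum>i=1..K. a i)\<^sup>2)"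
    and "AE p in path. (\<lambda>n. (\<Sum>i=1..K. a i * est (p (Suc n)) i) / real n powr (1/8)) \<longlonglongrightarrow> 0"
proof -
  interpret prob_space path by (rule prob_space_path)
  let ?s = "qform K S a + v * (\<Sum>i=1..K. a i)\<^sup>2"
  \<comment> \<open>Paths have coordinates from 1 on only, so index 0 is filled with the measurable
    constant 0.\<close>
  define V where "V \<tau> p = (if 1 \<le> \<tau> then \<Sum>i=1..K. a i * est (p \<tau>) i else 0)" for \<tau> and p :: "nat \<Rightarrow> (nat \<Rightarrow> real) \<times> real"
  have s: "0 \<le> ?s" using S_nonneg[of a] v by (intro add_nonneg_nonneg) auto
  have V1: "V \<tau> = (\<lambda>p. \<Sum>i=1..K. a i * est (p \<tau>) i)" if "1 \<le> \<tau>" for \<tau> using that by (simp add: V_def fun_eq_iff)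
  have lin[measurable]: "(\<lambda>q. \<Sum>i=1..K. a i * est q i) \<in> borel_measurable R" by measurable
  have V[measurable]: "V \<tau> \<in> borel_measurable path" for \<tau>
  proof (cases "1 \<le> \<tau>")
    case True
    then show ?thesis unfolding V1[OF True] by (intro measurable_compose[OF measurable_path_coord lin])
  next
    case False
    then have "V \<tau> = (\<lambda>_. 0)" by (simp add: V_def fun_eq_iff)
    then show ?thesis by simp
  qed
  have eR: "(\<Sum>i=1..K. a i * est q i) = (\<Sum>i=1..K. a i * fst q i) + (\<Sum>i=1..K. a i) * snd q" for q
    by (simp add: estimates_def sum.distrib distrib_left sum_distrib_right)
  have law: "distr path borel (V \<tau>) = normal_law 0 (sqrt ?s)" if "1 \<le> \<tau>" for \<tau>
  proof -
    have "distr path borel (V \<tau>) = distr (distr path R (\<lambda>p. p \<tau>)) borel (\<lambda>q. \<Sum>i=1..K. a i * est q i)"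
      using that by (subst distr_distr) (auto simp: V1 comp_def)
    also have "\<dots> = normal_law 0 (sqrt ?s)"
      unfolding distr_path_coord[OF that] eR R_linear by (simp add: mult.commute)
    finally show ?thesis .
  qed
  have "indep_vars (\<lambda>_. borel) (\<lambda>\<tau> p. \<Sum>i=1..K. a i * est (p \<tau>) i) {1..}"
    by (rule indep_vars_compose2[OF indep_path]) (rule lin)
  then have ind: "indep_vars (\<lambda>_. borel) V {1..}"
    by (subst indep_vars_cong[OF refl, of _ _ "\<lambda>\<tau> p. \<Sum>i=1..K. a i * est (p \<tau>) i"]) (auto simp: V1)
  have s2: "(sqrt ?s)\<^sup>2 = ?s" using s by simp
  have SLLN: "AE p in path. rconv (\<lambda>n. (\<Sum>\<tau>=1..n. (V \<tau> p)\<^sup>2) / real n) ((sqrt ?s)\<^sup>2)"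
    "AE p in path. (\<lambda>n. V (Suc n) p / real n powr (1/8)) \<longlonglongrightarrow> 0"
    by (rule iid_normal_squares[OF real_sqrt_ge_zero[OF s] V ind law]; assumption)+
  show "AE p in path. rconv (\<lambda>n. (\<Sum>\<tau>=1..n. (\<Sum>i=1..K. a i * est (p \<tau>) i)\<^sup>2) / real n) ?s"
    using SLLN(1) unfolding s2
  proof eventually_elim
    case (elim p)
    have "(\<Sum>\<tau>=1..n. (V \<tau> p)\<^sup>2) = (\<Sum>\<tau>=1..n. (\<Sum>i=1..K. a i * est (p \<tau>) i)\<^sup>2)" for n
      by (intro sum.cong refl) (simp add: V_def)
    then show ?case using elim by (simp only:)
  qed
  show "AE p in path. (\<lambda>n. (\<Sum>i=1..K. a i * est (p (Suc n)) i) / real n powr (1/8)) \<longlonglongrightarrow> 0"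
    using SLLN(2) by eventually_elim (simp add: V_def)
qed

lemma path_growth:
  assumes k: "k \<in> {1..K}"
  shows "AE p in path. (\<lambda>n. est (p (Suc n)) k / real n powr (1/8)) \<longlonglongrightarrow> 0"
proof -
  have "(\<Sum>i=1..K. (if i = k then 1 else 0) * est q i) = est q k" for q
  proof -
    have "(\<Sum>i=1..K. (if i = k then 1 else 0) * est q i) = (\<Sum>i=1..K. if i = k then est q i else 0)"
      by (intro sum.cong refl) simp
    then show ?thesis using k by simp
  qed
  then show ?thesis using path_linear(2)[of "\<lambda>i. if i = k then 1 else 0"] by (simp only:)
qed

text \<open>Polarization: the mixed moments come from the squares of the sum of two estimates and of
  each of them, to which the result on linear functionals applies.\<close>

lemma path_covariance:
  assumes ij: "i \<in> {1..K}" "j \<in> {1..K}"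
  shows "AE p in path. rconv (\<lambda>n. (\<Sum>\<tau>=1..n. est (p \<tau>) i * est (p \<tau>) j) / real n) (S i j + v)"
proof -
  define e where "e k l = (if l = k then 1 else 0 :: real)" for k l :: nat
  have e1: "(\<Sum>l=1..K. e k l * f l) = f k" if "k \<in> {1..K}" for k f
  proof -
    have "(\<Sum>l=1..K. e k l * f l) = (\<Sum>l=1..K. if l = k then f l else 0)"
      by (intro sum.cong refl) (simp add: e_def)
    then show ?thesis using that by simp
  qed
  have e2: "(\<Sum>l=1..K. e k l) = 1" if "k \<in> {1..K}" for k using e1[OF that, of "\<lambda>_. 1"] by simp
  have b: "(\<Sum>a=1..K. \<Sum>b=1..K. e k a * S a b * e l b) = S k l" if "k \<in> {1..K}" "l \<in> {1..K}" for k l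
  proof -
    have "(\<Sum>a=1..K. \<Sum>b=1..K. e k a * S a b * e l b) = (\<Sum>a=1..K. e k a * (\<Sum>b=1..K. e l b * S a b))"
      by (simp only: sum_distrib_left mult_ac)
    then show ?thesis using that by (simp only: e1)
  qed
  have q: "qform K S (\<lambda>l. e i l + e j l) = S i i + S j j + 2 * S i j"
  proof -
    have "qform K S (\<lambda>l. e i l + e j l) = (\<Sum>a=1..K. \<Sum>b=1..K. e i a * S a b * e i b + e i a * S a b * e j b
        + e j a * S a b * e i b + e j a * S a b * e j b)"
      by (intro sum.cong refl) (simp only: distrib_left distrib_right add_ac)
    also have "\<dots> = S i i + S i j + S j i + S j j" by (simp only: sum.distrib b ij)
    finally show ?thesis using S_sym[OF ij] by simp
  qed
  \<comment> \<open>The coefficients of the functional add up to 2, whence the summand 4 v.\<close>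
  have "AE p in path. rconv (\<lambda>n. (\<Sum>\<tau>=1..n. (est (p \<tau>) i + est (p \<tau>) j)\<^sup>2) / real n) (S i i + S j j + 2 * S i j + v * 4)"
    using path_linear(1)[of "\<lambda>l. e i l + e j l"] unfolding q by (simp only: distrib_right sum.distrib e1 e2 ij) simp
  moreover have "AE p in path. rconv (\<lambda>n. (\<Sum>\<tau>=1..n. (est (p \<tau>) k)\<^sup>2) / real n) (S k k + v)" if "k \<in> {1..K}" for k
    using path_linear(1)[of "e k"] by (simp only: b e1 e2 that) simp
  note this[OF ij(1)] this[OF ij(2)]
  ultimately show ?thesis
  proof eventually_elim
    case (elim p)
    have "rconv (\<lambda>n. ((\<Sum>\<tau>=1..n. (est (p \<tau>) i + est (p \<tau>) j)\<^sup>2) / real n - (\<Sum>\<tau>=1..n. (est (p \<tau>) i)\<^sup>2) / real n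
        - (\<Sum>\<tau>=1..n. (est (p \<tau>) j)\<^sup>2) / real n) * (1 / 2))
       (((S i i + S j j + 2 * S i j + v * 4) - (S i i + v) - (S j j + v)) * (1 / 2))"
      by (intro rconv_mult rconv_diff rconv_const elim)
    moreover have "((\<Sum>\<tau>=1..n. (est (p \<tau>) i + est (p \<tau>) j)\<^sup>2) / real n - (\<Sum>\<tau>=1..n. (est (p \<tau>) i)\<^sup>2) / real n
        - (\<Sum>\<tau>=1..n. (est (p \<tau>) j)\<^sup>2) / real n) * (1 / 2) = (\<Sum>\<tau>=1..n. est (p \<tau>) i * est (p \<tau>) j) / real n" for n
    proof -
      have "(\<Sum>\<tau>=1..n. (est (p \<tau>) i + est (p \<tau>) j)\<^sup>2) = (\<Sum>\<tau>=1..n. (est (p \<tau>) i)\<^sup>2) + (\<Sum>\<tau>=1..n. (est (p \<tau>) j)\<^sup>2)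
          + 2 * (\<Sum>\<tau>=1..n. est (p \<tau>) i * est (p \<tau>) j)"
        unfolding power2_sum sum.distrib sum_distrib_left by (simp only: mult.assoc)
      then show ?thesis by (simp add: add_divide_distrib)
    qed
    ultimately show ?case by (simp add: algebra_simps)
  qed
qed

end

section \<open>Mixtures of iid rounds\<close>

text \<open>Integrating the conditional probability removes the conditioning; conditional
  expectations given \<theta> do not occur after this.\<close>

lemma cond_iid_emeasure:
  assumes M: "prob_space M" and ci: "cond_iid M N \<theta> S I X Q"
    and J: "finite J" "J \<subseteq> I" and A: "\<And>j. j \<in> J \<Longrightarrow> A j \<in> sets S"
  shows "emeasure M {\<omega> \<in> space M. \<forall>j\<in>J. X j \<omega> \<in> A j} = (\<integral>\<^sup>+\<omega>. (\<Prod>j\<in>J. emeasure (Q (\<theta> \<omega>)) (A j)) \<partial>M)"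
proof -
  interpret prob_space M by fact
  have th[measurable]: "\<theta> \<in> M \<rightarrow>\<^sub>M N" and X: "\<And>j. j \<in> I \<Longrightarrow> X j \<in> M \<rightarrow>\<^sub>M S"
    and Q[measurable]: "Q \<in> N \<rightarrow>\<^sub>M prob_algebra S"
    and ae: "AE \<omega> in M. real_cond_exp M (vimage_algebra (space M) \<theta> N)
             (indicator {\<omega> \<in> space M. \<forall>j\<in>J. X j \<omega> \<in> A j}) \<omega> = (\<Prod>j\<in>J. measure (Q (\<theta> \<omega>)) (A j))"
    using ci J A unfolding cond_iid_def by blast+
  let ?E = "{\<omega> \<in> space M. \<forall>j\<in>J. X j \<omega> \<in> A j}"
  have E[measurable]: "?E \<in> sets M"
  proof (rule sets.sets_Collect_finite_All[OF _ J(1)])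
    fix j assume j: "j \<in> J"
    then have "X j -` A j \<inter> space M \<in> sets M" using J(2) by (intro measurable_sets[OF X A]) auto
    then show "{\<omega> \<in> space M. X j \<omega> \<in> A j} \<in> sets M" by (simp add: vimage_def Int_def conj_commute)
  qed
  have ps: "prob_space (Q (\<theta> \<omega>))" if "\<omega> \<in> space M" for \<omega>
    using measurable_space[OF Q measurable_space[OF th that]] by (simp add: space_prob_algebra)
  have m[measurable]: "(\<lambda>\<omega>. measure (Q (\<theta> \<omega>)) (A j)) \<in> borel_measurable M" if "j \<in> J" for j
    using A[OF that] by measurable
  have sub: "subalgebra M (vimage_algebra (space M) \<theta> N)"
  proof -
    have "\<theta> \<in> space M \<rightarrow> space N" using measurable_space[OF th] by auto
    then show ?thesis
      unfolding subalgebra_def by (auto simp: sets_vimage_algebra2 measurable_sets[OF th])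
  qed
  interpret finite_measure_subalgebra M "vimage_algebra (space M) \<theta> N"
    by unfold_locales (rule sub)
  have "prob ?E = (\<integral>\<omega>. indicator ?E \<omega> \<partial>M)" by simp
  also have "\<dots> = (\<integral>\<omega>. real_cond_exp M (vimage_algebra (space M) \<theta> N) (indicator ?E) \<omega> \<partial>M)"
    by (rule real_cond_exp_int(2)[symmetric]) (simp add: integrable_indicator_iff less_top[symmetric])
  also have "\<dots> = (\<integral>\<omega>. (\<Prod>j\<in>J. measure (Q (\<theta> \<omega>)) (A j)) \<partial>M)"
    by (rule integral_cong_AE) (use ae in auto)
  finally have p: "prob ?E = \<dots>" .
  have int: "integrable M (\<lambda>\<omega>. \<Prod>j\<in>J. measure (Q (\<theta> \<omega>)) (A j))"
    by (rule integrable_const_bound[where B = 1])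
       (auto intro!: AE_I2 prod_le_1 simp: abs_prod prob_space.prob_le_1 ps)
  have "emeasure M ?E = ennreal (prob ?E)" by (simp add: emeasure_eq_measure)
  also have "\<dots> = (\<integral>\<^sup>+\<omega>. ennreal (\<Prod>j\<in>J. measure (Q (\<theta> \<omega>)) (A j)) \<partial>M)"
    unfolding p by (rule nn_integral_eq_integral[symmetric, OF int]) (auto intro!: AE_I2 prod_nonneg)
  also have "\<dots> = (\<integral>\<^sup>+\<omega>. (\<Prod>j\<in>J. emeasure (Q (\<theta> \<omega>)) (A j)) \<partial>M)"
    by (intro nn_integral_cong)
       (simp add: prod_ennreal[symmetric] finite_measure.emeasure_eq_measure prob_space.finite_measure[OF ps])
  finally show ?thesis .
qed

text \<open>Independence is given between residuals and outcomes, not between \<theta> and the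
  outcomes. Accordingly the mixture formula concerns the law of the sequence of pairs and makes no
  claim about its conditional law given \<theta>.\<close>

locale mixture =
  fixes M :: "'a measure" and N :: "'c measure" and \<theta> :: "'a \<Rightarrow> 'c" and S :: "'b measure"
    and D :: "nat \<Rightarrow> 'a \<Rightarrow> 'b" and Q :: "'c \<Rightarrow> 'b measure"
    and Z :: "nat \<Rightarrow> 'a \<Rightarrow> real" and \<zeta> :: "real measure"
  assumes M: "prob_space M" and ci: "cond_iid M N \<theta> S {1..} D Q"
    and Z_ind: "prob_space.indep_vars M (\<lambda>_. borel) Z {1..}"
    and Z_law: "\<And>t. 1 \<le> t \<Longrightarrow> distr M borel (Z t) = \<zeta>"
    and DZ: "prob_space.indep_set M
         (sets (vimage_algebra (space M) (\<lambda>\<omega>. \<lambda>t\<in>{1..}. D t \<omega>) (Pi\<^sub>M {1..} (\<lambda>_. S))))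
         (sets (vimage_algebra (space M) (\<lambda>\<omega>. \<lambda>t\<in>{1..}. Z t \<omega>) (Pi\<^sub>M {1..} (\<lambda>_. borel))))"
begin

sublocale prob_space M by (rule M)

abbreviation pairs :: "(nat \<Rightarrow> 'b \<times> real) measure" where
  "pairs \<equiv> Pi\<^sub>M {1..} (\<lambda>_. S \<Otimes>\<^sub>M borel)"

lemma theta_meas[measurable]: "\<theta> \<in> M \<rightarrow>\<^sub>M N"
  and D_meas: "\<And>j. 1 \<le> j \<Longrightarrow> D j \<in> M \<rightarrow>\<^sub>M S"
  and Q_meas[measurable]: "Q \<in> N \<rightarrow>\<^sub>M prob_algebra S"
  using ci unfolding cond_iid_def by auto

lemma Z_meas: "1 \<le> j \<Longrightarrow> Z j \<in> borel_measurable M"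
  using Z_ind unfolding indep_vars_def by auto

lemma zeta: "prob_space \<zeta>" "sets \<zeta> = sets borel"
  using prob_space_distr[OF Z_meas[of 1]] unfolding Z_law[OF order_refl, symmetric] by auto

lemma Q_prob: "c \<in> space N \<Longrightarrow> prob_space (Q c)" and Q_sets: "c \<in> space N \<Longrightarrow> sets (Q c) = sets S"
  using measurable_space[OF Q_meas] by (auto simp: space_prob_algebra)

lemma zeta_const: "(\<lambda>_. \<zeta>) \<in> N \<rightarrow>\<^sub>M prob_algebra borel"
  by (rule measurable_const) (simp add: space_prob_algebra zeta)

lemma joint_law:
  assumes J: "finite J" "J \<noteq> {}" "J \<subseteq> {1..}"
  shows "distr M (Pi\<^sub>M J (\<lambda>_. S)) (\<lambda>\<omega>. \<lambda>t\<in>J. D t \<omega>) \<Otimes>\<^sub>M Pi\<^sub>M J (\<lambda>_. \<zeta>) =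
    distr M (Pi\<^sub>M J (\<lambda>_. S) \<Otimes>\<^sub>M Pi\<^sub>M J (\<lambda>_. borel)) (\<lambda>\<omega>. (\<lambda>t\<in>J. D t \<omega>, \<lambda>t\<in>J. Z t \<omega>))"
proof -
  let ?D = "\<lambda>\<omega>. \<lambda>t\<in>J. D t \<omega>" and ?Z = "\<lambda>\<omega>. \<lambda>t\<in>J. Z t \<omega>"
    and ?DZ = "\<lambda>\<omega>. (\<lambda>t\<in>J. D t \<omega>, \<lambda>t\<in>J. Z t \<omega>)"
    and ?S = "Pi\<^sub>M J (\<lambda>_. S)" and ?B = "Pi\<^sub>M J (\<lambda>_. borel :: real measure)"
  have mD: "?D \<in> M \<rightarrow>\<^sub>M ?S"
    by (rule measurable_restrict) (use J D_meas in auto)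
  have mZ: "?Z \<in> M \<rightarrow>\<^sub>M ?B"
    by (rule measurable_restrict) (use J Z_meas in auto)
  have "indep_vars (\<lambda>_. borel) Z J" by (rule indep_vars_subset[OF Z_ind J(3)])
  then have LZ: "distr M ?B ?Z = Pi\<^sub>M J (\<lambda>_. \<zeta>)"
    using J Z_meas Z_law by (subst (asm) indep_vars_iff_distr_eq_PiM') (auto cong: PiM_cong simp: subset_eq)
  \<comment> \<open>Events about finitely many rounds belong to the sigma-algebra generated by the
    whole sequence, where independence is assumed.\<close>
  have sub: "(\<lambda>\<omega>. \<lambda>t\<in>J. X t \<omega>) -` A \<inter> space M \<in>
      sets (vimage_algebra (space M) (\<lambda>\<omega>. \<lambda>t\<in>{1..}. X t \<omega>) (Pi\<^sub>M {1..} (\<lambda>_. T)))"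
    if X: "\<And>j. 1 \<le> j \<Longrightarrow> X j \<in> M \<rightarrow>\<^sub>M T" and A: "A \<in> sets (Pi\<^sub>M J (\<lambda>_. T))"
    for X :: "nat \<Rightarrow> 'a \<Rightarrow> 'd" and T and A
  proof -
    let ?V = "vimage_algebra (space M) (\<lambda>\<omega>. \<lambda>t\<in>{1..}. X t \<omega>) (Pi\<^sub>M {1..} (\<lambda>_. T))"
    have "(\<lambda>\<omega>. \<lambda>t\<in>{1..}. X t \<omega>) \<in> M \<rightarrow>\<^sub>M Pi\<^sub>M {1..} (\<lambda>_. T)"
      by (rule measurable_restrict) (use X in auto)
    then have "(\<lambda>\<omega>. \<lambda>t\<in>{1..}. X t \<omega>) \<in> ?V \<rightarrow>\<^sub>M Pi\<^sub>M {1..} (\<lambda>_. T)"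
      by (intro measurable_vimage_algebra1) (auto dest: measurable_space)
    from measurable_compose[OF this measurable_restrict_subset[OF J(3)]]
    have "(\<lambda>\<omega>. restrict (\<lambda>t\<in>{1..}. X t \<omega>) J) \<in> ?V \<rightarrow>\<^sub>M Pi\<^sub>M J (\<lambda>_. T)" .
    moreover have "restrict (\<lambda>t\<in>{1..}. X t \<omega>) J = (\<lambda>t\<in>J. X t \<omega>)" for \<omega>
      using J(3) by (auto simp: restrict_def fun_eq_iff)
    ultimately have "(\<lambda>\<omega>. \<lambda>t\<in>J. X t \<omega>) \<in> ?V \<rightarrow>\<^sub>M Pi\<^sub>M J (\<lambda>_. T)" by simp
    from measurable_sets[OF this A] show ?thesis by (simp add: space_vimage_algebra)
  qed
  show ?thesis
    unfolding LZ[symmetric]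
  proof (rule pair_measure_eqI)
    show "sigma_finite_measure (distr M ?S ?D)"
      "sigma_finite_measure (distr M ?B ?Z)"
      by (intro prob_space_imp_sigma_finite prob_space_distr mD mZ)+
    fix A B assume "A \<in> sets (distr M ?S ?D)"
      "B \<in> sets (distr M ?B ?Z)"
    then have AB: "A \<in> sets ?S" "B \<in> sets ?B" by simp_all
    let ?a = "?D -` A \<inter> space M" and ?b = "?Z -` B \<inter> space M"
    have ab: "prob (?a \<inter> ?b) = prob ?a * prob ?b"
      by (rule indep_setD[OF DZ sub[OF D_meas AB(1)] sub[OF Z_meas AB(2)]])
    have "emeasure (distr M (?S \<Otimes>\<^sub>M ?B) ?DZ) (A \<times> B)
       = emeasure M (?DZ -` (A \<times> B) \<inter> space M)"
      by (rule emeasure_distr) (use mD mZ AB in auto)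
    also have "?DZ -` (A \<times> B) \<inter> space M = ?a \<inter> ?b" by auto
    finally have eq: "emeasure (distr M (?S \<Otimes>\<^sub>M ?B) ?DZ) (A \<times> B)
       = emeasure M (?a \<inter> ?b)" .
    show "emeasure (distr M ?S ?D) A *
        emeasure (distr M ?B ?Z) B =
      emeasure (distr M (?S \<Otimes>\<^sub>M ?B) ?DZ) (A \<times> B)"
      unfolding eq emeasure_distr[OF mD AB(1)] emeasure_distr[OF mZ AB(2)] emeasure_eq_measure ab
      by (rule ennreal_mult'[symmetric]) simp
  qed simp
qed

text \<open>The sets \<open>E t\<close> couple residual and outcome and need not be rectangles.
  Fixing the outcomes replaces them by their sections, to which the product formula for the
  residuals applies; after an exchange of integrals the integral over the outcomes factors as
  well.\<close>

lemma emeasure_pairs: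
  assumes J: "finite J" "J \<subseteq> {1..}" and E: "\<And>t. t \<in> J \<Longrightarrow> E t \<in> sets (S \<Otimes>\<^sub>M borel)"
  shows "emeasure M {\<omega> \<in> space M. \<forall>t\<in>J. (D t \<omega>, Z t \<omega>) \<in> E t} =
    (\<integral>\<^sup>+\<omega>. (\<Prod>t\<in>J. emeasure (Q (\<theta> \<omega>) \<Otimes>\<^sub>M \<zeta>) (E t)) \<partial>M)"
proof (cases "J = {}")
  case True then show ?thesis by (simp add: emeasure_space_1)
next
  case False
  interpret zeta: prob_space \<zeta> by (rule zeta)
  note [measurable_cong] = zeta(2)
  let ?q = "\<lambda>\<omega>. \<Prod>t\<in>J. emeasure (Q (\<theta> \<omega>) \<Otimes>\<^sub>M \<zeta>) (E t)"
  let ?D = "\<lambda>\<omega>. \<lambda>t\<in>J. D t \<omega>" and ?Z = "\<lambda>\<omega>. \<lambda>t\<in>J. Z t \<omega>"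
    and ?DZ = "\<lambda>\<omega>. (\<lambda>t\<in>J. D t \<omega>, \<lambda>t\<in>J. Z t \<omega>)"
    and ?S = "Pi\<^sub>M J (\<lambda>_. S)" and ?B = "Pi\<^sub>M J (\<lambda>_. borel :: real measure)"
  let ?LD = "distr M ?S ?D" and ?LZ = "Pi\<^sub>M J (\<lambda>_. \<zeta>)"
  have mD: "?D \<in> M \<rightarrow>\<^sub>M ?S"
    by (rule measurable_restrict) (use J D_meas in auto)
  have mZ: "?Z \<in> M \<rightarrow>\<^sub>M ?B"
    by (rule measurable_restrict) (use J Z_meas in auto)
  interpret LD: prob_space ?LD by (rule prob_space_distr[OF mD])
  interpret LZ: prob_space ?LZ by (intro prob_space_PiM zeta)
  interpret L: pair_prob_space ?LD ?LZ ..
  interpret PJ: product_sigma_finite "\<lambda>_::nat. \<zeta>" ..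
  have setsZ: "sets ?LZ = sets ?B" by (intro sets_PiM_cong refl zeta)
  let ?P = "?S \<Otimes>\<^sub>M ?B"
  define F where "F = {p \<in> space ?P. \<forall>t\<in>J. (fst p t, snd p t) \<in> E t}"
  have F: "F \<in> sets ?P"
    unfolding F_def
  proof (rule sets.sets_Collect_finite_All[OF _ J(1)])
    fix t assume t: "t \<in> J"
    have "(\<lambda>p. (fst p t, snd p t)) \<in> ?P \<rightarrow>\<^sub>M S \<Otimes>\<^sub>M borel"
      using t by measurable
    from measurable_sets[OF this E[OF t]]
    show "{p \<in> space ?P. (fst p t, snd p t) \<in> E t} \<in> sets ?P"
      by (simp add: vimage_def Int_def conj_commute)
  qed
  \<comment> \<open>The conditional mass of a section, as a function of sample point and outcome
    jointly; the exchange of integrals needs its joint measurability.\<close>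
  define h where "h t q = emeasure (Q (\<theta> (fst q))) {x \<in> space S. (x, snd q) \<in> E t}" for t and q :: "'a \<times> real"
  have h[measurable]: "h t \<in> borel_measurable (M \<Otimes>\<^sub>M borel)" if t: "t \<in> J" for t
    unfolding h_def
  proof (rule emeasure_measurable_subprob_algebra2[where N = S])
    have "(\<lambda>r. (snd r, snd (fst r))) \<in> (M \<Otimes>\<^sub>M borel) \<Otimes>\<^sub>M S \<rightarrow>\<^sub>M S \<Otimes>\<^sub>M (borel :: real measure)" by measurable
    from measurable_sets[OF this E[OF t]]
    show "(SIGMA q:space (M \<Otimes>\<^sub>M borel). {x \<in> space S. (x, snd q) \<in> E t}) \<in> sets ((M \<Otimes>\<^sub>M borel) \<Otimes>\<^sub>M S)"
      by (rule back_subst[of "\<lambda>A. A \<in> sets _"]) (auto simp: space_pair_measure)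
    show "(\<lambda>q. Q (\<theta> (fst q))) \<in> M \<Otimes>\<^sub>M (borel :: real measure) \<rightarrow>\<^sub>M subprob_algebra S"
      by (intro measurable_prob_algebraD) measurable
  qed
  have sec: "{x \<in> space S. (x, y) \<in> E t} \<in> sets S" if t: "t \<in> J" for t y
  proof -
    have "(\<lambda>x. (x, y)) \<in> S \<rightarrow>\<^sub>M S \<Otimes>\<^sub>M (borel :: real measure)" by measurable
    from measurable_sets[OF this E[OF t]] show ?thesis by (simp add: vimage_def Int_def conj_commute)
  qed
  have "emeasure M {\<omega> \<in> space M. \<forall>t\<in>J. (D t \<omega>, Z t \<omega>) \<in> E t} =
      emeasure (distr M ?P ?DZ) F"
  proof -
    have "?DZ -` F \<inter> space M = {\<omega> \<in> space M. \<forall>t\<in>J. (D t \<omega>, Z t \<omega>) \<in> E t}"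
      using measurable_space[OF mD] measurable_space[OF mZ] by (auto simp: F_def space_pair_measure)
    then show ?thesis using F mD mZ by (subst emeasure_distr) auto
  qed
  also have "\<dots> = emeasure (?LD \<Otimes>\<^sub>M ?LZ) F"
    unfolding joint_law[OF J(1) False J(2)] ..
  also have "\<dots> = (\<integral>\<^sup>+z. emeasure ?LD ((\<lambda>x. (x, z)) -` F) \<partial>?LZ)"
  proof (rule L.emeasure_pair_measure_alt2)
    have "sets (?LD \<Otimes>\<^sub>M ?LZ) = sets ?P" by (intro sets_pair_measure_cong setsZ) simp
    then show "F \<in> sets (?LD \<Otimes>\<^sub>M ?LZ)" using F by simp
  qed
  also have "\<dots> = (\<integral>\<^sup>+z. \<integral>\<^sup>+\<omega>. (\<Prod>t\<in>J. h t (\<omega>, z t)) \<partial>M \<partial>?LZ)"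
  proof (rule nn_integral_cong)
    fix z assume "z \<in> space ?LZ"
    then have z: "z \<in> space ?B" using sets_eq_imp_space_eq[OF setsZ] by simp
    have "(\<lambda>x. (x, z)) \<in> ?S \<rightarrow>\<^sub>M ?P" using z by measurable
    from measurable_sets[OF this F]
    have Fz: "(\<lambda>x. (x, z)) -` F \<in> sets ?S"
      by (rule back_subst[of "\<lambda>A. A \<in> sets _"]) (auto simp: F_def space_pair_measure)
    have "emeasure ?LD ((\<lambda>x. (x, z)) -` F) = emeasure M (?D -` ((\<lambda>x. (x, z)) -` F) \<inter> space M)"
      by (rule emeasure_distr[OF mD Fz])
    also have "?D -` ((\<lambda>x. (x, z)) -` F) \<inter> space M =
        {\<omega> \<in> space M. \<forall>t\<in>J. D t \<omega> \<in> {x \<in> space S. (x, z t) \<in> E t}}"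
      using z measurable_space[OF mD] measurable_space[OF D_meas] J(2)
      by (auto simp: F_def space_pair_measure)
    also have "emeasure M \<dots> = (\<integral>\<^sup>+\<omega>. (\<Prod>t\<in>J. emeasure (Q (\<theta> \<omega>)) {x \<in> space S. (x, z t) \<in> E t}) \<partial>M)"
      by (rule cond_iid_emeasure[OF M ci J sec])
    finally show "emeasure ?LD ((\<lambda>x. (x, z)) -` F) = (\<integral>\<^sup>+\<omega>. (\<Prod>t\<in>J. h t (\<omega>, z t)) \<partial>M)"
      unfolding h_def fst_conv snd_conv .
  qed
  also have "\<dots> = (\<integral>\<^sup>+\<omega>. \<integral>\<^sup>+z. (\<Prod>t\<in>J. h t (\<omega>, z t)) \<partial>?LZ \<partial>M)"
  proof -
    interpret MZ: pair_sigma_finite M ?LZ ..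
    have "(\<lambda>(\<omega>, z). \<Prod>t\<in>J. h t (\<omega>, z t)) \<in> borel_measurable (M \<Otimes>\<^sub>M ?LZ)"
      unfolding case_prod_beta'
    proof (rule borel_measurable_prod_ennreal)
      fix t assume t: "t \<in> J"
      have "(\<lambda>r. (fst r, snd r t)) \<in> M \<Otimes>\<^sub>M ?LZ \<rightarrow>\<^sub>M M \<Otimes>\<^sub>M borel"
        using t by measurable
      from measurable_compose[OF this h[OF t]]
      show "(\<lambda>x. h t (fst x, snd x t)) \<in> borel_measurable (M \<Otimes>\<^sub>M ?LZ)" .
    qed
    then show ?thesis by (rule MZ.Fubini')
  qed
  also have "\<dots> = (\<integral>\<^sup>+\<omega>. ?q \<omega> \<partial>M)"
  proof (rule nn_integral_cong)
    fix \<omega> assume \<omega>: "\<omega> \<in> space M"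
    then have c: "\<theta> \<omega> \<in> space N" by (rule measurable_space[OF theta_meas])
    interpret Qc: prob_space "Q (\<theta> \<omega>)" by (rule Q_prob[OF c])
    interpret QZ: pair_prob_space "Q (\<theta> \<omega>)" \<zeta> ..
    have ht: "(\<lambda>y. h t (\<omega>, y)) \<in> borel_measurable \<zeta>" if "t \<in> J" for t
      using measurable_compose[OF measurable_Pair1'[OF \<omega>] h[OF that]] by simp
    have "(\<integral>\<^sup>+z. (\<Prod>t\<in>J. h t (\<omega>, z t)) \<partial>?LZ) = (\<Prod>t\<in>J. \<integral>\<^sup>+y. h t (\<omega>, y) \<partial>\<zeta>)"
      by (rule PJ.product_nn_integral_prod) (use J ht in auto)
    also have "\<dots> = ?q \<omega>"
    proof (rule prod.cong[OF refl])
      fix t assume t: "t \<in> J"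
      have s: "sets (Q (\<theta> \<omega>) \<Otimes>\<^sub>M \<zeta>) = sets (S \<Otimes>\<^sub>M borel)"
        by (intro sets_pair_measure_cong Q_sets c zeta)
      have sec_eq: "(\<lambda>x. (x, y)) -` E t = {x \<in> space S. (x, y) \<in> E t}" for y
        using sets.sets_into_space[OF E[OF t]] by (auto simp: space_pair_measure)
      have "emeasure (Q (\<theta> \<omega>) \<Otimes>\<^sub>M \<zeta>) (E t) = (\<integral>\<^sup>+y. emeasure (Q (\<theta> \<omega>)) ((\<lambda>x. (x, y)) -` E t) \<partial>\<zeta>)"
        using E[OF t] s by (intro QZ.emeasure_pair_measure_alt2) simp
      then show "(\<integral>\<^sup>+y. h t (\<omega>, y) \<partial>\<zeta>) = emeasure (Q (\<theta> \<omega>) \<Otimes>\<^sub>M \<zeta>) (E t)"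
        unfolding sec_eq h_def fst_conv snd_conv by (rule sym)
    qed
    finally show "(\<integral>\<^sup>+z. (\<Prod>t\<in>J. h t (\<omega>, z t)) \<partial>?LZ) = ?q \<omega>" .
  qed
  finally show ?thesis .
qed

definition W :: "'a \<Rightarrow> nat \<Rightarrow> 'b \<times> real" where
  "W \<omega> = (\<lambda>t\<in>{1..}. (D t \<omega>, Z t \<omega>))"

lemma W_meas[measurable]: "W \<in> M \<rightarrow>\<^sub>M pairs"
  unfolding W_def
proof (rule measurable_restrict)
  fix t :: nat assume "t \<in> {1..}"
  then have [measurable]: "D t \<in> M \<rightarrow>\<^sub>M S" "Z t \<in> borel_measurable M" using D_meas Z_meas by auto
  show "(\<lambda>\<omega>. (D t \<omega>, Z t \<omega>)) \<in> M \<rightarrow>\<^sub>M S \<Otimes>\<^sub>M borel" by measurable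
qed

definition pathlaw :: "'c \<Rightarrow> (nat \<Rightarrow> 'b \<times> real) measure" where
  "pathlaw c = Pi\<^sub>M {1..} (\<lambda>_. Q c \<Otimes>\<^sub>M \<zeta>)"

lemma pathlaw_emb:
  assumes c: "c \<in> space N" and J: "finite J" "J \<subseteq> {1..}" and E: "\<And>t. t \<in> J \<Longrightarrow> E t \<in> sets (S \<Otimes>\<^sub>M borel)"
  shows "emeasure (pathlaw c) (prod_emb {1..} (\<lambda>_. S \<Otimes>\<^sub>M borel) J (Pi\<^sub>E J E)) =
    (\<Prod>t\<in>J. emeasure (Q c \<Otimes>\<^sub>M \<zeta>) (E t))"
proof -
  have s: "sets (Q c \<Otimes>\<^sub>M \<zeta>) = sets (S \<Otimes>\<^sub>M borel)"
    by (intro sets_pair_measure_cong Q_sets c zeta)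
  have "prod_emb {1..} (\<lambda>_. S \<Otimes>\<^sub>M borel) J (Pi\<^sub>E J E) = prod_emb {1..} (\<lambda>_. Q c \<Otimes>\<^sub>M \<zeta>) J (Pi\<^sub>E J E)"
    by (simp only: prod_emb_def sets_eq_imp_space_eq[OF s])
  then show ?thesis
    unfolding pathlaw_def using E s
    by (simp only:) (rule emeasure_PiM_emb[OF prob_space_pair[OF Q_prob[OF c] zeta(1)] J(2,1)], simp)
qed

text \<open>On a generating cylinder the mass is a finite product of kernel masses, each measurable
  in the parameter; this extends from the Int-stable generator to a kernel.\<close>

lemma pathlaw_meas[measurable]: "pathlaw \<in> N \<rightarrow>\<^sub>M prob_algebra pairs"
proof (rule measurable_prob_algebra_generated[OF sets_PiM Int_stable_prod_algebra prod_algebra_sets_into_space])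
  show "prob_space (pathlaw c)" if "c \<in> space N" for c
    unfolding pathlaw_def by (intro prob_space_PiM prob_space_pair Q_prob that zeta)
  show "sets (pathlaw c) = sets pairs" if "c \<in> space N" for c
    unfolding pathlaw_def by (intro sets_PiM_cong refl sets_pair_measure_cong Q_sets that zeta)
  fix A :: "(nat \<Rightarrow> 'b \<times> real) set" assume "A \<in> prod_algebra {1..} (\<lambda>_. S \<Otimes>\<^sub>M borel)"
  then obtain J E where A: "A = prod_emb {1..} (\<lambda>_. S \<Otimes>\<^sub>M borel) J (Pi\<^sub>E J E)" "finite J"
    "J \<noteq> {} \<or> {1..} = ({} :: nat set)" "J \<subseteq> {1..}" "\<And>t. t \<in> J \<Longrightarrow> E t \<in> sets (S \<Otimes>\<^sub>M borel)" by (erule prod_algebraE)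
  have "(\<lambda>c. \<Prod>t\<in>J. emeasure (Q c \<Otimes>\<^sub>M \<zeta>) (E t)) \<in> borel_measurable N"
  proof (rule borel_measurable_prod_ennreal)
    fix t assume "t \<in> J"
    have "(\<lambda>c. Q c \<Otimes>\<^sub>M \<zeta>) \<in> N \<rightarrow>\<^sub>M prob_algebra (S \<Otimes>\<^sub>M borel)"
      by (intro measurable_pair_prob Q_meas zeta_const)
    from measurable_emeasure_kernel[OF measurable_prob_algebraD[OF this] A(5)[OF \<open>t \<in> J\<close>]]
    show "(\<lambda>c. emeasure (Q c \<Otimes>\<^sub>M \<zeta>) (E t)) \<in> borel_measurable N" .
  qed
  then show "(\<lambda>c. emeasure (pathlaw c) A) \<in> borel_measurable N"
    by (subst measurable_cong[of N]) (simp_all only: A(1) pathlaw_emb[OF _ A(2,4,5)])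
qed

text \<open>By \<open>emeasure_pairs\<close> both measures agree on cylinders, which determine a
  finite measure on the product space.\<close>

lemma W_law: "distr M pairs W = distr M N \<theta> \<bind> pathlaw"
proof (rule measure_eqI_PiM_infinite)
  interpret T: prob_space "distr M N \<theta>" by (rule prob_space_distr) measurable
  have ne: "space (distr M N \<theta>) \<noteq> {}" by (rule T.not_empty)
  have k: "pathlaw \<in> distr M N \<theta> \<rightarrow>\<^sub>M subprob_algebra pairs"
    using measurable_prob_algebraD[OF pathlaw_meas] by simp
  show "sets (distr M N \<theta> \<bind> pathlaw) = sets pairs"
    by (rule sets_bind[OF sets_kernel[OF k] ne])
  show "finite_measure (distr M pairs W)"
    by (intro finite_measure_distr W_meas)
  fix E :: "nat \<Rightarrow> ('b \<times> real) set" and J :: "nat set"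
  assume J: "finite J" "J \<subseteq> {1..}" and E: "\<And>t. t \<in> J \<Longrightarrow> E t \<in> sets (S \<Otimes>\<^sub>M borel)"
  let ?X = "prod_emb {1..} (\<lambda>_. S \<Otimes>\<^sub>M borel) J (Pi\<^sub>E J E)"
  have X: "?X \<in> sets pairs" using J E by (intro sets_PiM_I) auto
  have pre: "W -` ?X \<inter> space M = {\<omega> \<in> space M. \<forall>t\<in>J. (D t \<omega>, Z t \<omega>) \<in> E t}"
  proof -
    have "restrict (W \<omega>) J \<in> Pi\<^sub>E J E \<longleftrightarrow> (\<forall>t\<in>J. (D t \<omega>, Z t \<omega>) \<in> E t)" for \<omega>
      using J(2) by (auto simp: W_def PiE_iff subset_eq)
    moreover have "W \<omega> \<in> (\<Pi>\<^sub>E i\<in>{1..}. space (S \<Otimes>\<^sub>M borel))" if "\<omega> \<in> space M" for \<omega>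
      using measurable_space[OF W_meas that] by (simp only: space_PiM)
    ultimately show ?thesis
      by (intro set_eqI) (simp only: prod_emb_def vimage_eq Int_iff mem_Collect_eq, blast)
  qed
  have "emeasure (distr M pairs W) ?X = emeasure M (W -` ?X \<inter> space M)"
    by (rule emeasure_distr[OF W_meas X])
  also have "\<dots> = (\<integral>\<^sup>+\<omega>. (\<Prod>t\<in>J. emeasure (Q (\<theta> \<omega>) \<Otimes>\<^sub>M \<zeta>) (E t)) \<partial>M)"
    unfolding pre by (rule emeasure_pairs[OF J E])
  also have "\<dots> = (\<integral>\<^sup>+\<omega>. emeasure (pathlaw (\<theta> \<omega>)) ?X \<partial>M)"
    by (intro nn_integral_cong pathlaw_emb[symmetric] J E measurable_space[OF theta_meas])
  also have "\<dots> = (\<integral>\<^sup>+c. emeasure (pathlaw c) ?X \<partial>distr M N \<theta>)"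
    by (rule nn_integral_distr[symmetric, OF theta_meas])
       (simp add: measurable_emeasure_kernel[OF k X, simplified])
  also have "\<dots> = emeasure (distr M N \<theta> \<bind> pathlaw) ?X"
    by (rule emeasure_bind[symmetric, OF ne k X])
  finally show "emeasure (distr M pairs W) ?X = emeasure (distr M N \<theta> \<bind> pathlaw) ?X" .
qed simp

lemma nn_integral_W:
  assumes f: "f \<in> borel_measurable pairs"
  shows "(\<integral>\<^sup>+\<omega>. f (W \<omega>) \<partial>M) = (\<integral>\<^sup>+\<omega>. \<integral>\<^sup>+p. f p \<partial>pathlaw (\<theta> \<omega>) \<partial>M)"
proof -
  have k: "pathlaw \<in> distr M N \<theta> \<rightarrow>\<^sub>M subprob_algebra pairs"
    using measurable_prob_algebraD[OF pathlaw_meas] by simp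
  have "(\<integral>\<^sup>+\<omega>. f (W \<omega>) \<partial>M) = (\<integral>\<^sup>+p. f p \<partial>distr M pairs W)"
    by (rule nn_integral_distr[symmetric, OF W_meas]) (use f in simp)
  also have "\<dots> = (\<integral>\<^sup>+c. \<integral>\<^sup>+p. f p \<partial>pathlaw c \<partial>distr M N \<theta>)"
    unfolding W_law by (rule nn_integral_bind[OF f k])
  also have "\<dots> = (\<integral>\<^sup>+\<omega>. \<integral>\<^sup>+p. f p \<partial>pathlaw (\<theta> \<omega>) \<partial>M)"
    by (rule nn_integral_distr[OF theta_meas])
       (use nn_integral_measurable_subprob_algebra[OF f] measurable_prob_algebraD[OF pathlaw_meas] in
         \<open>auto intro: measurable_compose\<close>)
  finally show ?thesis .
qed

text \<open>The probability of failure is the average of the failure probabilities under the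
  component laws. Writing it as an integral is what makes the measurability of P
  indispensable.\<close>

lemma AE_W:
  assumes P: "Measurable.pred pairs P"
    and ae: "AE \<omega> in M. AE p in pathlaw (\<theta> \<omega>). P p"
  shows "AE \<omega> in M. P (W \<omega>)"
proof -
  let ?f = "\<lambda>p. indicator {p. \<not> P p} p :: ennreal"
  have f: "?f \<in> borel_measurable pairs"
    using P by (intro borel_measurable_indicator') measurable
  have "(\<integral>\<^sup>+\<omega>. ?f (W \<omega>) \<partial>M) = (\<integral>\<^sup>+\<omega>. \<integral>\<^sup>+p. ?f p \<partial>pathlaw (\<theta> \<omega>) \<partial>M)" by (rule nn_integral_W[OF f])
  also have "\<dots> = (\<integral>\<^sup>+\<omega>. 0 \<partial>M)"
  proof (rule nn_integral_cong_AE)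
    show "AE \<omega> in M. (\<integral>\<^sup>+p. ?f p \<partial>pathlaw (\<theta> \<omega>)) = 0"
      using ae
    proof eventually_elim
      case (elim \<omega>)
      then have "(\<integral>\<^sup>+p. ?f p \<partial>pathlaw (\<theta> \<omega>)) = (\<integral>\<^sup>+p. 0 \<partial>pathlaw (\<theta> \<omega>))"
        by (intro nn_integral_cong_AE) auto
      then show ?case by simp
    qed
  qed
  also have "\<dots> = 0" by simp
  finally have "AE \<omega> in M. ?f (W \<omega>) = 0"
    by (subst (asm) nn_integral_0_iff_AE) (use measurable_compose[OF W_meas f] in auto)
  then show ?thesis by eventually_elim (auto simp: indicator_def split: if_splits)
qed

text \<open>The marginal version of \<open>nn_integral_W\<close>; it turns the vanishing conditional
  means of the residuals into a vanishing unconditional mean.\<close>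

lemma nn_integral_D:
  assumes f: "f \<in> borel_measurable S"
  shows "(\<integral>\<^sup>+\<omega>. f (D 1 \<omega>) \<partial>M) = (\<integral>\<^sup>+\<omega>. \<integral>\<^sup>+x. f x \<partial>Q (\<theta> \<omega>) \<partial>M)"
proof -
  interpret zeta: prob_space \<zeta> by (rule zeta)
  have m1: "(\<lambda>p. p (1::nat)) \<in> Pi\<^sub>M {1..} (\<lambda>_. S \<Otimes>\<^sub>M (borel :: real measure)) \<rightarrow>\<^sub>M S \<Otimes>\<^sub>M borel"
    by (rule measurable_component_singleton) simp
  have fm: "(\<lambda>q. f (fst q)) \<in> borel_measurable (S \<Otimes>\<^sub>M (borel :: real measure))"
    using measurable_compose[OF measurable_fst f] .
  have "(\<integral>\<^sup>+\<omega>. f (D 1 \<omega>) \<partial>M) = (\<integral>\<^sup>+\<omega>. f (fst (W \<omega> 1)) \<partial>M)" by (simp add: W_def)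
  also have "\<dots> = (\<integral>\<^sup>+\<omega>. \<integral>\<^sup>+p. f (fst (p 1)) \<partial>pathlaw (\<theta> \<omega>) \<partial>M)"
    by (rule nn_integral_W) (rule measurable_compose[OF m1 fm])
  also have "\<dots> = (\<integral>\<^sup>+\<omega>. \<integral>\<^sup>+x. f x \<partial>Q (\<theta> \<omega>) \<partial>M)"
  proof (rule nn_integral_cong)
    fix \<omega> assume "\<omega> \<in> space M"
    then have c: "\<theta> \<omega> \<in> space N" by (rule measurable_space[OF theta_meas])
    interpret Qc: prob_space "Q (\<theta> \<omega>)" by (rule Q_prob[OF c])
    let ?R = "Q (\<theta> \<omega>) \<Otimes>\<^sub>M \<zeta>"
    have s: "sets ?R = sets (S \<Otimes>\<^sub>M borel)" by (intro sets_pair_measure_cong Q_sets c zeta)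
    have d1: "distr (pathlaw (\<theta> \<omega>)) ?R (\<lambda>p. p 1) = ?R"
      unfolding pathlaw_def by (rule distr_PiM_component) (auto intro: prob_space_pair Q_prob c zeta)
    have d2: "distr ?R (Q (\<theta> \<omega>)) fst = Q (\<theta> \<omega>)" by (rule zeta.distr_pair_fst)
    have "(\<integral>\<^sup>+p. f (fst (p 1)) \<partial>pathlaw (\<theta> \<omega>)) = (\<integral>\<^sup>+q. f (fst q) \<partial>distr (pathlaw (\<theta> \<omega>)) ?R (\<lambda>p. p 1))"
      by (rule nn_integral_distr[symmetric])
         (use fm in \<open>auto simp: pathlaw_def measurable_cong_sets[OF s refl] intro: measurable_component_singleton\<close>)
    also have "\<dots> = (\<integral>\<^sup>+x. f x \<partial>distr ?R (Q (\<theta> \<omega>)) fst)"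
      unfolding d1 by (rule nn_integral_distr[symmetric])
         (use f in \<open>auto simp: measurable_cong_sets[OF Q_sets[OF c] refl]\<close>)
    finally show "(\<integral>\<^sup>+p. f (fst (p 1)) \<partial>pathlaw (\<theta> \<omega>)) = (\<integral>\<^sup>+x. f x \<partial>Q (\<theta> \<omega>))" unfolding d2 .
  qed
  finally show ?thesis .
qed

end

section \<open>The conditional expectation of the outcome\<close>

definition emp_cov :: "(nat \<Rightarrow> nat \<Rightarrow> real) \<Rightarrow> nat \<Rightarrow> nat \<Rightarrow> nat \<Rightarrow> real" where
  "emp_cov y n i j = (\<Sum>\<tau>=1..n. y \<tau> i * y \<tau> j) / real n"

text \<open>\<open>lim\<close> is total, so this is a function of the observed estimates without
  reference to \<theta>. That makes the weights built from it admissible in a conditional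
  expectation given the estimates.\<close>

definition lim_cov :: "(nat \<Rightarrow> nat \<Rightarrow> real) \<Rightarrow> nat \<Rightarrow> nat \<Rightarrow> real" where
  "lim_cov y i j = lim (\<lambda>n. emp_cov y n i j)"

text \<open>Exactly the path properties that \<open>nu_hat_asymptotic\<close> consumes, phrased
  through the estimates alone.\<close>

definition regular :: "nat \<Rightarrow> (nat \<Rightarrow> nat \<Rightarrow> real) \<Rightarrow> bool" where
  "regular K y \<longleftrightarrow> pos_def K (lim_cov y) \<and>
     (\<forall>i\<in>{1..K}. \<forall>j\<in>{1..K}. rconv (\<lambda>n. emp_cov y n i j) (lim_cov y i j)) \<and>
     (\<forall>k\<in>{1..K}. (\<lambda>n. y (Suc n) k / real n powr (1/8)) \<longlonglongrightarrow> 0)"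

definition weights :: "nat \<Rightarrow> real \<Rightarrow> (nat \<Rightarrow> nat \<Rightarrow> real) \<Rightarrow> nat \<Rightarrow> real" where
  "weights K v y = solve K (lim_cov y) (\<lambda>_. v)"

abbreviation obs_space :: "nat \<Rightarrow> (nat \<Rightarrow> (nat \<Rightarrow> real) \<times> real) measure" where
  "obs_space K \<equiv> Pi\<^sub>M {1..} (\<lambda>_. rvec K \<Otimes>\<^sub>M borel)"

lemma measurable_est_coord:
  assumes "1 \<le> t" "k \<in> {1..K}"
  shows "(\<lambda>y. y t k) \<in> borel_measurable (est_space K)"
  by (rule measurable_compose[of "\<lambda>y. y t" _ "rvec K"]) (use assms in \<open>auto intro: measurable_component_singleton\<close>)

lemma measurable_emp_cov:
  assumes "i \<in> {1..K}" "j \<in> {1..K}"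
  shows "(\<lambda>y. emp_cov y n i j) \<in> borel_measurable (est_space K)"
  unfolding emp_cov_def
  by (intro borel_measurable_divide borel_measurable_sum borel_measurable_times measurable_est_coord
      borel_measurable_const assms) auto

lemma measurable_lim_cov:
  assumes "i \<in> {1..K}" "j \<in> {1..K}"
  shows "(\<lambda>y. lim_cov y i j) \<in> borel_measurable (est_space K)"
  unfolding lim_cov_def by (intro borel_measurable_lim_metric measurable_emp_cov assms)

lemma measurable_weights: "k \<in> {1..K} \<Longrightarrow> (\<lambda>y. weights K v y k) \<in> borel_measurable (est_space K)"
  unfolding weights_def by (intro measurable_solve measurable_lim_cov borel_measurable_const)

text \<open>Restricting the tolerance to the reciprocals 1/(k + 1) leaves only countable
  quantifiers.\<close>

lemma pred_tendsto_0:
  fixes f :: "nat \<Rightarrow> 'a \<Rightarrow> real"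
  assumes [measurable]: "\<And>n. f n \<in> borel_measurable M"
  shows "Measurable.pred M (\<lambda>x. (\<lambda>n. f n x) \<longlonglongrightarrow> 0)"
proof -
  have "(\<lambda>n. f n x) \<longlonglongrightarrow> 0 \<longleftrightarrow> (\<forall>k::nat. \<exists>N. \<forall>n\<ge>N. \<bar>f n x\<bar> < inverse (real (Suc k)))" for x
  proof
    assume "(\<lambda>n. f n x) \<longlonglongrightarrow> 0"
    then show "\<forall>k::nat. \<exists>N. \<forall>n\<ge>N. \<bar>f n x\<bar> < inverse (real (Suc k))"
      unfolding LIMSEQ_iff by (metis diff_0_right inverse_positive_iff_positive of_nat_0_less_iff real_norm_def zero_less_Suc)
  next
    assume r: "\<forall>k::nat. \<exists>N. \<forall>n\<ge>N. \<bar>f n x\<bar> < inverse (real (Suc k))"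
    show "(\<lambda>n. f n x) \<longlonglongrightarrow> 0"
      unfolding LIMSEQ_iff
    proof (intro allI impI)
      fix e :: real assume "0 < e"
      then obtain k where "inverse (real (Suc k)) < e" using reals_Archimedean by blast
      moreover obtain N where "\<forall>n\<ge>N. \<bar>f n x\<bar> < inverse (real (Suc k))" using r by blast
      ultimately show "\<exists>N. \<forall>n\<ge>N. norm (f n x - 0) < e" by fastforce
    qed
  qed
  then show ?thesis by simp
qed

lemma pred_regular: "Measurable.pred (est_space K) (regular K)"
proof -
  have 1: "Measurable.pred (est_space K) (\<lambda>y. pos_def K (lim_cov y))"
    by (intro pred_pos_def measurable_lim_cov)
  have 2: "Measurable.pred (est_space K) (\<lambda>y. \<forall>i\<in>{1..K}. \<forall>j\<in>{1..K}. rconv (\<lambda>n. emp_cov y n i j) (lim_cov y i j))"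
    unfolding rconv_def
    by (intro pred_intros_finite pred_tendsto_0 borel_measurable_times borel_measurable_diff
        borel_measurable_const measurable_emp_cov measurable_lim_cov finite_atLeastAtMost)
  have 3: "Measurable.pred (est_space K) (\<lambda>y. \<forall>k\<in>{1..K}. (\<lambda>n. y (Suc n) k / real n powr (1/8)) \<longlonglongrightarrow> 0)"
    by (intro pred_intros_finite pred_tendsto_0 borel_measurable_divide
        borel_measurable_const measurable_est_coord finite_atLeastAtMost) auto
  show ?thesis
    unfolding regular_def[abs_def] by (intro pred_intros_logic 1 2 3)
qed

text \<open>The constant matrix adds v times the squared coordinate sum to the quadratic
  form.\<close>

lemma pos_def_add_const:
  assumes S: "pos_def n S" and v: "0 \<le> v"
  shows "pos_def n (\<lambda>i j. S i j + v)"
  unfolding pos_def_def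
proof (intro conjI ballI allI impI)
  fix i j assume "i \<in> {1..n}" "j \<in> {1..n}"
  then show "S i j + v = S j i + v" using S unfolding pos_def_def by simp
next
  fix a :: "nat \<Rightarrow> real" assume "\<exists>i\<in>{1..n}. a i \<noteq> 0"
  then have "0 < qform n S a" using S unfolding pos_def_def by blast
  moreover have "0 \<le> v * (\<Sum>i=1..n. a i)\<^sup>2" using v by simp
  moreover have "(\<Sum>i=1..n. \<Sum>j=1..n. a i * (S i j + v) * a j) = qform n S a + v * (\<Sum>i=1..n. a i)\<^sup>2"
  proof -
    have "v * (\<Sum>i=1..n. a i)\<^sup>2 = (\<Sum>i=1..n. \<Sum>j=1..n. a i * v * a j)"
      by (simp only: power2_eq_square sum_product sum_distrib_left mult_ac)
    then show ?thesis by (simp only: distrib_left distrib_right sum.distrib)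
  qed
  ultimately show "0 < (\<Sum>i=1..n. \<Sum>j=1..n. a i * (S i j + v) * a j)" by linarith
qed

text \<open>The error when the weights are learned from the same path. It makes no mention of S, so
  one function on paths serves all components of the mixture.\<close>

definition pred_error :: "nat \<Rightarrow> real \<Rightarrow> nat \<Rightarrow> (nat \<Rightarrow> (nat \<Rightarrow> real) \<times> real) \<Rightarrow> real" where
  "pred_error K v t p = snd (p t) - (\<Sum>k=1..K. weights K v (estimate_path K p) k * estimate_path K p t k)"

lemma measurable_estimate_path:
  "estimate_path K \<in> obs_space K \<rightarrow>\<^sub>M est_space K"
  unfolding estimate_path_def
proof (rule measurable_restrict)
  fix t :: nat assume t: "t \<in> {1..}"
  have "estimates K \<in> rvec K \<Otimes>\<^sub>M borel \<rightarrow>\<^sub>M rvec K" unfolding estimates_def by measurable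
  then show "(\<lambda>p. estimates K (p t)) \<in> obs_space K \<rightarrow>\<^sub>M rvec K"
    by (rule measurable_compose[rotated]) (rule measurable_component_singleton[OF t])
qed

lemma measurable_pred_error:
  assumes t: "1 \<le> t"
  shows "pred_error K v t \<in> borel_measurable (obs_space K)"
  unfolding pred_error_def
proof (intro borel_measurable_diff borel_measurable_sum borel_measurable_times)
  show "(\<lambda>p. snd (p t)) \<in> borel_measurable (obs_space K)"
  proof -
    have "(\<lambda>p. p t) \<in> obs_space K \<rightarrow>\<^sub>M rvec K \<Otimes>\<^sub>M borel"
      by (rule measurable_component_singleton) (use t in simp)
    from measurable_compose[OF this measurable_snd] show ?thesis .
  qed
  fix k assume k: "k \<in> {1..K}"
  show "(\<lambda>p. weights K v (estimate_path K p) k) \<in> borel_measurable (obs_space K)"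
    by (rule measurable_compose[OF measurable_estimate_path measurable_weights[OF k]])
  show "(\<lambda>p. estimate_path K p t k) \<in> borel_measurable (obs_space K)"
    by (rule measurable_compose[OF measurable_estimate_path measurable_est_coord[OF t k]])
qed

section \<open>The prediction error for a fixed covariance\<close>

context gaussian_round begin

context
  assumes S: "pos_def K S"
begin

lemma path_regular:
  "AE p in path. regular K (ests p) \<and> (\<forall>i\<in>{1..K}. \<forall>j\<in>{1..K}. lim_cov (ests p) i j = S i j + v)"
proof -
  have "AE p in path. \<forall>i\<in>{1..K}. \<forall>j\<in>{1..K}. rconv (\<lambda>n. emp_cov (ests p) n i j) (S i j + v)"
  proof (intro AE_finite_allI finite_atLeastAtMost)
    fix i j assume ij: "i \<in> {1..K}" "j \<in> {1..K}"
    have "emp_cov (ests p) n i j = (\<Sum>\<tau>=1..n. est (p \<tau>) i * est (p \<tau>) j) / real n" for p n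
      unfolding emp_cov_def by (intro arg_cong2[where f = "(/)"] sum.cong refl) (simp add: estimate_path_def)
    then show "AE p in path. rconv (\<lambda>n. emp_cov (ests p) n i j) (S i j + v)"
      using path_covariance[OF ij] by (simp only:)
  qed
  moreover have "AE p in path. \<forall>k\<in>{1..K}. (\<lambda>n. ests p (Suc n) k / real n powr (1/8)) \<longlonglongrightarrow> 0"
  proof (intro AE_finite_allI finite_atLeastAtMost)
    fix k assume "k \<in> {1..K}"
    from path_growth[OF this] show "AE p in path. (\<lambda>n. ests p (Suc n) k / real n powr (1/8)) \<longlonglongrightarrow> 0"
      by (simp add: estimate_path_def)
  qed
  ultimately show ?thesis
  proof eventually_elim
    case (elim p)
    have lc: "lim_cov (ests p) i j = S i j + v" if "i \<in> {1..K}" "j \<in> {1..K}" for i j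
      unfolding lim_cov_def using elim(1) that by (intro limI rconv_imp_tendsto) blast
    moreover have "pos_def K (lim_cov (ests p))"
      using pos_def_add_const[OF S v] pos_def_cong[of K "lim_cov (ests p)" "\<lambda>i j. S i j + v"] lc by blast
    ultimately show ?case using elim unfolding regular_def by simp
  qed
qed

text \<open>On almost every path the limit covariance equals S + v 1 1^T, and uniqueness of the
  solution replaces the learned weights by constant ones.\<close>

lemma path_pred_error:
  assumes t: "1 \<le> t"
  shows "AE p in path. pred_error K v t p = innov (solve K (\<lambda>i j. S i j + v) (\<lambda>_. v)) (p t)"
  using path_regular
proof eventually_elim
  case (elim p)
  then have reg: "pos_def K (lim_cov (ests p))" by (simp add: regular_def)
  have "weights K v (ests p) k = solve K (\<lambda>i j. S i j + v) (\<lambda>_. v) k" if k: "k \<in> {1..K}" for k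
    unfolding weights_def
  proof (rule pos_def_unique[OF reg _ k])
    fix i assume i: "i \<in> {1..K}"
    have "(\<Sum>j=1..K. lim_cov (ests p) i j * solve K (\<lambda>i j. S i j + v) (\<lambda>_. v) j) =
      (\<Sum>j=1..K. (S i j + v) * solve K (\<lambda>i j. S i j + v) (\<lambda>_. v) j)"
      using elim i by (intro sum.cong refl) simp
    also have "\<dots> = v" by (rule solve_correct[OF pos_def_add_const[OF S v] i])
    also have "v = (\<Sum>j=1..K. lim_cov (ests p) i j * solve K (lim_cov (ests p)) (\<lambda>_. v) j)"
      by (rule solve_correct[OF reg i, symmetric])
    finally show "(\<Sum>j=1..K. lim_cov (ests p) i j * solve K (lim_cov (ests p)) (\<lambda>_. v) j) =
      (\<Sum>j=1..K. lim_cov (ests p) i j * solve K (\<lambda>i j. S i j + v) (\<lambda>_. v) j)" by (rule sym)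
  qed
  then show ?case
    unfolding pred_error_def innov_def using t
    by (intro arg_cong2[where f = "(-)"] refl sum.cong) (simp add: estimate_path_def)
qed

lemma path_pred_error_square_le:
  assumes t: "1 \<le> t"
  shows "(\<integral>\<^sup>+p. ennreal ((pred_error K v t p)\<^sup>2) \<partial>path) \<le> ennreal v"
proof -
  let ?w = "solve K (\<lambda>i j. S i j + v) (\<lambda>_. v)"
  have "(\<integral>\<^sup>+p. ennreal ((pred_error K v t p)\<^sup>2) \<partial>path) = (\<integral>\<^sup>+p. ennreal ((innov ?w (p t))\<^sup>2) \<partial>path)"
    using path_pred_error[OF t] by (intro nn_integral_cong_AE) auto
  also have "\<dots> \<le> ennreal v"
    by (rule innov_path_square_le[OF solve_correct[OF pos_def_add_const[OF S v]] t])
  finally show ?thesis .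
qed

lemma path_pred_error_symmetric:
  assumes t: "1 \<le> t" and G: "G \<in> sets (est_space K)"
  shows "(\<integral>\<^sup>+p. ennreal (pred_error K v t p) * indicator G (ests p) \<partial>path) =
    (\<integral>\<^sup>+p. ennreal (- pred_error K v t p) * indicator G (ests p) \<partial>path)"
proof -
  let ?w = "solve K (\<lambda>i j. S i j + v) (\<lambda>_. v)"
  have e: "(\<integral>\<^sup>+p. ennreal (c * pred_error K v t p) * indicator G (ests p) \<partial>path) =
      (\<integral>\<^sup>+p. ennreal (c * innov ?w (p t)) * indicator G (ests p) \<partial>path)" for c
    using path_pred_error[OF t] by (intro nn_integral_cong_AE) auto
  have "(\<integral>\<^sup>+p. ennreal (innov ?w (p t)) * indicator G (ests p) \<partial>path) =
      (\<integral>\<^sup>+p. ennreal (- innov ?w (p t)) * indicator G (ests p) \<partial>path)"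
    by (rule innov_path_symmetric[OF _ t G]) (rule solve_correct[OF pos_def_add_const[OF S v]])
  then show ?thesis using e[of 1] e[of "-1"] by simp
qed

end

end

text \<open>Mean zero in a form that can be integrated over \<theta> as it stands.\<close>

lemma nn_integral_pos_neg_eq:
  assumes int: "integrable M (f :: 'a \<Rightarrow> real)" and "integral\<^sup>L M f = 0"
  shows "(\<integral>\<^sup>+x. ennreal (f x) \<partial>M) = (\<integral>\<^sup>+x. ennreal (- f x) \<partial>M)"
proof -
  have fin: "(\<integral>\<^sup>+x. ennreal (f x) \<partial>M) \<noteq> \<infinity>" "(\<integral>\<^sup>+x. ennreal (- f x) \<partial>M) \<noteq> \<infinity>"
    using int unfolding real_integrable_def by auto
  have "enn2real (\<integral>\<^sup>+x. ennreal (f x) \<partial>M) = enn2real (\<integral>\<^sup>+x. ennreal (- f x) \<partial>M)"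
    using assms(2) by (simp add: real_lebesgue_integral_def[OF int])
  then show ?thesis using fin by (metis ennreal_enn2real infinity_ennreal_def less_top)
qed

section \<open>The crowd as a mixture of Gaussian rounds\<close>

context gaussian_crowd begin

abbreviation \<Delta> :: "nat \<Rightarrow> 'a \<Rightarrow> nat \<Rightarrow> real" where
  "\<Delta> \<equiv> residual K Y Z"

lemma estimates_residual: "1 \<le> t \<Longrightarrow> \<omega> \<in> space M \<Longrightarrow> estimates K (\<Delta> t \<omega>, Z t \<omega>) = Y t \<omega>"
  by (auto simp: estimates_def residual_def Y_eq fun_eq_iff)

lemma mixture_residual:
  assumes "\<And>t. 1 \<le> t \<Longrightarrow> distr M borel (Z t) = \<zeta>"
  shows "mixture M N \<theta> (rvec K) \<Delta> Q\<Delta> Z \<zeta>"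
  by (intro mixture.intro prob_space_axioms residual_cond_iid Z_indep assms residual_indep_Z)

text \<open>The centring comes from the estimates: the mean of Z is that of an estimate minus that
  of its residual. The residual has conditional mean zero, so its positive and negative parts have
  equal integrals under each component law and hence under the mixture. The variance then fixes the
  remaining parameter.\<close>

lemma Z_gaussian_law:
  assumes t: "1 \<le> t"
  shows "distr M borel (Z t) = normal_law 0 (sqrt (variance (Z t)))" and "integrable M (Z t)"
proof -
  have Zm[measurable]: "Z t \<in> borel_measurable M" if "1 \<le> t" for t using that by (rule Z_measurable)
  obtain m s where ms: "0 \<le> s" "distr M borel (Z 1) = normal_law m s"
    using Z_gaussian[of 1] unfolding gaussian_law_def by auto
  then have law: "distr M borel (Z t) = normal_law m s" if "1 \<le> t" for t
    using Z_identical[OF that order_refl] by simp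
  have int: "integrable M (Z t)" if "1 \<le> t" for t
    using integrable_normal_law_power[OF ms(1), of m 1] Zm[OF that]
    unfolding law[OF that, symmetric] by (simp add: integrable_distr_eq)
  then show "integrable M (Z t)" using t .
  have E: "expectation (\<lambda>\<omega>. g (Z t \<omega>)) = (\<integral>z. g z \<partial>normal_law m s)"
    if "1 \<le> t" and [measurable]: "g \<in> borel_measurable borel" for t and g :: "real \<Rightarrow> real"
    unfolding law[OF that(1), symmetric] using Zm[OF that(1)] by (simp add: integral_distr)
  interpret mixture M N \<theta> "rvec K" \<Delta> Q\<Delta> Z "normal_law m s" by (rule mixture_residual[OF law])
  have k: "1 \<in> {1..K}" using K_pos by simp
  have D: "\<Delta> 1 \<omega> 1 = Y 1 \<omega> 1 - Z 1 \<omega>" for \<omega> using k by (simp add: residual_def)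
  have intD: "integrable M (\<lambda>\<omega>. \<Delta> 1 \<omega> 1)"
    unfolding D using Y_integrable[OF order_refl k] int[OF order_refl] by simp
  have xm: "(\<lambda>x. c * x 1) \<in> borel_measurable (rvec K)" for c :: real using k by measurable
  have "(\<integral>\<^sup>+\<omega>. ennreal (\<Delta> 1 \<omega> 1) \<partial>M) = (\<integral>\<^sup>+\<omega>. \<integral>\<^sup>+x. ennreal (x 1) \<partial>Q\<Delta> (\<theta> \<omega>) \<partial>M)"
    using nn_integral_D[OF measurable_compose[OF xm[of 1] measurable_ennreal]] by simp
  also have "\<dots> = (\<integral>\<^sup>+\<omega>. \<integral>\<^sup>+x. ennreal (- x 1) \<partial>Q\<Delta> (\<theta> \<omega>) \<partial>M)"
  proof (rule nn_integral_cong_AE)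
    show "AE \<omega> in M. (\<integral>\<^sup>+x. ennreal (x 1) \<partial>Q\<Delta> (\<theta> \<omega>)) = (\<integral>\<^sup>+x. ennreal (- x 1) \<partial>Q\<Delta> (\<theta> \<omega>))"
      using residual_gaussian AE_space
    proof eventually_elim
      case (elim \<omega>)
      then have "prob_space (Q\<Delta> (\<theta> \<omega>))" by (intro Q_prob measurable_space[OF theta_meas])
      with elim k show ?case
        by (intro nn_integral_pos_neg_eq gaussian_vector_integrable[where n = K]) (auto simp: mean_vector_def)
    qed
  qed
  also have "\<dots> = (\<integral>\<^sup>+\<omega>. ennreal (- \<Delta> 1 \<omega> 1) \<partial>M)"
    using nn_integral_D[OF measurable_compose[OF xm[of "-1"] measurable_ennreal]] by simp
  finally have "expectation (\<lambda>\<omega>. \<Delta> 1 \<omega> 1) = 0"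
    unfolding real_lebesgue_integral_def[OF intD] by simp
  then have "expectation (Z 1) = 0"
    unfolding D using Y_mean[OF order_refl k] Y_integrable[OF order_refl k] int[OF order_refl]
    by (subst (asm) Bochner_Integration.integral_diff) auto
  then have m: "m = 0"
    using E[OF order_refl, of "\<lambda>z. z"] integral_normal_law[OF ms(1)] by simp
  have "expectation (Z t) = 0" using E[OF t, of "\<lambda>z. z"] integral_normal_law[OF ms(1)] m by simp
  then have "variance (Z t) = s\<^sup>2"
    using E[OF t, of "\<lambda>z. z\<^sup>2"] integral_normal_law_square[OF ms(1)] m by simp
  then show "distr M borel (Z t) = normal_law 0 (sqrt (variance (Z t)))"
    using law[OF t] ms(1) m by simp
qed

context
  fixes vbar :: real
  assumes vbar: "\<And>t. 1 \<le> t \<Longrightarrow> vbar = variance (Z t)"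
begin

interpretation mixture M N \<theta> "rvec K" \<Delta> Q\<Delta> Z "normal_law 0 (sqrt vbar)"
  by (rule mixture_residual) (use Z_gaussian_law(1) vbar in simp)

lemma vbar_nonneg: "0 \<le> vbar"
  using vbar[OF order_refl] by (simp add: Bochner_Integration.integral_nonneg)

lemma AE_round:
  "AE \<omega> in M. gaussian_round K (Q\<Delta> (\<theta> \<omega>)) (cov_matrix (Q\<Delta> (\<theta> \<omega>))) vbar \<and>
    pos_def K (cov_matrix (Q\<Delta> (\<theta> \<omega>))) \<and>
    pathlaw (\<theta> \<omega>) = gaussian_round.path (Q\<Delta> (\<theta> \<omega>)) vbar"
  using residual_gaussian AE_space
proof eventually_elim
  case (elim \<omega>)
  let ?Q = "Q\<Delta> (\<theta> \<omega>)"
  have c: "\<theta> \<omega> \<in> space N" by (rule measurable_space[OF theta_meas elim(2)])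
  note Q = Q_prob[OF c] Q_sets[OF c]
  have "gaussian_round K ?Q (cov_matrix ?Q) vbar"
  proof (rule gaussian_round.intro)
    show "cov_matrix ?Q i j = cov_matrix ?Q j i" for i j
      by (simp add: cov_matrix_def mult.commute)
    have mean: "mean_vector ?Q k = 0" if "k \<in> {1..K}" for k
      using elim(1) that by blast
    have g: "gaussian_vector_law K ?Q" using elim(1) by blast
    show "0 \<le> qform K (cov_matrix ?Q) a"
      "distr ?Q borel (\<lambda>x. \<Sum>i=1..K. a i * x i) =
         normal_law 0 (sqrt (qform K (cov_matrix ?Q) a))" for a
      by (rule gaussian_vector_qform_nonneg[OF Q(1) g mean] gaussian_vector_distr[OF Q(1) g mean]; assumption)+
  qed (fact Q vbar_nonneg)+
  moreover from this have "pathlaw (\<theta> \<omega>) = gaussian_round.path ?Q vbar"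
    by (simp only: pathlaw_def gaussian_round.path_def gaussian_round.R_def)
  ultimately show ?case using elim by blast
qed

definition Yseq :: "'a \<Rightarrow> nat \<Rightarrow> nat \<Rightarrow> real" where
  "Yseq \<omega> = (\<lambda>t\<in>{1..}. Y t \<omega>)"

lemma estimate_path_W: "\<omega> \<in> space M \<Longrightarrow> estimate_path K (W \<omega>) = Yseq \<omega>"
  unfolding estimate_path_def W_def Yseq_def by (auto simp: fun_eq_iff estimates_residual)

lemma Yseq_meas: "Yseq \<in> M \<rightarrow>\<^sub>M est_space K"
  unfolding Yseq_def
  by (rule measurable_restrict) (use Y_exchangeable in \<open>auto simp: exchangeable_def\<close>)

lemma AE_regular: "AE \<omega> in M. regular K (Yseq \<omega>)"
proof -
  have "AE \<omega> in M. regular K (estimate_path K (W \<omega>))"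
  proof (rule AE_W)
    show "Measurable.pred (obs_space K) (\<lambda>p. regular K (estimate_path K p))"
      by (rule measurable_compose[OF measurable_estimate_path pred_regular])
    show "AE \<omega> in M. AE p in pathlaw (\<theta> \<omega>). regular K (estimate_path K p)"
      using AE_round
    proof eventually_elim
      case (elim \<omega>)
      then have g: "gaussian_round K (Q\<Delta> (\<theta> \<omega>)) (cov_matrix (Q\<Delta> (\<theta> \<omega>))) vbar"
        and pd: "pos_def K (cov_matrix (Q\<Delta> (\<theta> \<omega>)))"
        and pl: "pathlaw (\<theta> \<omega>) = gaussian_round.path (Q\<Delta> (\<theta> \<omega>)) vbar" by auto
      show ?case
        unfolding pl using gaussian_round.path_regular[OF g pd] by eventually_elim simp
    qed
  qed
  with AE_space show ?thesis by eventually_elim (simp only: estimate_path_W)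
qed

lemma pred_error_W:
  "1 \<le> t \<Longrightarrow> \<omega> \<in> space M \<Longrightarrow> pred_error K vbar t (W \<omega>) = Z t \<omega> - (\<Sum>k=1..K. weights K vbar (Yseq \<omega>) k * Y t \<omega> k)"
  unfolding pred_error_def estimate_path_W by (simp add: W_def Yseq_def)

text \<open>The weighted sum is a function of the estimates, and the error integrates to zero over
  each of their events, because the integrals of its positive and negative parts agree on every
  component and thus on the mixture.\<close>

lemma cond_exp_Z:
  assumes t: "1 \<le> t"
  shows "AE \<omega> in M. real_cond_exp M (sigma_Y M K Y) (Z t) \<omega> = (\<Sum>k=1..K. weights K vbar (Yseq \<omega>) k * Y t \<omega> k)"
proof -
  define U where "U \<omega> = pred_error K vbar t (W \<omega>)" for \<omega>
  let ?g = "\<lambda>\<omega>. \<Sum>k=1..K. weights K vbar (Yseq \<omega>) k * Y t \<omega> k"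
  have Um[measurable]: "U \<in> borel_measurable M"
    unfolding U_def by (rule measurable_compose[OF W_meas measurable_pred_error[OF t]])
  have sq: "(\<lambda>p. ennreal ((pred_error K vbar t p)\<^sup>2)) \<in> borel_measurable (obs_space K)"
    using measurable_pred_error[OF t, of K vbar] by measurable
  have "(\<integral>\<^sup>+\<omega>. ennreal ((U \<omega>)\<^sup>2) \<partial>M) = (\<integral>\<^sup>+\<omega>. \<integral>\<^sup>+p. ennreal ((pred_error K vbar t p)\<^sup>2) \<partial>pathlaw (\<theta> \<omega>) \<partial>M)"
    unfolding U_def by (rule nn_integral_W[OF sq])
  also have "\<dots> \<le> (\<integral>\<^sup>+\<omega>. ennreal vbar \<partial>M)"
  proof (rule nn_integral_mono_AE)
    show "AE \<omega> in M. (\<integral>\<^sup>+p. ennreal ((pred_error K vbar t p)\<^sup>2) \<partial>pathlaw (\<theta> \<omega>)) \<le> ennreal vbar"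
      using AE_round by eventually_elim (use t in \<open>auto intro!: gaussian_round.path_pred_error_square_le\<close>)
  qed
  also have "\<dots> < \<infinity>" by (simp add: emeasure_space_1)
  \<comment> \<open>The second moment is at most \<open>vbar\<close> on every component, uniformly
    in the covariance; integrability of U, and of the weighted sum as Z - U, follows.\<close>
  finally have "integrable M (\<lambda>\<omega>. (U \<omega>)\<^sup>2)" by (intro integrableI_nonneg) auto
  then have intU: "integrable M U" by (rule square_integrable_imp_integrable[OF Um])
  have sym: "(\<integral>\<^sup>+\<omega>. ennreal (U \<omega>) * indicator G (Yseq \<omega>) \<partial>M) = (\<integral>\<^sup>+\<omega>. ennreal (- U \<omega>) * indicator G (Yseq \<omega>) \<partial>M)"
    if G: "G \<in> sets (est_space K)" for G
  proof -
    let ?I = "\<lambda>c \<omega>. \<integral>\<^sup>+p. ennreal (c * pred_error K vbar t p) * indicator G (estimate_path K p) \<partial>pathlaw (\<theta> \<omega>)"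
    have fm: "(\<lambda>p. ennreal (c * pred_error K vbar t p) * indicator G (estimate_path K p)) \<in>
        borel_measurable (obs_space K)" for c
      by (intro borel_measurable_times_ennreal measurable_compose[OF _ measurable_ennreal] borel_measurable_times
          borel_measurable_const measurable_pred_error t
          measurable_compose[OF measurable_estimate_path borel_measurable_indicator[OF G]])
    have e: "(\<integral>\<^sup>+\<omega>. ennreal (c * U \<omega>) * indicator G (Yseq \<omega>) \<partial>M) =
        (\<integral>\<^sup>+\<omega>. ?I c \<omega> \<partial>M)" for c
      unfolding nn_integral_W[OF fm, symmetric] U_def
      by (intro nn_integral_cong) (simp only: estimate_path_W)
    have "(\<integral>\<^sup>+\<omega>. ?I 1 \<omega> \<partial>M)
       = (\<integral>\<^sup>+\<omega>. ?I (-1) \<omega> \<partial>M)"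
    proof (rule nn_integral_cong_AE)
      show "AE \<omega> in M. (?I 1 \<omega>)
       = (?I (-1) \<omega>)"
        using AE_round
      proof eventually_elim
        case (elim \<omega>)
        then show ?case
          using gaussian_round.path_pred_error_symmetric[of K "Q\<Delta> (\<theta> \<omega>)" "cov_matrix (Q\<Delta> (\<theta> \<omega>))" vbar t G] t G
          by simp
      qed
    qed
    then show ?thesis using e[of 1] e[of "-1"] by simp
  qed
  have Ug: "?g \<omega> = Z t \<omega> - U \<omega>" if "\<omega> \<in> space M" for \<omega>
    unfolding U_def pred_error_W[OF t that] by simp
  have intg: "integrable M ?g"
    using Bochner_Integration.integrable_diff[OF Z_gaussian_law(2)[OF t] intU]
    by (rule Bochner_Integration.integrable_cong[OF refl, THEN iffD1, rotated]) (simp only: Ug)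
  have sub: "subalgebra M (sigma_Y M K Y)"
  proof -
    have "Yseq \<in> space M \<rightarrow> space (est_space K)" using measurable_space[OF Yseq_meas] by auto
    then show ?thesis
      unfolding subalgebra_def sigma_Y_def Yseq_def[symmetric]
      by (auto simp: sets_vimage_algebra2 measurable_sets[OF Yseq_meas])
  qed
  interpret finite_measure_subalgebra M "sigma_Y M K Y" by unfold_locales (rule sub)
  have Yv: "Yseq \<in> sigma_Y M K Y \<rightarrow>\<^sub>M est_space K"
    unfolding sigma_Y_def Yseq_def[symmetric]
    by (rule measurable_vimage_algebra1) (use measurable_space[OF Yseq_meas] in auto)
  show ?thesis
  proof (rule real_cond_exp_charact)
    show "integrable M (Z t)" by (rule Z_gaussian_law(2)[OF t])
    show "integrable M ?g" by (rule intg)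
    show "?g \<in> borel_measurable (sigma_Y M K Y)"
    proof -
      have "?g = (\<lambda>\<omega>. \<Sum>k=1..K. weights K vbar (Yseq \<omega>) k * Yseq \<omega> t k)"
        using t by (simp add: Yseq_def)
      moreover have "\<dots> \<in> borel_measurable (sigma_Y M K Y)"
        by (intro borel_measurable_sum borel_measurable_times measurable_compose[OF Yv measurable_weights]
            measurable_compose[OF Yv measurable_est_coord] t)
      ultimately show ?thesis by simp
    qed
    fix A assume "A \<in> sets (sigma_Y M K Y)"
    moreover have "Yseq \<in> space M \<rightarrow> space (est_space K)" using measurable_space[OF Yseq_meas] by auto
    ultimately obtain G where G: "G \<in> sets (est_space K)" "A = Yseq -` G \<inter> space M"
      unfolding sigma_Y_def Yseq_def[symmetric] by (auto simp: sets_vimage_algebra2)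
    have A: "A \<in> sets M" unfolding G(2) by (rule measurable_sets[OF Yseq_meas G(1)])
    have iA: "integrable M (\<lambda>\<omega>. indicator A \<omega> * U \<omega>)"
      using integrable_mult_indicator[OF A intU] by simp
    have "(\<integral>\<^sup>+\<omega>. ennreal (indicator A \<omega> * (c * U \<omega>)) \<partial>M) = (\<integral>\<^sup>+\<omega>. ennreal (c * U \<omega>) * indicator G (Yseq \<omega>) \<partial>M)" for c
      by (intro nn_integral_cong) (auto simp: G(2) indicator_def)
    from this[of 1] this[of "-1"] sym[OF G(1)]
    have "(\<integral>\<omega>. indicator A \<omega> * U \<omega> \<partial>M) = 0"
      by (simp add: real_lebesgue_integral_def[OF iA])
    moreover have "(\<integral>\<omega>. indicator A \<omega> * Z t \<omega> \<partial>M) - (\<integral>\<omega>. indicator A \<omega> * ?g \<omega> \<partial>M) = (\<integral>\<omega>. indicator A \<omega> * U \<omega> \<partial>M)"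
    proof -
      have "(\<integral>\<omega>. indicator A \<omega> * Z t \<omega> \<partial>M) - (\<integral>\<omega>. indicator A \<omega> * ?g \<omega> \<partial>M) =
          (\<integral>\<omega>. indicator A \<omega> * Z t \<omega> - indicator A \<omega> * ?g \<omega> \<partial>M)"
        using integrable_mult_indicator[OF A Z_gaussian_law(2)[OF t]] integrable_mult_indicator[OF A intg]
        by (intro Bochner_Integration.integral_diff[symmetric]) simp_all
      also have "\<dots> = (\<integral>\<omega>. indicator A \<omega> * U \<omega> \<partial>M)"
        by (intro Bochner_Integration.integral_cong refl) (simp only: Ug right_diff_distrib diff_diff_eq2 add_diff_cancel_left')
      finally show ?thesis .
    qed
    ultimately show "(\<integral>\<omega>\<in>A. Z t \<omega> \<partial>M) = (\<integral>\<omega>\<in>A. ?g \<omega> \<partial>M)"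
      unfolding set_lebesgue_integral_def by simp
  qed
qed

text \<open>On a regular path where the conditional expectations take their explicit form, the claim
  is the deterministic statement \<open>nu_hat_asymptotic\<close> with C the limit covariance of
  that path.\<close>

lemma predict_each_worker_optimal:
  assumes \<Lambda>: "pos_def (K - 1) \<Lambda>" and lbar: "0 < lbar" and lam: "0 \<le> lam" and r: "0 < r"
    and fit: "predict_each_worker_fit (space M) K \<Lambda> lam ubar lbar Y uhat lhat"
  shows "AE \<omega> in M.
    (\<lambda>t. \<bar>(\<Sum>k=1..K. nu_hat K vbar ubar lbar r uhat lhat t \<omega> k * Y t \<omega> k)
          - real_cond_exp M (sigma_Y M K Y) (Z t) \<omega>\<bar>) \<longlonglongrightarrow> 0"
proof -
  let ?nuY = "\<lambda>t \<omega>. \<Sum>k=1..K. nu_hat K vbar ubar lbar r uhat lhat t \<omega> k * Y t \<omega> k"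
    and ?wY = "\<lambda>t \<omega>. \<Sum>k=1..K. weights K vbar (Yseq \<omega>) k * Y t \<omega> k"
    and ?E = "\<lambda>t. real_cond_exp M (sigma_Y M K Y) (Z t)"
  \<comment> \<open>Each conditional expectation is determined up to its own null set; there are
    countably many rounds, so one null set covers them all.\<close>
  have "AE \<omega> in M. \<forall>t\<in>{1..}. ?E t \<omega> = ?wY t \<omega>"
    by (rule AE_ball_countable[THEN iffD2]) (simp, intro ballI cond_exp_Z, simp only: atLeast_iff)
  with AE_regular AE_space show ?thesis
  proof eventually_elim
    case (elim \<omega>)
    have Ys: "Yseq \<omega> \<tau> = Y \<tau> \<omega>" if "1 \<le> \<tau>" for \<tau> using that by (simp add: Yseq_def)
    have "(\<lambda>t. ?nuY t \<omega>
        - (\<Sum>k=1..K. solve K (lim_cov (Yseq \<omega>)) (\<lambda>_. vbar) k * Y t \<omega> k)) \<longlonglongrightarrow> 0"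
    proof (rule nu_hat_asymptotic[OF K_pos _ \<Lambda> lbar lam r _ _ fit])
      show "pos_def K (lim_cov (Yseq \<omega>))" using elim(1) by (simp add: regular_def)
      show "\<omega> \<in> space M" by (rule elim(2))
      fix i assume i: "i \<in> {1..K}"
      have "(\<lambda>n. Yseq \<omega> (Suc n) i / real n powr (1/8)) \<longlonglongrightarrow> 0" using elim(1) i unfolding regular_def by blast
      then show "(\<lambda>n. Y (Suc n) \<omega> i / real n powr (1/8)) \<longlonglongrightarrow> 0" by (simp add: Ys)
      fix j assume j: "j \<in> {1..K}"
      have "emp_cov (Yseq \<omega>) n i j = (\<Sum>\<tau>=1..n. Y \<tau> \<omega> i * Y \<tau> \<omega> j) / real n" for n
        unfolding emp_cov_def by (intro arg_cong2[where f = "(/)"] sum.cong refl) (simp add: Ys)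
      moreover have "rconv (\<lambda>n. emp_cov (Yseq \<omega>) n i j) (lim_cov (Yseq \<omega>) i j)"
        using elim(1) i j unfolding regular_def by blast
      ultimately show "rconv (\<lambda>n. (\<Sum>\<tau>=1..n. Y \<tau> \<omega> i * Y \<tau> \<omega> j) / real n) (lim_cov (Yseq \<omega>) i j)"
        by (simp only:)
    qed
    then have "(\<lambda>t. \<bar>?nuY t \<omega>
        - ?wY t \<omega>\<bar>) \<longlonglongrightarrow> 0"
      unfolding weights_def by (rule tendsto_rabs_zero)
    moreover have "eventually (\<lambda>t. \<bar>?nuY t \<omega>
        - ?wY t \<omega>\<bar> =
      \<bar>?nuY t \<omega>
          - ?E t \<omega>\<bar>) sequentially"
      using eventually_ge_at_top[of 1] by eventually_elim (use elim(3) in simp)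
    ultimately show ?case by (rule Lim_transform_eventually)
  qed
qed

end

end

theorem theorem3p3:
  fixes M :: "'a measure" and K :: nat
    and Y :: "nat \<Rightarrow> 'a \<Rightarrow> nat \<Rightarrow> real" and Ytilde :: "nat \<Rightarrow> nat \<Rightarrow> 'a \<Rightarrow> real"
    and Z :: "nat \<Rightarrow> 'a \<Rightarrow> real"
    and N :: "'c measure" and \<theta> :: "'a \<Rightarrow> 'c"
    and QY Q\<Delta> :: "'c \<Rightarrow> (nat \<Rightarrow> real) measure"
    and \<Lambda> :: "nat \<Rightarrow> nat \<Rightarrow> real" and lam ubar lbar r vbar :: real
    and uhat :: "nat \<Rightarrow> nat \<Rightarrow> 'a \<Rightarrow> nat \<Rightarrow> real" and lhat :: "nat \<Rightarrow> nat \<Rightarrow> 'a \<Rightarrow> real"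
  assumes "gaussian_crowd M K Y Ytilde Z N \<theta> QY Q\<Delta>"
    and "\<And>t. 1 \<le> t \<Longrightarrow> vbar = prob_space.variance M (Z t)"
    and "pos_def (K - 1) \<Lambda>" and "0 < lbar" and "0 \<le> lam" and "0 < r"
    and "predict_each_worker_fit (space M) K \<Lambda> lam ubar lbar Y uhat lhat"
  shows "AE \<omega> in M.
    (\<lambda>t. \<bar>(\<Sum>k=1..K. nu_hat K vbar ubar lbar r uhat lhat t \<omega> k * Y t \<omega> k)
          - real_cond_exp M (sigma_Y M K Y) (Z t) \<omega>\<bar>) \<longlonglongrightarrow> 0"
proof -
  interpret gaussian_crowd M K Y Ytilde Z N \<theta> QY Q\<Delta> by (rule assms(1))
  show ?thesis by (rule predict_each_worker_optimal[OF assms(2-7)])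
qed

end
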